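(* Let $F_{ij}$ ($0\le i\le m$, $0\le j\le n$) be a dual-convex $m\times n$ net in $I^3$ whose faces $p_{kl}$ ($0\le k<m$, $0\le l<n$) lie in pairwise non-parallel planes. Then the net is flexible in $I^3$ if and only if at least one of the following conditions holds: (i) for each $0\le k\le m-3$ the $n$ lines $p_{k,0}\cap p_{k+2,0},\ldots,p_{k,n-1}\cap p_{k+2,n-1}$ lie in one isotropic plane, or for each $0\le l\le n-3$ the $m$ lines $p_{0,l}\cap p_{0,l+2},\ldots,p_{m-1,l}\cap p_{m-1,l+2}$ lie in one isotropic plane; (ii) any two non-boundary vertices joined by an edge have equal opposite ratios with respect to that edge.
   Context: $I^3$ is $\mathbb{R}^3$ with coordinates $(x,y,z)$. A vector, line or plane is isotropic if it is parallel to the $z$-axis. The top view $\overline{P}$ of $P=(x,y,z)$ is $(x,y)$. Isotropic congruences are the maps $\mathbf{x}\mapsto A\mathbf{x}+\mathbf{b}$ with $\mathbf b\in\mathbb R^3$ and $A=\begin{pmatrix}\cos\phi&-\sin\phi&0\\ \sin\phi&\cos\phi&0\\ c_1&c_2&1\end{pmatrix}$, $\phi,c_1,c_2\in\mathbb R$. Metric duality: a point $P=(P^1,P^2,P^3)$ corresponds to the non-isotropic plane $P^*\colon z=P^1x+P^2y-P^3$, and a non-isotropic plane $p$ to the point $p^*$ with $(p^* )^*=p$. The isotropic angle $\angle(p,q)$ between non-isotropic planes $z=a_1x+b_1y+c_1$ and $z=a_2x+b_2y+c_2$ is $\sqrt{(a_1-a_2)^2+(b_1-b_2)^2}$. An $m\times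 n$ net ($m,n\ge1$) is a collection of points $F_{ij}\in I^3$, $0\le i\le m$, $0\le j\le n$, such that for all $0\le i<m$, $0\le j<n$ the points $F_{ij},F_{i+1,j},F_{i+1,j+1},F_{i,j+1}$ are consecutive vertices of a convex planar quadrilateral, the face $p_{ij}$ (its plane is also denoted $p_{ij}$); edges are the sides of faces. A vertex $F_{ij}$ with $i\in\{0,m\}$ or $j\in\{0,n\}$ is a boundary vertex; the four consecutive faces around a non-boundary vertex $F_{ij}$ are $p_{i-1,j-1},p_{i,j-1},p_{ij},p_{i-1,j}$. For a convex quadrilateral in a plane and a point $O$ off that plane, the union of rays from $O$ meeting the quadrilateral is a convex 4-hedral angle with vertex $O$; the union of rays from $O$ meeting one side is a flat angle. It is admissible if the isotropic line through $O$ meets its interior. An $m\times n$ net is dual-convex if $m,n\ge2$ and for each non-boundary vertex the planes of its four consecutive faces are the planes of four consecutive flat angles of some admissible convex 4-hedral angle. Curvature: if $p_1,\dots,p_4$ are the consecutive faces around a non-boundary vertex $F_{ij}$ (with non-isotropic planes), $\Omega(F_{ij})=\frac12\sum_{k=1}^4\det(\overline{p_k^*},\overline{p_{k+1}^*})$ with $p_5=p_1$. An isotropic isometric deformation of a dual-convex $m\times n$ net $F_{ij}$ is a continuous family of $m\times n$ nets $F_{ij}(t)$, $t\in[0,1]$, $F_{ij}(0)=F_{ij}$, such that corresponding faces of all $F_{ij}(t)$ are isotropically congruent and corresponding non-boundary vertices of all $F_{ij}(t)$ have the same curvature $\Omega$. It is trivial if for each $t$ there is an isotropic congruence $C_t$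 with $F_{ij}(t)=C_t(F_{ij})$ for all $i,j$. A dual-convex net is flexible in $I^3$ if it has a nontrivial isotropic isometric deformation. Opposite ratio: let $F_{ij}$ be a non-boundary vertex and $e$ an edge emanating from it; enumerate the consecutive faces around $F_{ij}$ as $p_1,p_2,p_3,p_4$ so that $p_1\cap p_4=e$, and let $p$ be the plane spanned by the lines $p_1\cap p_3$ and $p_2\cap p_4$. The opposite ratio of $F_{ij}$ with respect to $e$ is $\frac{\angle(p_1,p)}{\angle(p_3,p)}\cdot\frac{\angle(p_4,p)}{\angle(p_2,p)}$. *)

theory Defs
  imports "HOL-Analysis.Analysis"
begin

text \<open>Points of I^3 are triples (x,y,z); the z-axis is the isotropic direction.\<close>
type_synonym pt = "real \<times> real \<times> real"

definition xc :: "pt \<Rightarrow> real" where "xc p = fst p"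
definition yc :: "pt \<Rightarrow> real" where "yc p = fst (snd p)"
definition zc :: "pt \<Rightarrow> real" where "zc p = snd (snd p)"

definition nplane :: "real \<times> real \<times> real \<Rightarrow> pt set" where
  "nplane q = {p. zc p = fst q * xc p + fst (snd q) * yc p + snd (snd q)}"

definition coeffs :: "pt set \<Rightarrow> real \<times> real \<times> real" where
  "coeffs P = (THE q. nplane q = P)"

definition iso_plane :: "pt set \<Rightarrow> bool" where
  "iso_plane P \<longleftrightarrow> (\<exists>a b c. (a, b) \<noteq> (0, 0) \<and> P = {p. a * xc p + b * yc p = c})"

definition planes_parallel :: "pt set \<Rightarrow> pt set \<Rightarrow> bool" where
  "planes_parallel P Q \<longleftrightarrow> (\<exists>v. Q = (\<lambda>x. v + x) ` P)"

definition convex_quad :: "pt \<Rightarrow> pt \<Rightarrow> pt \<Rightarrow> pt \<Rightarrow> bool" where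
  "convex_quad A B C D \<longleftrightarrow>
     \<not> collinear {A, B, C} \<and> \<not> collinear {B, C, D} \<and> \<not> collinear {C, D, A} \<and>
     \<not> collinear {D, A, B} \<and> open_segment A C \<inter> open_segment B D \<noteq> {}"

text \<open>m x n net (F given as a total function; only indices 0..m, 0..n matter).\<close>
definition is_net :: "nat \<Rightarrow> nat \<Rightarrow> (nat \<Rightarrow> nat \<Rightarrow> pt) \<Rightarrow> bool" where
  "is_net m n F \<longleftrightarrow> m \<ge> 1 \<and> n \<ge> 1 \<and>
     (\<forall>i<m. \<forall>j<n. convex_quad (F i j) (F (Suc i) j) (F (Suc i) (Suc j)) (F i (Suc j)))"

definition face_plane :: "(nat \<Rightarrow> nat \<Rightarrow> pt) \<Rightarrow> nat \<Rightarrow> nat \<Rightarrow> pt set" where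
  "face_plane F i j = affine hull {F i j, F (Suc i) j, F (Suc i) (Suc j), F i (Suc j)}"

definition hedral :: "pt \<Rightarrow> pt \<Rightarrow> pt \<Rightarrow> pt \<Rightarrow> pt \<Rightarrow> pt set" where
  "hedral V A B C D = {V + t *\<^sub>R (q - V) | t q. t \<ge> 0 \<and> q \<in> convex hull {A, B, C, D}}"

definition admissible :: "pt \<Rightarrow> pt \<Rightarrow> pt \<Rightarrow> pt \<Rightarrow> pt \<Rightarrow> bool" where
  "admissible V A B C D \<longleftrightarrow> (\<exists>s. V + (0, 0, s) \<in> interior (hedral V A B C D))"

definition dual_convex :: "nat \<Rightarrow> nat \<Rightarrow> (nat \<Rightarrow> nat \<Rightarrow> pt) \<Rightarrow> bool" where
  "dual_convex m n F \<longleftrightarrow> is_net m n F \<and> m \<ge> 2 \<and> n \<ge> 2 \<and>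
     (\<forall>i j. 0 < i \<and> i < m \<and> 0 < j \<and> j < n \<longrightarrow>
        (\<exists>V A B C D. convex_quad A B C D \<and> V \<notin> affine hull {A, B, C, D} \<and>
            admissible V A B C D \<and>
            face_plane F (i - 1) (j - 1) = affine hull {V, A, B} \<and>
            face_plane F i (j - 1) = affine hull {V, B, C} \<and>
            face_plane F i j = affine hull {V, C, D} \<and>
            face_plane F (i - 1) j = affine hull {V, D, A}))"

definition iang :: "pt set \<Rightarrow> pt set \<Rightarrow> real" where
  "iang P Q = sqrt ((fst (coeffs P) - fst (coeffs Q))\<^sup>2 +
                    (fst (snd (coeffs P)) - fst (snd (coeffs Q)))\<^sup>2)"

text \<open>Top view of the dual point p^* of a non-isotropic plane p: z = a x + b y + c, i.e. (a,b).\<close>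
definition dual_top :: "pt set \<Rightarrow> real \<times> real" where
  "dual_top P = (fst (coeffs P), fst (snd (coeffs P)))"

definition det2 :: "real \<times> real \<Rightarrow> real \<times> real \<Rightarrow> real" where
  "det2 u v = fst u * snd v - snd u * fst v"

definition curv :: "(nat \<Rightarrow> nat \<Rightarrow> pt) \<Rightarrow> nat \<Rightarrow> nat \<Rightarrow> real" where
  "curv F i j = (let t1 = dual_top (face_plane F (i - 1) (j - 1));
                     t2 = dual_top (face_plane F i (j - 1));
                     t3 = dual_top (face_plane F i j);
                     t4 = dual_top (face_plane F (i - 1) j)
                 in (det2 t1 t2 + det2 t2 t3 + det2 t3 t4 + det2 t4 t1) / 2)"

definition iso_cong :: "(pt \<Rightarrow> pt) \<Rightarrow> bool" where
  "iso_cong C \<longleftrightarrow> (\<exists>\<phi> c1 c2 b1 b2 b3. \<forall>x y z.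
      C (x, y, z) = (cos \<phi> * x - sin \<phi> * y + b1, sin \<phi> * x + cos \<phi> * y + b2,
                     c1 * x + c2 * y + z + b3))"

definition iso_deform :: "nat \<Rightarrow> nat \<Rightarrow> (nat \<Rightarrow> nat \<Rightarrow> pt) \<Rightarrow> (real \<Rightarrow> nat \<Rightarrow> nat \<Rightarrow> pt) \<Rightarrow> bool" where
  "iso_deform m n F G \<longleftrightarrow>
     (\<forall>i\<le>m. \<forall>j\<le>n. continuous_on {0..1} (\<lambda>t. G t i j)) \<and>
     (\<forall>i\<le>m. \<forall>j\<le>n. G 0 i j = F i j) \<and>
     (\<forall>t\<in>{0..1}. is_net m n (G t)) \<and>
     (\<forall>t\<in>{0..1}. \<forall>k<m. \<forall>l<n. \<exists>C. iso_cong C \<and>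
          C (F k l) = G t k l \<and> C (F (Suc k) l) = G t (Suc k) l \<and>
          C (F (Suc k) (Suc l)) = G t (Suc k) (Suc l) \<and> C (F k (Suc l)) = G t k (Suc l)) \<and>
     (\<forall>t\<in>{0..1}. \<forall>i j. 0 < i \<and> i < m \<and> 0 < j \<and> j < n \<longrightarrow> curv (G t) i j = curv F i j)"

definition trivial_deform :: "nat \<Rightarrow> nat \<Rightarrow> (nat \<Rightarrow> nat \<Rightarrow> pt) \<Rightarrow> (real \<Rightarrow> nat \<Rightarrow> nat \<Rightarrow> pt) \<Rightarrow> bool" where
  "trivial_deform m n F G \<longleftrightarrow>
     (\<forall>t\<in>{0..1}. \<exists>C. iso_cong C \<and> (\<forall>i\<le>m. \<forall>j\<le>n. G t i j = C (F i j)))"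

definition flexible :: "nat \<Rightarrow> nat \<Rightarrow> (nat \<Rightarrow> nat \<Rightarrow> pt) \<Rightarrow> bool" where
  "flexible m n F \<longleftrightarrow> (\<exists>G. iso_deform m n F G \<and> \<not> trivial_deform m n F G)"

text \<open>Opposite ratio for consecutive faces P1..P4 with P1 \<inter> P4 the edge;
  the plane p is spanned by the lines P1 \<inter> P3 and P2 \<inter> P4.\<close>
definition opp_ratio :: "pt set \<Rightarrow> pt set \<Rightarrow> pt set \<Rightarrow> pt set \<Rightarrow> real" where
  "opp_ratio P1 P2 P3 P4 =
     (let P = affine hull ((P1 \<inter> P3) \<union> (P2 \<inter> P4))
      in (iang P1 P / iang P3 P) * (iang P4 P / iang P2 P))"

text \<open>Opposite ratios of F_ij w.r.t. the edges towards F_{i+1,j}, F_{i-1,j}, F_{i,j+1}, F_{i,j-1}.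
  Around F_ij: f1 = p_{i-1,j-1}, f2 = p_{i,j-1}, f3 = p_ij, f4 = p_{i-1,j}.\<close>
definition orat_ip :: "(nat \<Rightarrow> nat \<Rightarrow> pt) \<Rightarrow> nat \<Rightarrow> nat \<Rightarrow> real" where
  "orat_ip F i j = opp_ratio (face_plane F i j) (face_plane F (i - 1) j)
                             (face_plane F (i - 1) (j - 1)) (face_plane F i (j - 1))"

definition orat_im :: "(nat \<Rightarrow> nat \<Rightarrow> pt) \<Rightarrow> nat \<Rightarrow> nat \<Rightarrow> real" where
  "orat_im F i j = opp_ratio (face_plane F (i - 1) (j - 1)) (face_plane F i (j - 1))
                             (face_plane F i j) (face_plane F (i - 1) j)"

definition orat_jp :: "(nat \<Rightarrow> nat \<Rightarrow> pt) \<Rightarrow> nat \<Rightarrow> nat \<Rightarrow> real" where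
  "orat_jp F i j = opp_ratio (face_plane F (i - 1) j) (face_plane F (i - 1) (j - 1))
                             (face_plane F i (j - 1)) (face_plane F i j)"

definition orat_jm :: "(nat \<Rightarrow> nat \<Rightarrow> pt) \<Rightarrow> nat \<Rightarrow> nat \<Rightarrow> real" where
  "orat_jm F i j = opp_ratio (face_plane F i (j - 1)) (face_plane F i j)
                             (face_plane F (i - 1) j) (face_plane F (i - 1) (j - 1))"

end

theory Submission
  imports
    Defs
    "HOL-Computational_Algebra.Polynomial_Factorial"
    "HOL-Computational_Algebra.Field_as_Ring"
begin

text \<open>A plane $z = ax + by + c$ is recorded by its gradient $(a, b)$. The gradients of the faces form an
  $m \times n$ grid in the plane whose elementary quadrilaterals are strictly convex. Up to a rigid motion of the
  top view, an isotropic isometric deformation keeps the top view of the net fixed, so it becomes a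
  deformation of the gradient grid that keeps all edge directions and the areas of all quadrilaterals.

  In one quadrilateral the scalings of the sides (bottom, top, left, right) are
  $c + h\,(\alpha, 1/\alpha, \beta, 1/\beta)$ with $\alpha > 0 > \beta$ depending on the affine class of the
  quadrilateral, and the area is multiplied by $c^2 - h^2$; hence $c^2 - h^2 = 1$. Opposite ratios are
  $\alpha^{\pm 2}$ and $\beta^{\pm 2}$. Condition (ii) says that all quadrilaterals can share one pair $(c, h)$,
  and (i) says that neighbours in one direction are oblique mirror images of each other, so that every
  strip moves like the first one.

  Conversely, consider four quadrilaterals around a grid point and use the slope $s = c_1 / h_1$ of one of them
  as a parameter. Its two neighbours contribute square roots of quadratic polynomials in $s$; the closing
  condition is then an algebraic relation on infinitely many $s$, which can only hold if one of these quadratics is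
  degenerate, i.e. if two rates at a common side agree. Because $\alpha > 0 > \beta$, the two quadratics are never
  proportional. A case analysis leaves only (ii) and the two mirrored types of a block, and one mirrored
  block that is not of type (ii) forces the whole net to be mirrored.\<close>

subsection \<open>Squares of polynomials\<close>

text \<open>Planes that share an edge have gradients whose difference is perpendicular to the top
  view of that edge; this is why a fixed top view means fixed edge directions in the gradient grid.
  Modulo translation, the quadrilaterals with given side directions form a plane on which area is an
  indefinite quadratic form. Preserving the area is thus motion on a hyperbola, and each side
  scaling is a linear function \<open>c + x * h\<close> of the point \<open>(c, h)\<close>. It takes
  a value at most twice; its derivative along the hyperbola, \<open>h + x * c\<close>, tells the two
  points apart, and keeping the sign of this derivative makes neighbours determine each other. The
  obstacle is \<open>x = 1\<close> or \<open>x = - 1\<close>, which occurs for trapezoids: the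
  function is then isotropic for the area form, the square root in the slope disappears, and the
  other scalings become rational functions of the slope. This accounts for the separate parabolic
  and mixed cases. Moreover, the slope is a quotient by \<open>h\<^sub>1\<close>, whose sign is
  unknown, so the branch inequalities have to be exploited before dividing.\<close>

lemma poly_eq_0_if_infinite_zeros:
  fixes p :: "real poly"
  assumes "infinite S" "\<And>x. x \<in> S \<Longrightarrow> poly p x = 0"
  shows "p = 0"
proof (rule ccontr)
  assume "p \<noteq> 0"
  then have "finite {x. poly p x = 0}" by (rule poly_roots_finite)
  moreover have "S \<subseteq> {x. poly p x = 0}" using assms(2) by auto
  ultimately show False using assms(1) finite_subset by blast
qed

text \<open>Unique factorisation of real polynomials turns \<open>K\<^sup>2 dvd N\<^sup>2\<close>
  into \<open>K dvd N\<close>. A square root that equals a quotient \<open>N / K\<close> at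
  infinitely many arguments thus has a square as radicand.\<close>

lemma square_factor_poly:
  fixes D K N :: "real poly"
  assumes K: "K \<noteq> 0" and eq: "N\<^sup>2 = K\<^sup>2 * D"
  obtains M where "D = M\<^sup>2"
proof -
  have "K\<^sup>2 dvd N\<^sup>2" using eq by simp
  then have "K dvd N" by (simp add: pow_divides_pow_iff)
  then obtain M where "N = K * M" by (auto elim: dvdE)
  then have "K\<^sup>2 * M\<^sup>2 = K\<^sup>2 * D" using eq by (simp add: power_mult_distrib)
  then have "D = M\<^sup>2" using K by simp
  then show ?thesis by (rule that)
qed

lemma quadratic_square_disc:
  fixes M :: "real poly"
  assumes eq: "[:e, 2 * f, g:] = M\<^sup>2" and g: "g \<noteq> 0"
  shows "f\<^sup>2 = e * g"
proof -
  have "degree (M\<^sup>2) = 2" using g by (simp flip: eq)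
  then have dM: "degree M = 1" by (cases "M = 0") (auto simp: degree_power_eq)
  then obtain u v where M: "M = [:u, v:]"
    by (metis One_nat_def degree_eq_zeroE degree_pCons_eq_if nat.inject pCons_cases zero_neq_one)
  have "[:e, 2 * f, g:] = [:u * u, 2 * (u * v), v * v:]"
    unfolding eq M by (simp add: power2_eq_square algebra_simps)
  then show ?thesis by (simp add: power2_eq_square)
qed

text \<open>Over the complex numbers each factor has two distinct roots, and a square has only even
  multiplicities, so the factors share their roots; the conclusion compares the root sums. Comparing
  coefficients avoids complex roots.\<close>

lemma quadratic_product_square:
  fixes M :: "real poly"
  assumes eq: "[:e1, 2 * f1, g1:] * [:e2, 2 * f2, g2:] = M\<^sup>2" and g: "g1 \<noteq> 0" "g2 \<noteq> 0"
    and d: "f1\<^sup>2 \<noteq> e1 * g1" "f2\<^sup>2 \<noteq> e2 * g2"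
  shows "f1 * g2 = f2 * g1"
proof -
  have "degree (M\<^sup>2) = 4" using g by (simp add: degree_mult_eq flip: eq)
  then have dM: "degree M = 2" by (cases "M = 0") (auto simp: degree_power_eq)
  define x y z where "x = coeff M 0" "y = coeff M 1" "z = coeff M 2"
  have M: "M = [:x, y, z:]"
    by (rule poly_eqI)
      (auto simp: x_y_z_def coeff_pCons numeral_2_eq_2 dM le_degree intro!: coeff_eq_0 split: nat.splits)
  have "[:e1 * e2, 2 * (e1 * f2 + f1 * e2), e1 * g2 + 4 * f1 * f2 + g1 * e2, 2 * (f1 * g2 + g1 * f2), g1 * g2:]
     = [:x * x, 2 * (x * y), y * y + 2 * (x * z), 2 * (y * z), z * z:]"
    using eq unfolding M by (simp add: power2_eq_square algebra_simps)
  then have E: "e1 * e2 = x * x" "e1 * f2 + f1 * e2 = x * y" "e1 * g2 + 4 * f1 * f2 + g1 * e2 = y * y + 2 * (x * z)"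
     "f1 * g2 + g1 * f2 = y * z" "g1 * g2 = z * z" by auto
  have z: "z \<noteq> 0" using E(5) g by auto
  define F1 E1 F2 E2 X Y where "F1 = f1 / g1" "E1 = e1 / g1" "F2 = f2 / g2" "E2 = e2 / g2" "X = x / z" "Y = y / z"
  have s: "f1 = F1 * g1" "e1 = E1 * g1" "f2 = F2 * g2" "e2 = E2 * g2" "x = X * z" "y = Y * z"
    using g z by (auto simp: F1_E1_F2_E2_X_Y_def)
  have z2: "z * z \<noteq> 0" using z by simp
  have "z * z * (E1 * E2) = z * z * (X * X)" using E(1,5) unfolding s by algebra
  moreover have "z * z * (E1 * F2 + F1 * E2) = z * z * (X * Y)" using E(2,5) unfolding s by algebra
  moreover have "z * z * (E1 + 4 * F1 * F2 + E2) = z * z * (Y * Y + 2 * X)" using E(3,5) unfolding s by algebra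
  moreover have "z * z * (F1 + F2) = z * z * Y" using E(4,5) unfolding s by algebra
  ultimately have R: "E1 * E2 = X * X" "E1 * F2 + F1 * E2 = X * Y" "E1 + 4 * F1 * F2 + E2 = Y * Y + 2 * X" "F1 + F2 = Y"
    using z2 by auto
  define d1 d2 where "d1 = F1\<^sup>2 - E1" "d2 = F2\<^sup>2 - E2"
  have e: "E1 = F1\<^sup>2 - d1" "E2 = F2\<^sup>2 - d2" by (auto simp: d1_d2_def)
  have dn: "d1 \<noteq> 0" "d2 \<noteq> 0"
    using d g by (auto simp: d1_d2_def s power2_eq_square field_simps)
  have X: "X = F1 * F2 - (d1 + d2) / 2" using R(3) unfolding R(4)[symmetric] e by algebra
  have "(F1 - F2) * (d1 - d2) = 0" using R(2) unfolding R(4)[symmetric] X e by algebra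
  moreover have "F1 = F2" if "d1 = d2"
  proof -
    have "d1 * (F1 - F2)\<^sup>2 = 0" using R(1) unfolding X e that by algebra
    then show ?thesis using dn by simp
  qed
  ultimately have "F1 = F2" by auto
  then show ?thesis by (simp add: s)
qed

text \<open>Squaring twice turns the relation into $(R^2 - \tau^2 D_2)(S^2 - \tau^2 D_1) = 0$ unless
  $D_1 D_2$ is a square up to square factors.\<close>

lemma biquadratic_relation:
  fixes P R S :: "real poly" and \<tau> :: real
  assumes D: "D1 = [:e1, 2 * f1, g1:]" "D2 = [:e2, 2 * f2, g2:]"
    and inf: "infinite I" and \<tau>: "\<tau> \<noteq> 0" and g: "g1 \<noteq> 0" "g2 \<noteq> 0"
    and rel: "\<And>s. s \<in> I \<Longrightarrow> \<exists>y x. y\<^sup>2 = poly D1 s \<and> x\<^sup>2 = poly D2 s \<and>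
        poly P s + poly R s * y + poly S s * x + \<tau> * (x * y) = 0"
  shows "f1\<^sup>2 = e1 * g1 \<or> f2\<^sup>2 = e2 * g2 \<or> f1 * g2 = f2 * g1"
proof -
  \<comment> \<open>Squaring \<open>P + \<tau> * (x * y) = - (R * y + S * x)\<close> leaves
    \<open>x * y\<close> as the only irrational quantity: \<open>N = K * (x * y)\<close>.\<close>
  define N K where "N = P\<^sup>2 + [:\<tau>\<^sup>2:] * D1 * D2 - R\<^sup>2 * D1 - S\<^sup>2 * D2" "K = 2 * (R * S - P * [:\<tau>:])"
  have "poly (N\<^sup>2 - K\<^sup>2 * (D1 * D2)) s = 0" if s: "s \<in> I" for s
  proof -
    obtain y x where y: "y\<^sup>2 = poly D1 s" and x: "x\<^sup>2 = poly D2 s" and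
      r: "poly P s + poly R s * y + poly S s * x + \<tau> * (x * y) = 0" using rel[OF s] by blast
    have "(poly P s + \<tau> * (x * y))\<^sup>2 = (poly R s * y + poly S s * x)\<^sup>2" using r by algebra
    then have "poly N s = poly K s * (x * y)"
      unfolding N_K_def by (simp add: y[symmetric] x[symmetric]) algebra
    then show ?thesis by (simp add: power_mult_distrib y x)
  qed
  then have N: "N\<^sup>2 = K\<^sup>2 * (D1 * D2)" using poly_eq_0_if_infinite_zeros[OF inf] by fastforce
  show ?thesis
  proof (cases "K = 0")
    case False
    obtain M where "D1 * D2 = M\<^sup>2" using square_factor_poly[OF False N] by blast
    then show ?thesis using quadratic_product_square g D by metis
  next
    case True
    \<comment> \<open>Now \<open>R * S = \<tau> * P\<close>, so \<open>\<tau>\<close> times the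
      relation is \<open>(R + \<tau> * x) * (S + \<tau> * y)\<close>; the product derived below is
      its norm, and a vanishing factor makes one radicand a square.\<close>
    then have N0: "P\<^sup>2 + [:\<tau>\<^sup>2:] * D1 * D2 = R\<^sup>2 * D1 + S\<^sup>2 * D2" and K0: "R * S = P * [:\<tau>:]"
      using N unfolding N_K_def by (auto simp del: mult_pCons_left mult_pCons_right)
    have t2: "[:\<tau>\<^sup>2:] = [:\<tau>:]\<^sup>2" by (simp add: power2_eq_square)
    have "(R\<^sup>2 - [:\<tau>:]\<^sup>2 * D2) * (S\<^sup>2 - [:\<tau>:]\<^sup>2 * D1) = 0"
      using N0 K0 unfolding t2 by algebra
    moreover have t0: "[:\<tau>:] \<noteq> 0" using \<tau> by simp
    ultimately consider "R\<^sup>2 = [:\<tau>:]\<^sup>2 * D2" | "S\<^sup>2 = [:\<tau>:]\<^sup>2 * D1" by auto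
    then show ?thesis
      using square_factor_poly[OF t0] quadratic_square_disc g unfolding D by metis
  qed
qed

subsection \<open>Closed chains of four quadrilaterals\<close>

text \<open>With \<open>c = cosh u\<close> and \<open>h = sinh u\<close>, \<open>h + x * c\<close>
  is the derivative of the scaling \<open>c + x * h\<close>. Its prescribed signs at the rates
  \<open>a\<close> and \<open>b\<close> fix a branch, and the infinite range of \<open>h\<close>
  turns relations that hold along \<open>T\<close> into polynomial identities.\<close>

definition motion :: "'t set \<Rightarrow> real \<Rightarrow> real \<Rightarrow> ('t \<Rightarrow> real) \<Rightarrow> ('t \<Rightarrow> real) \<Rightarrow> bool" where
  "motion T a b c h \<longleftrightarrow> b < 0 \<and> 0 < a \<and> infinite (h ` T) \<and>
     (\<forall>t\<in>T. 0 < c t \<and> (c t)\<^sup>2 = 1 + (h t)\<^sup>2 \<and> 0 < h t + a * c t \<and> h t + b * c t < 0)"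

definition block_motion where
  "block_motion T a1 b1 c1 h1 a2 b2 c2 h2 a3 b3 c3 h3 a4 b4 c4 h4 \<longleftrightarrow>
     motion T a1 b1 c1 h1 \<and> motion T a2 b2 c2 h2 \<and> motion T a3 b3 c3 h3 \<and> motion T a4 b4 c4 h4 \<and>
     (\<forall>t\<in>T. c1 t + b1 * h1 t = c2 t + b2 * h2 t \<and> c2 t + a2 * h2 t = c3 t + a3 * h3 t \<and>
       c3 t + b3 * h3 t = c4 t + b4 * h4 t \<and> c4 t + a4 * h4 t = c1 t + a1 * h1 t)"

text \<open>Since \<open>c + x * h = c + (- x) * (- h)\<close>, negating \<open>h\<close> exchanges
  the positive and the negative rate. This makes a block rotated by one place a block again, so that
  one position of each case suffices.\<close>

lemma motion_reverse: "motion T a b c h \<Longrightarrow> motion T (- b) (- a) c (\<lambda>t. - h t)"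
proof -
  assume m: "motion T a b c h"
  have "(\<lambda>t. - h t) ` T = uminus ` (h ` T)" by auto
  moreover have "infinite (uminus ` (h ` T))"
    using m finite_imageD[of uminus "h ` T"] by (auto simp: motion_def)
  ultimately show ?thesis using m by (auto simp: motion_def)
qed

lemma block_motion_rotate:
  "block_motion T a1 b1 c1 h1 a2 b2 c2 h2 a3 b3 c3 h3 a4 b4 c4 h4 \<Longrightarrow>
   block_motion T (-b2) (-a2) c2 (\<lambda>t. - h2 t) (-b3) (-a3) c3 (\<lambda>t. - h3 t)
     (-b4) (-a4) c4 (\<lambda>t. - h4 t) (-b1) (-a1) c1 (\<lambda>t. - h1 t)"
  unfolding block_motion_def by (auto intro: motion_reverse)

lemma block_motion_reflect:
  "block_motion T a1 b1 c1 h1 a2 b2 c2 h2 a3 b3 c3 h3 a4 b4 c4 h4 \<Longrightarrow>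
   block_motion T a2 b2 c2 h2 a1 b1 c1 h1 a4 b4 c4 h4 a3 b3 c3 h3"
  unfolding block_motion_def by auto

text \<open>A line \<open>c + b * h = const\<close> meets the hyperbola in at most two points, and
  at two distinct ones \<open>h + b * c\<close> takes opposite values.\<close>

lemma branch_unique:
  fixes b :: real
  assumes "c1\<^sup>2 = 1 + h1\<^sup>2" "c2\<^sup>2 = 1 + h2\<^sup>2" "c1 + b * h1 = c2 + b * h2"
    and "h1 + b * c1 < 0 \<and> h2 + b * c2 < 0 \<or> 0 < h1 + b * c1 \<and> 0 < h2 + b * c2"
  shows "h1 = h2 \<and> c1 = c2"
proof -
  have "(h1 - h2) * ((h1 + b * c1) + (h2 + b * c2)) = 0" using assms(1-3) by algebra
  then have "h1 = h2" using assms(4) by auto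
  then show ?thesis using assms(3) by simp
qed

text \<open>The capital letters stand for \<open>c\<close> and \<open>h\<close> of quadrilaterals 2,
  3, 4 divided by \<open>h1\<close>; then \<open>1 / h1\<^sup>2 = s\<^sup>2 - 1\<close>. The last
  line keeps what is later used of the branches: the inequalities of \<open>motion\<close> do not
  survive division by a number of unknown sign, but equal rates at a common side give equal
  parameters beforehand.\<close>

definition slope_rel ::
    "real \<Rightarrow> real \<Rightarrow> real \<Rightarrow> real \<Rightarrow> real \<Rightarrow> real \<Rightarrow> real \<Rightarrow> real \<Rightarrow> real \<Rightarrow> real \<Rightarrow> real \<Rightarrow> real \<Rightarrow> real \<Rightarrow> real \<Rightarrow> real \<Rightarrow> bool"
where
  "slope_rel a1 b1 a2 b2 a3 b3 a4 b4 s C2 H2 C3 H3 C4 H4 \<longleftrightarrow>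
     C2\<^sup>2 - H2\<^sup>2 = s\<^sup>2 - 1 \<and> C3\<^sup>2 - H3\<^sup>2 = s\<^sup>2 - 1 \<and> C4\<^sup>2 - H4\<^sup>2 = s\<^sup>2 - 1 \<and>
     s + b1 = C2 + b2 * H2 \<and> C2 + a2 * H2 = C3 + a3 * H3 \<and>
     C3 + b3 * H3 = C4 + b4 * H4 \<and> C4 + a4 * H4 = s + a1 \<and>
     (b1 = b2 \<longrightarrow> C2 = s \<and> H2 = 1) \<and> (a1 = a4 \<longrightarrow> C4 = s \<and> H4 = 1)"

text \<open>Dividing all coordinates by $h_1$ makes the parameters of the first quadrilateral linear in
  the slope $s = c_1 / h_1$.\<close>

lemma block_motion_slopes:
  assumes "block_motion T a1 b1 c1 h1 a2 b2 c2 h2 a3 b3 c3 h3 a4 b4 c4 h4"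
  obtains I where "infinite I"
    "\<And>s. s \<in> I \<Longrightarrow> \<exists>C2 H2 C3 H3 C4 H4. slope_rel a1 b1 a2 b2 a3 b3 a4 b4 s C2 H2 C3 H3 C4 H4"
proof
  let ?T = "{t \<in> T. h1 t \<noteq> 0}"
  let ?s = "\<lambda>t. c1 t / h1 t"
  have m: "c1 t > 0" "(c1 t)\<^sup>2 = 1 + (h1 t)\<^sup>2" if "t \<in> T" for t
    using assms that by (auto simp: block_motion_def motion_def)
  \<comment> \<open>The slope determines \<open>h1\<close>: \<open>s\<^sup>2 - 1\<close> is
    \<open>1 / h1\<^sup>2\<close>, and \<open>0 < c1\<close> gives \<open>s\<close> the sign of
    \<open>h1\<close>. Hence infinitely many values of \<open>h1\<close> yield infinitely many
    slopes.\<close>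
  have h_of: "h1 t = h1 t'" if t: "t \<in> ?T" "t' \<in> ?T" and e: "?s t = ?s t'" for t t'
  proof -
    have n: "h1 t \<noteq> 0" "h1 t' \<noteq> 0" using t by auto
    have cr: "c1 t * h1 t' = c1 t' * h1 t" using e n by (simp add: field_simps)
    then have "(1 + (h1 t)\<^sup>2) * (h1 t')\<^sup>2 = (1 + (h1 t')\<^sup>2) * (h1 t)\<^sup>2"
      using m[of t] m[of t'] t by (metis (mono_tags, lifting) mem_Collect_eq power_mult_distrib)
    then have "(h1 t)\<^sup>2 = (h1 t')\<^sup>2" by (simp add: algebra_simps)
    then consider "h1 t = h1 t'" | "h1 t = - h1 t'" using power2_eq_iff by blast
    then show ?thesis
    proof cases
      case 2
      then have "(c1 t + c1 t') * h1 t' = 0" using cr by (simp add: algebra_simps)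
      then have "c1 t = - c1 t'" using n by simp
      then show ?thesis using m[of t] m[of t'] t by auto
    qed
  qed
  have "infinite (h1 ` T)" using assms by (simp add: block_motion_def motion_def)
  moreover have "h1 ` T \<subseteq> insert 0 (h1 ` ?T)" by auto
  ultimately have inf: "infinite (h1 ` ?T)" by (meson finite_insert finite_subset)
  show "infinite (?s ` ?T)"
  proof
    assume "finite (?s ` ?T)"
    then obtain U where U: "finite U" "U \<subseteq> ?T" "?s ` ?T = ?s ` U"
      by (meson finite_subset_image order_refl)
    have "h1 ` ?T \<subseteq> h1 ` U" 
    proof clarify
      fix t assume t: "t \<in> T" "h1 t \<noteq> 0"
      then have "?s t \<in> ?s ` U" using U(3) by blast
      then obtain u where "u \<in> U" "?s t = ?s u" by blast
      then show "h1 t \<in> h1 ` U" using h_of[of t u] t U(2) by auto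
    qed
    then show False using inf U(1) by (meson finite_imageI finite_subset)
  qed
  fix s assume "s \<in> ?s ` ?T"
  then obtain t where t: "t \<in> T" "h1 t \<noteq> 0" and s: "s = c1 t / h1 t" by auto
  have q: "(c2 t)\<^sup>2 = 1 + (h2 t)\<^sup>2" "(c3 t)\<^sup>2 = 1 + (h3 t)\<^sup>2" "(c4 t)\<^sup>2 = 1 + (h4 t)\<^sup>2"
     "c1 t + b1 * h1 t = c2 t + b2 * h2 t" "c2 t + a2 * h2 t = c3 t + a3 * h3 t"
     "c3 t + b3 * h3 t = c4 t + b4 * h4 t" "c4 t + a4 * h4 t = c1 t + a1 * h1 t"
    using assms t(1) by (auto simp: block_motion_def motion_def)
  have br: "h1 t + b1 * c1 t < 0" "h2 t + b2 * c2 t < 0" "0 < h1 t + a1 * c1 t" "0 < h4 t + a4 * c4 t"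
    using assms t(1) by (auto simp: block_motion_def motion_def)
  have e2: "b1 = b2 \<longrightarrow> c2 t / h1 t = s \<and> h2 t / h1 t = 1"
    using branch_unique[OF m(2)[OF t(1)] q(1), of b2] q(4) br t(2) by (auto simp: s)
  have e4: "a1 = a4 \<longrightarrow> c4 t / h1 t = s \<and> h4 t / h1 t = 1"
    using branch_unique[OF m(2)[OF t(1)] q(3), of a4] q(7) br t(2) by (auto simp: s)
  have sc: "(u / h1 t)\<^sup>2 - (v / h1 t)\<^sup>2 = s\<^sup>2 - 1" if "u\<^sup>2 = 1 + v\<^sup>2" for u v
    using t(2) that m(2)[OF t(1)] unfolding s by (simp add: field_simps)
  have lin: "u / h1 t + k * (v / h1 t) = (u + k * v) / h1 t" for u v k by (simp add: add_divide_distrib)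
  have s1: "s + k = (c1 t + k * h1 t) / h1 t" for k unfolding s using t(2) by (simp add: add_divide_distrib)
  have "s + b1 = c2 t / h1 t + b2 * (h2 t / h1 t)"
      "c2 t / h1 t + a2 * (h2 t / h1 t) = c3 t / h1 t + a3 * (h3 t / h1 t)"
      "c3 t / h1 t + b3 * (h3 t / h1 t) = c4 t / h1 t + b4 * (h4 t / h1 t)"
      "c4 t / h1 t + a4 * (h4 t / h1 t) = s + a1"
    unfolding lin s1 q(4-7) by (rule refl)+
  then have "slope_rel a1 b1 a2 b2 a3 b3 a4 b4 s
      (c2 t / h1 t) (h2 t / h1 t) (c3 t / h1 t) (h3 t / h1 t) (c4 t / h1 t) (h4 t / h1 t)"
    unfolding slope_rel_def using sc[OF q(1)] sc[OF q(2)] sc[OF q(3)] e2 e4 by blast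
  then show "\<exists>C2 H2 C3 H3 C4 H4. slope_rel a1 b1 a2 b2 a3 b3 a4 b4 s C2 H2 C3 H3 C4 H4" by blast
qed

text \<open>By \<open>(C + k * H)\<^sup>2 - (H + k * C)\<^sup>2 = (1 - k\<^sup>2) * (C\<^sup>2 -
  H\<^sup>2)\<close>, prescribing \<open>C + k * H\<close> makes \<open>H + k * C\<close> a square
  root of a quadratic in \<open>s\<close>. Together they express every other scaling, unless
  \<open>k\<^sup>2 = 1\<close>.\<close>

lemma slope_square:
  fixes C :: real
  assumes "C\<^sup>2 - H\<^sup>2 = s\<^sup>2 - 1" "C + k * H = s + l"
  shows "(H + k * C)\<^sup>2 = poly [:l\<^sup>2 + 1 - k\<^sup>2, 2 * l, k\<^sup>2:] s"
    "(1 - k\<^sup>2) * (C + j * H) = (1 - j * k) * (s + l) + (j - k) * (H + k * C)"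
proof -
  have "C\<^sup>2 = H\<^sup>2 + s\<^sup>2 - 1" using assms by simp
  then have "(H + k * C)\<^sup>2 = (s + l)\<^sup>2 - (1 - k\<^sup>2) * (s\<^sup>2 - 1)"
    unfolding assms(2)[symmetric] by algebra
  then show "(H + k * C)\<^sup>2 = poly [:l\<^sup>2 + 1 - k\<^sup>2, 2 * l, k\<^sup>2:] s"
    by (simp add: algebra_simps power2_eq_square)
  show "(1 - k\<^sup>2) * (C + j * H) = (1 - j * k) * (s + l) + (j - k) * (H + k * C)"
    unfolding assms(2)[symmetric] by (simp add: algebra_simps power2_eq_square)
qed

text \<open>The discriminant factors as \<open>(l\<^sup>2 - k\<^sup>2) * (1 - k\<^sup>2)\<close>;
  equal signs of \<open>k\<close> and \<open>l\<close> exclude \<open>l = - k\<close>.\<close>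

lemma slope_disc:
  fixes k l :: real
  assumes "k \<noteq> 0" "l\<^sup>2 = (l\<^sup>2 + 1 - k\<^sup>2) * k\<^sup>2" "0 < k * l"
  shows "k = l \<or> k\<^sup>2 = 1"
proof -
  have "(l\<^sup>2 - k\<^sup>2) * (1 - k\<^sup>2) = 0" using assms(2) by algebra
  then show ?thesis using assms(3) power2_eq_iff[of l k] 
    by (auto simp: zero_less_mult_iff)
qed

text \<open>The two neighbours of the first quadrilateral contribute the roots \<open>y\<close> and
  \<open>x\<close>. The third receives from them \<open>C3 + a3 * H3\<close>, linear in
  \<open>s\<close> and \<open>y\<close>, and \<open>C3 + b3 * H3\<close>, linear in \<open>s\<close>
  and \<open>x\<close>, and its hyperbola equation ties these two values together by a quadratic
  relation.\<close>

lemma block_generic: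
  assumes bm: "block_motion T a1 b1 c1 h1 a2 b2 c2 h2 a3 b3 c3 h3 a4 b4 c4 h4"
    and n: "b2 \<noteq> - 1" "a4 \<noteq> 1"
  shows "b1 = b2 \<or> a1 = a4"
proof -
  obtain I where inf: "infinite I" and I: "\<And>s. s \<in> I \<Longrightarrow> \<exists>C2 H2 C3 H3 C4 H4. slope_rel a1 b1 a2 b2 a3 b3 a4 b4 s C2 H2 C3 H3 C4 H4"
    using block_motion_slopes[OF bm] by blast
  have sg: "b1 < 0" "b2 < 0" "b3 < 0" "b4 < 0" "0 < a1" "0 < a2" "0 < a3" "0 < a4"
    using bm by (auto simp: block_motion_def motion_def)
  define A B where "A = 1 - a4\<^sup>2" "B = 1 - b2\<^sup>2"
  have AB: "A \<noteq> 0" "B \<noteq> 0" using n sg by (auto simp: A_B_def power2_eq_1_iff)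
  \<comment> \<open>Up to the factors \<open>A\<close> and \<open>B\<close> that clear denominators,
    these are the coefficients of \<open>(b3 - a3)\<^sup>2 * (C3\<^sup>2 - H3\<^sup>2)\<close> as a
    quadratic form in \<open>C3 + a3 * H3\<close> and \<open>C3 + b3 * H3\<close>.\<close>
  define u v w where "u = (b3\<^sup>2 - 1) * A\<^sup>2" "v = - 2 * (a3 * b3 - 1) * A * B" "w = (a3\<^sup>2 - 1) * B\<^sup>2"
  define k m k' m' where "k = 1 - a2 * b2" "m = a2 - b2" "k' = 1 - a4 * b4" "m' = b4 - a4"
  define D2 D4 where "D2 = [:b1\<^sup>2 + 1 - b2\<^sup>2, 2 * b1, b2\<^sup>2:]" "D4 = [:a1\<^sup>2 + 1 - a4\<^sup>2, 2 * a1, a4\<^sup>2:]"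
  define X Y where "X = [:a1, 1:]" "Y = [:b1, 1:]"
  define P R S where
    "P = [:u:] * ([:k\<^sup>2:] * Y\<^sup>2 + [:m\<^sup>2:] * D2) + [:v * k * k':] * X * Y + [:w:] * ([:k'\<^sup>2:] * X\<^sup>2 + [:m'\<^sup>2:] * D4)
         - [:(b3 - a3)\<^sup>2 * A\<^sup>2 * B\<^sup>2:] * [:-1, 0, 1:]"
    "R = [:2 * u * k * m:] * Y + [:v * m * k':] * X"
    "S = [:v * k * m':] * Y + [:2 * w * k' * m':] * X"
  have "b1\<^sup>2 = (b1\<^sup>2 + 1 - b2\<^sup>2) * b2\<^sup>2 \<or> a1\<^sup>2 = (a1\<^sup>2 + 1 - a4\<^sup>2) * a4\<^sup>2 \<or> b1 * a4\<^sup>2 = a1 * b2\<^sup>2"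
  proof (rule biquadratic_relation[OF D2_D4_def inf, of "v * m * m'" P R S])
    \<comment> \<open>Opposite signs of the rates keep \<open>a3 * b3\<close> away from 1, so the
      term in \<open>x * y\<close> is really present.\<close>
    have "a3 * b3 < 0" using sg by (simp add: mult_pos_neg)
    then show "v * m * m' \<noteq> 0" using AB sg by (auto simp: u_v_w_def k_m_k'_m'_def)
    show "b2\<^sup>2 \<noteq> 0" "a4\<^sup>2 \<noteq> 0" using sg by auto
    fix s assume "s \<in> I"
    then obtain C2 H2 C3 H3 C4 H4 where q: "C2\<^sup>2 - H2\<^sup>2 = s\<^sup>2 - 1" "C3\<^sup>2 - H3\<^sup>2 = s\<^sup>2 - 1"
       "C4\<^sup>2 - H4\<^sup>2 = s\<^sup>2 - 1" and l: "s + b1 = C2 + b2 * H2" "C2 + a2 * H2 = C3 + a3 * H3"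
       "C3 + b3 * H3 = C4 + b4 * H4" "C4 + a4 * H4 = s + a1" using I unfolding slope_rel_def by blast
    define y x where "y = H2 + b2 * C2" "x = H4 + a4 * C4"
    have y: "y\<^sup>2 = poly D2 s" and x: "x\<^sup>2 = poly D4 s"
      unfolding y_x_def D2_D4_def using slope_square(1) q l by metis+
    have Z: "B * (C3 + a3 * H3) = k * (s + b1) + m * y"
      using slope_square(2)[OF q(1) l(1)[symmetric], of a2] unfolding A_B_def k_m_k'_m'_def l(2) y_x_def by simp
    have W: "A * (C3 + b3 * H3) = k' * (s + a1) + m' * x"
      using slope_square(2)[OF q(3) l(4), of b4] unfolding A_B_def k_m_k'_m'_def l(3) y_x_def by (simp add: mult.commute)
    have "(b3\<^sup>2 - 1) * (C3 + a3 * H3)\<^sup>2 - 2 * (a3 * b3 - 1) * ((C3 + a3 * H3) * (C3 + b3 * H3)) + (a3\<^sup>2 - 1) * (C3 + b3 * H3)\<^sup>2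
        = (b3 - a3)\<^sup>2 * (C3\<^sup>2 - H3\<^sup>2)" by algebra
    then have "u * (B * (C3 + a3 * H3))\<^sup>2 + v * ((B * (C3 + a3 * H3)) * (A * (C3 + b3 * H3))) + w * (A * (C3 + b3 * H3))\<^sup>2
        = (b3 - a3)\<^sup>2 * A\<^sup>2 * B\<^sup>2 * (s\<^sup>2 - 1)" unfolding q(2) u_v_w_def by algebra
    then have E: "u * (k * (s + b1) + m * y)\<^sup>2 + v * ((k * (s + b1) + m * y) * (k' * (s + a1) + m' * x)) + w * (k' * (s + a1) + m' * x)\<^sup>2
        = (b3 - a3)\<^sup>2 * A\<^sup>2 * B\<^sup>2 * (s\<^sup>2 - 1)" unfolding Z W .
    have pX: "poly X s = s + a1" "poly Y s = s + b1" by (auto simp: X_Y_def)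
    have pP: "poly P s = u * (k\<^sup>2 * (s + b1)\<^sup>2 + m\<^sup>2 * y\<^sup>2) + v * k * k' * (s + a1) * (s + b1) + w * (k'\<^sup>2 * (s + a1)\<^sup>2 + m'\<^sup>2 * x\<^sup>2)
         - (b3 - a3)\<^sup>2 * A\<^sup>2 * B\<^sup>2 * (s\<^sup>2 - 1)"
      "poly R s = 2 * u * k * m * (s + b1) + v * m * k' * (s + a1)"
      "poly S s = v * k * m' * (s + b1) + 2 * w * k' * m' * (s + a1)"
      unfolding P_R_S_def poly_add poly_mult poly_diff poly_power pX x y by (simp_all add: power2_eq_square)
    have "poly P s + poly R s * y + poly S s * x + v * m * m' * (x * y) = 0"
      unfolding pP using E by algebra
    then show "\<exists>y x. y\<^sup>2 = poly D2 s \<and> x\<^sup>2 = poly D4 s \<and> poly P s + poly R s * y + poly S s * x + v * m * m' * (x * y) = 0"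
      using x y by blast
  qed
  moreover have "b1 * a4\<^sup>2 < 0" "0 < a1 * b2\<^sup>2" using sg by (auto simp: mult_neg_pos)
  ultimately show ?thesis
    using slope_disc[of b2 b1] slope_disc[of a4 a1] sg n
    by (auto simp: zero_less_mult_iff power2_eq_1_iff)
qed


lemma poly_eq_if_infinite:
  fixes p q :: "real poly"
  assumes "infinite S" "\<And>x. x \<in> S \<Longrightarrow> poly p x = poly q x"
  shows "p = q"
  using poly_eq_0_if_infinite_zeros[of S "p - q"] assms by simp

lemma rational_root_degenerate:
  fixes N K :: "real poly"
  assumes inf: "infinite I" and K: "K \<noteq> 0" and k: "0 < k * l"
    and rel: "\<And>s. s \<in> I \<Longrightarrow> \<exists>x. x\<^sup>2 = poly [:l\<^sup>2 + 1 - k\<^sup>2, 2 * l, k\<^sup>2:] s \<and> poly N s = poly K s * x"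
  shows "k = l \<or> k\<^sup>2 = 1"
proof -
  have "N\<^sup>2 = K\<^sup>2 * [:l\<^sup>2 + 1 - k\<^sup>2, 2 * l, k\<^sup>2:]"
  proof (rule poly_eq_if_infinite[OF inf])
    fix s assume "s \<in> I"
    then obtain x where "x\<^sup>2 = poly [:l\<^sup>2 + 1 - k\<^sup>2, 2 * l, k\<^sup>2:] s" "poly N s = poly K s * x"
      using rel by blast
    then show "poly (N\<^sup>2) s = poly (K\<^sup>2 * [:l\<^sup>2 + 1 - k\<^sup>2, 2 * l, k\<^sup>2:]) s"
      by (simp only: poly_power poly_mult power_mult_distrib)
  qed
  then obtain M where "[:l\<^sup>2 + 1 - k\<^sup>2, 2 * l, k\<^sup>2:] = M\<^sup>2" using square_factor_poly[OF K] by blast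
  moreover have "k \<noteq> 0" using k by auto
  ultimately show ?thesis using quadratic_square_disc slope_disc k by (metis zero_eq_power2)
qed

text \<open>For \<open>b2 = - 1\<close> the first link prescribes \<open>C2 - H2\<close>, and
  \<open>C2 + H2 = (s\<^sup>2 - 1) / (C2 - H2)\<close> is rational in \<open>s\<close>;
  \<open>a3 = 1\<close> has the same effect on the third quadrilateral. Only the root of the fourth
  remains, and the closing condition makes it rational.\<close>

lemma block_parabolic:
  assumes bm: "block_motion T a1 b1 c1 h1 a2 b2 c2 h2 a3 b3 c3 h3 a4 b4 c4 h4"
    and n: "b2 = - 1" "a3 = 1" "a4 \<noteq> 1" "b1 \<noteq> - 1"
  shows "a1 = a4"
proof -
  obtain I where inf: "infinite I" and
    I: "\<And>s. s \<in> I \<Longrightarrow> \<exists>C2 H2 C3 H3 C4 H4. slope_rel a1 b1 a2 b2 a3 b3 a4 b4 s C2 H2 C3 H3 C4 H4"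
    using block_motion_slopes[OF bm] by blast
  have sg: "b1 < 0" "b3 < 0" "b4 < 0" "0 < a1" "0 < a2" "0 < a4"
    using bm by (auto simp: block_motion_def motion_def)
  define A where "A = 1 - a4\<^sup>2"
  define k m where "k = 1 - b4 * a4" "m = b4 - a4"
  define X Y V where "X = [:a1, 1:]" "Y = [:b1, 1:]" "V = [:- 1, 0, 1 :: real:]"
  \<comment> \<open>Numerators of the scalings at the next two links:
    \<open>C2 + a2 * H2 = Z / (2 * Y)\<close> and
    \<open>C3 + b3 * H3 = W / (4 * Y * Z)\<close>.\<close>
  define Z where "Z = smult (1 + a2) V + smult (1 - a2) (Y\<^sup>2)"
  define W where "W = smult (1 + b3) (Z\<^sup>2) + smult (4 * (1 - b3)) (V * Y\<^sup>2)"
  define N K where "N = smult A W - smult (4 * k) (Y * Z * X)" "K = smult (4 * m) (Y * Z)"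
  \<comment> \<open>At the zero of \<open>Y\<close> only the first summand of \<open>Z\<close>
    survives; \<open>b1 \<noteq> - 1\<close> makes it nonzero, so \<open>Z\<close> and hence
    \<open>K\<close> are not the zero polynomial.\<close>
  have "poly Z (- b1) = (1 + a2) * (b1\<^sup>2 - 1)" by (simp add: Z_def X_Y_V_def power2_eq_square algebra_simps)
  then have "poly Z (- b1) \<noteq> 0" using sg n by (auto simp: power2_eq_1_iff)
  then have "Z \<noteq> 0" by auto
  moreover have "Y \<noteq> 0" "m \<noteq> 0" using sg by (auto simp: k_m_def X_Y_V_def)
  ultimately have K: "K \<noteq> 0" by (simp add: N_K_def)
  have "a4 = a1 \<or> a4\<^sup>2 = 1"
  proof (rule rational_root_degenerate[OF inf K, of _ _ N])
    show "0 < a4 * a1" using sg by simp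
    fix s assume "s \<in> I"
    then obtain C2 H2 C3 H3 C4 H4 where q: "C2\<^sup>2 - H2\<^sup>2 = s\<^sup>2 - 1" "C3\<^sup>2 - H3\<^sup>2 = s\<^sup>2 - 1"
       "C4\<^sup>2 - H4\<^sup>2 = s\<^sup>2 - 1" and l: "s + b1 = C2 + b2 * H2" "C2 + a2 * H2 = C3 + a3 * H3"
       "C3 + b3 * H3 = C4 + b4 * H4" "C4 + a4 * H4 = s + a1" using I unfolding slope_rel_def by blast
    define z w where "z = C2 + a2 * H2" "w = C4 + b4 * H4"
    have pY: "poly X s = s + a1" "poly Y s = s + b1" "poly V s = s\<^sup>2 - 1"
      by (auto simp: X_Y_V_def power2_eq_square)
    have Z: "poly Z s = 2 * z * (s + b1)"
      unfolding Z_def poly_add poly_smult poly_power pY q(1)[symmetric] l(1) n z_w_def by algebra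
    have "2 * w * z = (1 + b3) * z\<^sup>2 + (1 - b3) * (s\<^sup>2 - 1)"
      unfolding z_w_def l(2) l(3)[symmetric] n q(2)[symmetric] by algebra
    then have W: "poly W s = 4 * w * (s + b1) * poly Z s"
      unfolding W_def poly_add poly_smult poly_mult poly_power pY Z by algebra
    have "A * w = k * (s + a1) + m * (H4 + a4 * C4)"
      using slope_square(2)[OF q(3) l(4), of b4] by (simp add: A_def k_m_def z_w_def)
    then have "poly N s = poly K s * (H4 + a4 * C4)"
      unfolding N_K_def poly_diff poly_smult poly_mult W pY by algebra
    then show "\<exists>x. x\<^sup>2 = poly [:a1\<^sup>2 + 1 - a4\<^sup>2, 2 * a1, a4\<^sup>2:] s \<and> poly N s = poly K s * x"
      using slope_square(1)[OF q(3) l(4)] by blast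
  qed
  then show ?thesis using n sg by (auto simp: power2_eq_1_iff)
qed

text \<open>Equal rates at both sides of the first quadrilateral make the second and the fourth move
  exactly like it. The third then obeys two linear equations, which force a constant
  \<open>H3 = \<nu>\<close> and \<open>C3 = s + \<mu>\<close>; the hyperbola equation for infinitely
  many \<open>s\<close> leaves \<open>\<mu> = 0\<close> and \<open>\<nu>\<^sup>2 = 1\<close>, and
  the signs of the rates make \<open>\<nu>\<close> positive.\<close>

lemma block_chain:
  assumes bm: "block_motion T a1 b1 c1 h1 a2 b2 c2 h2 a3 b3 c3 h3 a4 b4 c4 h4"
    and n: "b1 = b2" "a1 = a4"
  shows "a2 = a3 \<and> b3 = b4"
proof -
  obtain I where inf: "infinite I" and
    I: "\<And>s. s \<in> I \<Longrightarrow> \<exists>C2 H2 C3 H3 C4 H4. slope_rel a1 b1 a2 b2 a3 b3 a4 b4 s C2 H2 C3 H3 C4 H4"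
    using block_motion_slopes[OF bm] by blast
  have sg: "b3 < 0" "b4 < 0" "0 < a2" "0 < a3"
    using bm by (auto simp: block_motion_def motion_def)
  define \<nu> where "\<nu> = (b4 - a2) / (b3 - a3)"
  define \<mu> where "\<mu> = a2 - a3 * \<nu>"
  have \<nu>: "\<nu> > 0" "\<nu> * (b3 - a3) = b4 - a2" using sg by (auto simp: \<nu>_def divide_neg_neg)
  have "[:\<mu>\<^sup>2 - \<nu>\<^sup>2 + 1, 2 * \<mu>:] = 0"
  proof (rule poly_eq_0_if_infinite_zeros[OF inf])
    fix s assume "s \<in> I"
    then obtain C3 H3 where q: "C3\<^sup>2 - H3\<^sup>2 = s\<^sup>2 - 1" and l: "s + a2 = C3 + a3 * H3" "C3 + b3 * H3 = s + b4"
      using I n unfolding slope_rel_def by fastforce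
    have "(H3 - \<nu>) * (b3 - a3) = 0" using l \<nu>(2) by algebra
    then have "H3 = \<nu>" using sg by auto
    moreover from this have "C3 = s + \<mu>" using l(1) by (simp add: \<mu>_def)
    ultimately show "poly [:\<mu>\<^sup>2 - \<nu>\<^sup>2 + 1, 2 * \<mu>:] s = 0"
      using q by (simp add: power2_eq_square algebra_simps)
  qed
  then have "\<mu> = 0" "\<nu>\<^sup>2 = 1" by auto
  then have "\<nu> = 1" using \<nu>(1) by (auto simp: power2_eq_1_iff)
  then show ?thesis using \<open>\<mu> = 0\<close> \<nu>(2) by (simp add: \<mu>_def)
qed

text \<open>The second quadrilateral moves like the first, so the third and the fourth have the
  prescribed scalings \<open>s + a2\<close> and \<open>s + a1\<close>, each with its own square
  root, and share a side. This gives a linear relation between two roots: a nonzero polynomial part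
  \<open>L\<close> makes one root rational, while \<open>L = 0\<close> makes the radicands
  proportional.\<close>

lemma block_equal_generic:
  assumes bm: "block_motion T a1 b1 c1 h1 a2 b2 c2 h2 a3 b3 c3 h3 a4 b4 c4 h4"
    and n: "b1 = b2" "a3 \<noteq> 1" "a4 \<noteq> 1"
  shows "a1 = a2 \<and> a3 = a4 \<and> b3 = b4 \<or> a2 = a3"
proof -
  obtain I where inf: "infinite I" and
    I: "\<And>s. s \<in> I \<Longrightarrow> \<exists>C2 H2 C3 H3 C4 H4. slope_rel a1 b1 a2 b2 a3 b3 a4 b4 s C2 H2 C3 H3 C4 H4"
    using block_motion_slopes[OF bm] by blast
  have sg: "b3 < 0" "b4 < 0" "0 < a1" "0 < a2" "0 < a3" "0 < a4"
    using bm by (auto simp: block_motion_def motion_def)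
  define A A' where "A = 1 - a4\<^sup>2" "A' = 1 - a3\<^sup>2"
  have AA: "A \<noteq> 0" "A' \<noteq> 0" using n sg by (auto simp: A_A'_def power2_eq_1_iff)
  define k m k' m' where "k = 1 - b4 * a4" "m = b4 - a4" "k' = 1 - b3 * a3" "m' = b3 - a3"
  have "b4 * a4 < 0" "b3 * a3 < 0" using sg by (auto simp: mult_neg_pos)
  then have km: "k > 0" "k' > 0" "m < 0" "m' < 0" using sg by (auto simp: k_m_k'_m'_def)
  define L where "L = smult (A * k') [:a2, 1:] - smult (A' * k) [:a1, 1:]"
  define D D' where "D = [:a1\<^sup>2 + 1 - a4\<^sup>2, 2 * a1, a4\<^sup>2:]" "D' = [:a2\<^sup>2 + 1 - a3\<^sup>2, 2 * a2, a3\<^sup>2:]"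
  define N where "N = smult ((A' * m)\<^sup>2) D - smult ((A * m')\<^sup>2) D' - L\<^sup>2"
  define K where "K = smult (2 * A * m') L"
  have rel: "\<exists>x. x\<^sup>2 = poly D' s \<and> poly N s = poly K s * x" if s: "s \<in> I" for s
  proof -
    obtain C3 H3 C4 H4 where q: "C3\<^sup>2 - H3\<^sup>2 = s\<^sup>2 - 1"
       "C4\<^sup>2 - H4\<^sup>2 = s\<^sup>2 - 1" and l: "C3 + a3 * H3 = s + a2"
       "C3 + b3 * H3 = C4 + b4 * H4" "C4 + a4 * H4 = s + a1"
      using I[OF s] n unfolding slope_rel_def by fastforce
    define x x' where "x = H4 + a4 * C4" "x' = H3 + a3 * C3"
    have x: "x\<^sup>2 = poly D s" "x'\<^sup>2 = poly D' s"
      unfolding x_x'_def D_D'_def using slope_square(1) q l by blast+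
    have "A * (C3 + b3 * H3) = k * (s + a1) + m * x" "A' * (C3 + b3 * H3) = k' * (s + a2) + m' * x'"
      using slope_square(2)[OF q(2) l(3), of b4] slope_square(2)[OF q(1) l(1), of b3]
      by (simp_all add: A_A'_def k_m_k'_m'_def x_x'_def l(2))
    then have "A * (k' * (s + a2) + m' * x') = A' * (k * (s + a1) + m * x)" by algebra
    then have "poly L s + A * m' * x' = A' * m * x" by (simp add: L_def algebra_simps)
    then have "(poly L s + A * m' * x')\<^sup>2 = (A' * m * x)\<^sup>2" by simp
    then have "poly N s = poly K s * x'"
      unfolding N_def K_def poly_diff poly_smult poly_power x[symmetric] by algebra
    then show ?thesis using x by blast
  qed
  show ?thesis
  proof (cases "L = 0")
    case False
    then have "K \<noteq> 0" using AA km by (auto simp: K_def)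
    then have "a3 = a2 \<or> a3\<^sup>2 = 1"
      using rational_root_degenerate[OF inf, of K a3 a2 N] rel sg unfolding D_D'_def by auto
    then show ?thesis using n sg by (auto simp: power2_eq_1_iff)
  next
    case True
    then have e: "A * k' = A' * k" "A * k' * a2 = A' * k * a1" by (auto simp: L_def)
    then have a: "a1 = a2" using AA km by auto
    have "N = 0" by (rule poly_eq_0_if_infinite_zeros[OF inf]) (use rel True in \<open>auto simp: K_def\<close>)
    then have "(A' * m)\<^sup>2 * a1 = (A * m')\<^sup>2 * a2" "(A' * m)\<^sup>2 * a4\<^sup>2 = (A * m')\<^sup>2 * a3\<^sup>2"
      unfolding N_def True D_D'_def by auto
    then have "(A' * m)\<^sup>2 = (A * m')\<^sup>2" "(A' * m)\<^sup>2 * a4\<^sup>2 = (A * m')\<^sup>2 * a3\<^sup>2" using a sg by auto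
    then have "a4\<^sup>2 = a3\<^sup>2" using AA km by auto
    then have a': "a3 = a4" using sg by (simp add: power2_eq_iff)
    then have "k = k'" using e(1) AA by (simp add: A_A'_def)
    then have "b3 = b4" using a' sg by (simp add: k_m_k'_m'_def)
    then show ?thesis using a a' by simp
  qed
qed

text \<open>Here \<open>a4 = 1\<close> makes the fourth quadrilateral rational in \<open>s\<close>,
  and the shared side transfers rationality to the root of the third.\<close>

lemma block_equal_mixed:
  assumes bm: "block_motion T a1 b1 c1 h1 a2 b2 c2 h2 a3 b3 c3 h3 a4 b4 c4 h4"
    and n: "b1 = b2" "a3 \<noteq> 1" "a4 = 1"
  shows "a2 = a3"
proof -
  obtain I where inf: "infinite I" and
    I: "\<And>s. s \<in> I \<Longrightarrow> \<exists>C2 H2 C3 H3 C4 H4. slope_rel a1 b1 a2 b2 a3 b3 a4 b4 s C2 H2 C3 H3 C4 H4"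
    using block_motion_slopes[OF bm] by blast
  have sg: "b3 < 0" "0 < a2" "0 < a3" using bm by (auto simp: block_motion_def motion_def)
  define A k m where "A = 1 - a3\<^sup>2" "k = 1 - b3 * a3" "m = b3 - a3"
  define X V where "X = [:a1, 1:]" "V = [:- 1, 0, 1 :: real:]"
  define W where "W = smult (1 + b4) (X\<^sup>2) + smult (1 - b4) V"
  define N K where "N = smult A W - smult (2 * k) (X * [:a2, 1:])" "K = smult (2 * m) X"
  have K: "K \<noteq> 0" using sg by (auto simp: N_K_def A_k_m_def X_V_def)
  have "a3 = a2 \<or> a3\<^sup>2 = 1"
  proof (rule rational_root_degenerate[OF inf K, of _ _ N])
    show "0 < a3 * a2" using sg by simp
    fix s assume "s \<in> I"
    then obtain C3 H3 C4 H4 where q: "C3\<^sup>2 - H3\<^sup>2 = s\<^sup>2 - 1"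
       "C4\<^sup>2 - H4\<^sup>2 = s\<^sup>2 - 1" and l: "C3 + a3 * H3 = s + a2"
       "C3 + b3 * H3 = C4 + b4 * H4" "C4 + H4 = s + a1"
      using I n unfolding slope_rel_def by fastforce
    define w where "w = C4 + b4 * H4"
    have pX: "poly X s = s + a1" "poly V s = s\<^sup>2 - 1" "poly [:a2, 1:] s = s + a2"
      by (auto simp: X_V_def power2_eq_square)
    have W: "poly W s = 2 * w * (s + a1)"
      unfolding W_def poly_add poly_smult poly_power pX q(2)[symmetric] l(3)[symmetric] w_def by algebra
    have "A * w = k * (s + a2) + m * (H3 + a3 * C3)"
      using slope_square(2)[OF q(1) l(1), of b3] by (simp add: A_k_m_def w_def l(2))
    then have "poly N s = poly K s * (H3 + a3 * C3)"
      unfolding N_K_def poly_diff poly_smult poly_mult W pX by algebra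
    then show "\<exists>x. x\<^sup>2 = poly [:a2\<^sup>2 + 1 - a3\<^sup>2, 2 * a2, a3\<^sup>2:] s \<and> poly N s = poly K s * x"
      using slope_square(1)[OF q(1) l(1)] by blast
  qed
  then show ?thesis using n sg by (auto simp: power2_eq_1_iff)
qed

text \<open>With \<open>a3 = a4 = 1\<close> no roots occur: the third and the fourth quadrilateral
  both give the scaling of their common side as a rational function of \<open>s\<close>. The
  exception \<open>a1 = 1\<close> means \<open>a1 = a4\<close> and is left to
  \<open>block_chain\<close>.\<close>

lemma block_equal_parabolic:
  assumes bm: "block_motion T a1 b1 c1 h1 a2 b2 c2 h2 a3 b3 c3 h3 a4 b4 c4 h4"
    and n: "b1 = b2" "a3 = 1" "a4 = 1"
  shows "a1 = a2 \<and> b3 = b4 \<or> a1 = 1"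
proof -
  obtain I where inf: "infinite I" and
    I: "\<And>s. s \<in> I \<Longrightarrow> \<exists>C2 H2 C3 H3 C4 H4. slope_rel a1 b1 a2 b2 a3 b3 a4 b4 s C2 H2 C3 H3 C4 H4"
    using block_motion_slopes[OF bm] by blast
  have sg: "b3 < 0" "b4 < 0" "0 < a1" using bm by (auto simp: block_motion_def motion_def)
  define X Z V where "X = [:a1, 1:]" "Z = [:a2, 1:]" "V = [:- 1, 0, 1 :: real:]"
  have eq: "Z * (smult (1 + b4) (X\<^sup>2) + smult (1 - b4) V) = X * (smult (1 + b3) (Z\<^sup>2) + smult (1 - b3) V)"
  proof (rule poly_eq_if_infinite[OF inf])
    fix s assume "s \<in> I"
    then obtain C3 H3 C4 H4 where q: "C3\<^sup>2 - H3\<^sup>2 = s\<^sup>2 - 1"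
       "C4\<^sup>2 - H4\<^sup>2 = s\<^sup>2 - 1" and l: "C3 + H3 = s + a2"
       "C3 + b3 * H3 = C4 + b4 * H4" "C4 + H4 = s + a1"
      using I n unfolding slope_rel_def by fastforce
    have pX: "poly X s = s + a1" "poly Z s = s + a2" "poly V s = s\<^sup>2 - 1"
      by (auto simp: X_Z_V_def power2_eq_square)
    have "(1 + b4) * (s + a1)\<^sup>2 + (1 - b4) * (s\<^sup>2 - 1) = 2 * (C4 + b4 * H4) * (s + a1)"
      unfolding q(2)[symmetric] l(3)[symmetric] by algebra
    moreover have "(1 + b3) * (s + a2)\<^sup>2 + (1 - b3) * (s\<^sup>2 - 1) = 2 * (C4 + b4 * H4) * (s + a2)"
      unfolding q(1)[symmetric] l(1)[symmetric] l(2)[symmetric] by algebra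
    ultimately show "poly (Z * (smult (1 + b4) (X\<^sup>2) + smult (1 - b4) V)) s = poly (X * (smult (1 + b3) (Z\<^sup>2) + smult (1 - b3) V)) s"
      unfolding poly_mult poly_add poly_smult poly_power pX by algebra
  qed
  have "poly X (- a1) = 0" "poly Z (- a1) = a2 - a1" "poly V (- a1) = a1\<^sup>2 - 1"
    by (auto simp: X_Z_V_def power2_eq_square)
  then have "(a2 - a1) * ((1 - b4) * (a1\<^sup>2 - 1)) = 0"
    using arg_cong[OF eq, of "\<lambda>p. poly p (- a1)"] by (simp del: mult_eq_0_iff)
  then consider "a1 = 1" | "a1 = a2" using sg by (auto simp: power2_eq_1_iff)
  then show ?thesis
  proof cases
    case 2
    then have "X = Z" "X \<noteq> 0" by (auto simp: X_Z_V_def)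
    then have "smult (1 + b4) (X\<^sup>2) + smult (1 - b4) V = smult (1 + b3) (X\<^sup>2) + smult (1 - b3) V"
      using eq by auto
    \<comment> \<open>At \<open>s = 1\<close> the polynomial \<open>V\<close> vanishes and
      \<open>X\<close> does not, which isolates \<open>b4 - b3\<close>.\<close>
    then have "poly (smult (1 + b4) (X\<^sup>2) + smult (1 - b4) V) 1 = poly (smult (1 + b3) (X\<^sup>2) + smult (1 - b3) V) 1"
      by simp
    then have "(b4 - b3) * (a1 + 1)\<^sup>2 = 0" by (simp add: X_Z_V_def algebra_simps)
    then show ?thesis using 2 sg by auto
  qed simp
qed

lemma block_equal:
  assumes bm: "block_motion T a1 b1 c1 h1 a2 b2 c2 h2 a3 b3 c3 h3 a4 b4 c4 h4" and b: "b1 = b2"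
  shows "a2 = a3 \<and> b3 = b4 \<and> a1 = a4 \<or> a1 = a2 \<and> a3 = a4 \<and> b3 = b4"
proof -
  note bm' = block_motion_reflect[OF bm]
  have ch: ?thesis if "a2 = a3 \<or> a1 = a4"
    using that block_chain[OF bm b] block_chain[OF bm' b[symmetric]] by auto
  consider "a3 \<noteq> 1" "a4 \<noteq> 1" | "a3 \<noteq> 1" "a4 = 1" | "a3 = 1" "a4 \<noteq> 1" | "a3 = 1" "a4 = 1" by blast
  then show ?thesis
  proof cases
    case 1 then show ?thesis using block_equal_generic[OF bm b] ch by blast
  next
    case 2 then show ?thesis using block_equal_mixed[OF bm b] ch by blast
  next
    case 3 then show ?thesis using block_equal_mixed[OF bm' b[symmetric]] ch by blast
  next
    case 4 then show ?thesis using block_equal_parabolic[OF bm b] ch by auto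
  qed
qed

text \<open>Any agreement at a side becomes \<open>b1 = b2\<close> after a rotation. Without
  agreement, the four rotated copies of \<open>block_generic\<close> require rates \<open>1\<close>
  or \<open>- 1\<close>; since rates at a common side differ, one such choice determines the next
  around the cycle, which leaves two patterns, reflections of each other.\<close>

lemma block_classification:
  assumes bm: "block_motion T a1 b1 c1 h1 a2 b2 c2 h2 a3 b3 c3 h3 a4 b4 c4 h4"
  shows "b1 = b2 \<and> a2 = a3 \<and> b3 = b4 \<and> a1 = a4 \<or>
    a1 = a2 \<and> b1 = b2 \<and> a3 = a4 \<and> b3 = b4 \<or> a1 = a4 \<and> b1 = b4 \<and> a2 = a3 \<and> b2 = b3"
proof -
  note r1 = block_motion_rotate[OF bm]
  note r2 = block_motion_rotate[OF r1, simplified]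
  note r3 = block_motion_rotate[OF r2, simplified]
  note f = block_motion_reflect[OF bm]
  consider "b1 = b2" | "a2 = a3" | "b3 = b4" | "a1 = a4" | "b1 \<noteq> b2" "a2 \<noteq> a3" "b3 \<noteq> b4" "a1 \<noteq> a4" by blast
  then show ?thesis
  proof cases
    case 1 then show ?thesis using block_equal[OF bm] by auto
  next
    case 2 then show ?thesis using block_equal[OF r1] by auto
  next
    case 3 then show ?thesis using block_equal[OF r2] by auto
  next
    case 4 then show ?thesis using block_equal[OF r3] by auto
  next
    case 5
    have "b2 = - 1 \<or> a4 = 1" using block_generic[OF bm] 5 by blast
    moreover have "a3 = 1 \<or> b1 = - 1" using block_generic[OF r1] 5 by fastforce
    moreover have "b4 = - 1 \<or> a2 = 1" using block_generic[OF r2] 5 by fastforce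
    moreover have "a1 = 1 \<or> b3 = - 1" using block_generic[OF r3] 5 by fastforce
    ultimately consider "b2 = - 1" "a3 = 1" "a4 \<noteq> 1" "b1 \<noteq> - 1" | "b1 = - 1" "a4 = 1" "a3 \<noteq> 1" "b2 \<noteq> - 1"
      using 5 by metis
    then show ?thesis
      using block_parabolic[OF bm] block_parabolic[OF f] 5 by cases auto
  qed
qed

subsection \<open>Plane quadrilaterals with fixed side directions\<close>

type_synonym vec2 = "real \<times> real"

definition tri :: "vec2 \<Rightarrow> vec2 \<Rightarrow> vec2 \<Rightarrow> real" where
  "tri A B C = det2 (B - A) (C - A)"

definition convex4 :: "vec2 \<Rightarrow> vec2 \<Rightarrow> vec2 \<Rightarrow> vec2 \<Rightarrow> bool" where
  "convex4 A B C D \<longleftrightarrow>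
     0 < tri A B C \<and> 0 < tri B C D \<and> 0 < tri C D A \<and> 0 < tri D A B \<or>
     tri A B C < 0 \<and> tri B C D < 0 \<and> tri C D A < 0 \<and> tri D A B < 0"

definition area4 :: "vec2 \<Rightarrow> vec2 \<Rightarrow> vec2 \<Rightarrow> vec2 \<Rightarrow> real" where
  "area4 A B C D = tri A B C + tri C D A"

text \<open>Scaling the sides $AB$, $DC$, $AD$, $BC$ by $a$, $1/a$, $b$, $1/b$, where $a$ and $b$ are the two
  rates defined next, gives the quadrilateral with parallel sides that is orthogonal to $ABCD$ with
  respect to the (indefinite) area form and has the opposite area.\<close>

definition base_rate :: "vec2 \<Rightarrow> vec2 \<Rightarrow> vec2 \<Rightarrow> vec2 \<Rightarrow> real" where
  "base_rate A B C D = sqrt (tri B C D * tri C D A / (tri A B C * tri D A B))"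

definition side_rate :: "vec2 \<Rightarrow> vec2 \<Rightarrow> vec2 \<Rightarrow> vec2 \<Rightarrow> real" where
  "side_rate A B C D = - sqrt (tri A B C * tri B C D / (tri C D A * tri D A B))"

lemma tri_sum: "tri A B C + tri C D A = tri B C D + tri D A B"
  by (simp add: tri_def det2_def algebra_simps)

text \<open>The last two identities resolve the roots: product and quotient of the rates are
  rational in the triangle areas. Their squares follow from the root formulas, and
  \<open>side_rate < 0 < base_rate\<close> selects the signs.\<close>

lemma rates:
  assumes "convex4 A B C D"
  shows "0 < base_rate A B C D" "side_rate A B C D < 0"
    "(base_rate A B C D)\<^sup>2 = tri B C D * tri C D A / (tri A B C * tri D A B)"
    "(side_rate A B C D)\<^sup>2 = tri A B C * tri B C D / (tri C D A * tri D A B)"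
    "base_rate A B C D * side_rate A B C D * tri D A B = - tri B C D"
    "side_rate A B C D * tri C D A = - base_rate A B C D * tri A B C"
proof -
  let ?p = "tri A B C" and ?q = "tri B C D" and ?r = "tri C D A" and ?s = "tri D A B"
  let ?a = "base_rate A B C D" and ?b = "side_rate A B C D"
  have pos: "0 < ?q * ?r" "0 < ?p * ?s" "0 < ?p * ?q" "0 < ?r * ?s" "0 < ?q / ?s" "0 < ?p / ?r"
    using assms by (auto simp: convex4_def zero_less_mult_iff zero_less_divide_iff)
  have nz: "?p \<noteq> 0" "?q \<noteq> 0" "?r \<noteq> 0" "?s \<noteq> 0" using assms by (auto simp: convex4_def)
  show a: "0 < ?a" and b: "?b < 0" using pos by (auto simp: base_rate_def side_rate_def)
  show a2: "?a\<^sup>2 = ?q * ?r / (?p * ?s)" and b2: "?b\<^sup>2 = ?p * ?q / (?r * ?s)"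
    using pos by (auto simp: base_rate_def side_rate_def)
  have "(?a * - ?b)\<^sup>2 = (?q / ?s)\<^sup>2"
    unfolding power_mult_distrib power2_minus a2 b2 using nz by (simp add: field_simps power2_eq_square)
  moreover have "0 \<le> ?a * - ?b" using a b by (intro mult_nonneg_nonneg) auto
  ultimately have "?a * - ?b = ?q / ?s" using power2_eq_imp_eq pos(5) less_imp_le by blast
  then show "?a * ?b * ?s = - ?q" using nz by (simp add: field_simps)
  have "(- ?b)\<^sup>2 = (?a * (?p / ?r))\<^sup>2"
    unfolding power_mult_distrib power2_minus a2 b2 using nz by (simp add: field_simps power2_eq_square)
  moreover have "0 \<le> - ?b" "0 \<le> ?a * (?p / ?r)" using a b pos(6) by (auto intro!: mult_nonneg_nonneg simp del: times_divide_eq_right)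
  ultimately have "- ?b = ?a * (?p / ?r)" using power2_eq_imp_eq by blast
  then show "?b * ?r = - ?a * ?p" using nz by (simp add: field_simps)
qed

lemma det2_simps:
  "det2 (u + v) w = det2 u w + det2 v w" "det2 w (u + v) = det2 w u + det2 w v"
  "det2 (u - v) w = det2 u w - det2 v w" "det2 w (u - v) = det2 w u - det2 w v"
  "det2 (k *\<^sub>R u) w = k * det2 u w" "det2 w (k *\<^sub>R u) = k * det2 w u" "det2 u u = 0"
  by (auto simp: det2_def algebra_simps)

lemma det2_basis_eq_0:
  assumes "det2 u v \<noteq> 0" "det2 u w = 0" "det2 v w = 0"
  shows "w = 0"
proof -
  have "det2 u v * fst w = fst u * det2 v w * -1 + fst v * det2 u w"
    "det2 u v * snd w = - snd u * det2 v w + snd v * det2 u w"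
    by (auto simp: det2_def algebra_simps)
  then show ?thesis using assms by (auto simp: prod_eq_iff)
qed

text \<open>Closing up is two linear equations for four scalings, hence a plane of solutions. It is
  spanned by \<open>(1, 1, 1, 1)\<close> and \<open>(a, 1 / a, b, 1 / b)\<close>, in the order of
  the sides \<open>AB\<close>, \<open>DC\<close>, \<open>AD\<close>, \<open>BC\<close>.\<close>

lemma parallel_quad_iff:
  fixes A B C D :: vec2
  assumes cv: "convex4 A B C D"
  defines "a \<equiv> base_rate A B C D" and "b \<equiv> side_rate A B C D"
  shows "\<alpha> *\<^sub>R (B - A) + \<beta>' *\<^sub>R (C - B) = \<beta> *\<^sub>R (D - A) + \<alpha>' *\<^sub>R (C - D) \<longleftrightarrow>
    (\<exists>c h. \<alpha> = c + a * h \<and> \<alpha>' = c + h / a \<and> \<beta> = c + b * h \<and> \<beta>' = c + h / b)"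
proof -
  let ?p = "tri A B C" and ?q = "tri B C D" and ?r = "tri C D A" and ?s = "tri D A B"
  note rt = rates[OF cv, folded a_def b_def]
  have nz: "?p \<noteq> 0" "?q \<noteq> 0" using cv by (auto simp: convex4_def)
  have ab: "a > 0" "b < 0" using rt by auto
  have sum: "?p + ?r = ?q + ?s" by (rule tri_sum)
  \<comment> \<open>This and \<open>q\<close> say that the second spanning vector satisfies the two
    scalar closing equations.\<close>
  have p: "?p / b = b * ?s + (?p - ?s) / a"
  proof -
    have "a * ?p = b * (a * b * ?s) + b * (?p - ?s)" using rt(5,6) sum by algebra
    then show ?thesis using ab by (simp add: field_simps)
  qed
  have q: "a * ?p = b * (?p - ?q) + ?q / a"
  proof -
    have "a * (a * ?p) = a * (b * (?p - ?q)) + ?q"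
    proof -
      have "a * (a * ?p) = - a * b * ?r" using rt(6) by algebra
      also have "\<dots> = - a * b * (?q - ?p) - a * b * ?s" using sum by algebra
      also have "\<dots> = a * (b * (?p - ?q)) + ?q" using rt(5) by algebra
      finally show ?thesis .
    qed
    also have "\<dots> = a * (b * (?p - ?q) + ?q / a)" using ab by (simp add: distrib_left)
    finally show ?thesis using ab by simp
  qed
  let ?w = "\<alpha> *\<^sub>R (B - A) + \<beta>' *\<^sub>R (C - B) - (\<beta> *\<^sub>R (D - A) + \<alpha>' *\<^sub>R (C - D))"
  have d: "det2 (B - A) (C - B) = ?p" "det2 (B - A) ?w = \<beta>' * ?p - \<beta> * ?s - \<alpha>' * (?p - ?s)"
    "det2 (C - B) ?w = - \<alpha> * ?p + \<beta> * (?p - ?q) + \<alpha>' * ?q"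
    by (auto simp: det2_def tri_def algebra_simps)
  have "?w = 0 \<longleftrightarrow> \<beta>' * ?p - \<beta> * ?s - \<alpha>' * (?p - ?s) = 0 \<and> - \<alpha> * ?p + \<beta> * (?p - ?q) + \<alpha>' * ?q = 0"
  proof
    assume "?w = 0"
    then have "det2 (B - A) ?w = 0" "det2 (C - B) ?w = 0" by (simp_all add: det2_def)
    then show "\<beta>' * ?p - \<beta> * ?s - \<alpha>' * (?p - ?s) = 0 \<and> - \<alpha> * ?p + \<beta> * (?p - ?q) + \<alpha>' * ?q = 0"
      unfolding d by blast
  next
    assume "\<beta>' * ?p - \<beta> * ?s - \<alpha>' * (?p - ?s) = 0 \<and> - \<alpha> * ?p + \<beta> * (?p - ?q) + \<alpha>' * ?q = 0"
    then have "det2 (B - A) ?w = 0" "det2 (C - B) ?w = 0" unfolding d by blast+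
    then show "?w = 0" using det2_basis_eq_0[of "B - A" "C - B" ?w] nz unfolding d(1) by blast
  qed
  also have "\<dots> \<longleftrightarrow> (\<exists>c h. \<alpha> = c + a * h \<and> \<alpha>' = c + h / a \<and> \<beta> = c + b * h \<and> \<beta>' = c + h / b)"
  proof
    assume "\<exists>c h. \<alpha> = c + a * h \<and> \<alpha>' = c + h / a \<and> \<beta> = c + b * h \<and> \<beta>' = c + h / b"
    then obtain c h where e: "\<alpha> = c + a * h" "\<alpha>' = c + h / a" "\<beta> = c + b * h" "\<beta>' = c + h / b" by blast
    have "\<beta>' * ?p - \<beta> * ?s - \<alpha>' * (?p - ?s) = h * (?p / b - (b * ?s + (?p - ?s) / a))"
      unfolding e by (simp add: algebra_simps diff_divide_distrib)
    moreover have "- \<alpha> * ?p + \<beta> * (?p - ?q) + \<alpha>' * ?q = h * (b * (?p - ?q) + ?q / a - a * ?p)"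
      unfolding e by (simp add: algebra_simps)
    ultimately show "\<beta>' * ?p - \<beta> * ?s - \<alpha>' * (?p - ?s) = 0 \<and> - \<alpha> * ?p + \<beta> * (?p - ?q) + \<alpha>' * ?q = 0"
      using p q by simp
  next
    assume w: "\<beta>' * ?p - \<beta> * ?s - \<alpha>' * (?p - ?s) = 0 \<and> - \<alpha> * ?p + \<beta> * (?p - ?q) + \<alpha>' * ?q = 0"
    define h where "h = (\<beta> - \<alpha>) / (b - a)"
    define c where "c = \<alpha> - a * h"
    have hh: "h * (b - a) = \<beta> - \<alpha>" using ab by (simp add: h_def)
    have al: "\<alpha> = c + a * h" and be: "\<beta> = c + b * h" using hh by (auto simp: c_def algebra_simps)
    have "\<alpha>' * ?q = \<alpha> * ?p - \<beta> * (?p - ?q)" using w by simp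
    also have "\<dots> = c * ?q + h * (a * ?p - b * (?p - ?q))" unfolding al be by algebra
    also have "a * ?p - b * (?p - ?q) = ?q / a" using q by simp
    finally have "\<alpha>' * ?q = (c + h / a) * ?q" by (simp add: algebra_simps)
    then have al': "\<alpha>' = c + h / a" using nz by simp
    have "\<beta>' * ?p = \<beta> * ?s + \<alpha>' * (?p - ?s)" using w by simp
    also have "\<dots> = c * ?p + h * (b * ?s + (?p - ?s) / a)" unfolding al' be by (simp add: algebra_simps diff_divide_distrib)
    also have "b * ?s + (?p - ?s) / a = ?p / b" using p by simp
    finally have "\<beta>' * ?p = (c + h / b) * ?p" by (simp add: algebra_simps)
    then have "\<beta>' = c + h / b" using nz by simp
    then show "\<exists>c h. \<alpha> = c + a * h \<and> \<alpha>' = c + h / a \<and> \<beta> = c + b * h \<and> \<beta>' = c + h / b"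
      using al be al' by blast
  qed
  finally show ?thesis by simp
qed

lemma parallel_quad_area:
  fixes A B C D :: vec2
  assumes cv: "convex4 A B C D"
  defines "a \<equiv> base_rate A B C D" and "b \<equiv> side_rate A B C D"
  assumes s: "B' - A' = (c + a * h) *\<^sub>R (B - A)" "C' - D' = (c + h / a) *\<^sub>R (C - D)"
    "D' - A' = (c + b * h) *\<^sub>R (D - A)" "C' - B' = (c + h / b) *\<^sub>R (C - B)"
  shows "area4 A' B' C' D' = area4 A B C D * (c\<^sup>2 - h\<^sup>2)"
proof -
  let ?p = "tri A B C" and ?r = "tri C D A"
  note rt = rates[OF cv, folded a_def b_def]
  have ab: "a > 0" "b < 0" using rt by auto
  have t: "tri X Y Z = det2 (Y - X) (Z - Y)" for X Y Z
    by (simp add: tri_def det2_def algebra_simps)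
  have t': "tri X Y Z = det2 (X - Y) (Y - Z)" for X Y Z
    by (simp add: tri_def det2_def algebra_simps)
  have "tri A' B' C' = (c + a * h) * (c + h / b) * ?p"
    unfolding t[of A'] t[of A] s by (simp only: det2_simps(5,6) mult_ac)
  moreover have "tri C' D' A' = (c + h / a) * (c + b * h) * ?r"
    unfolding t'[of C'] t'[of C] s by (simp only: det2_simps(5,6) mult_ac)
  ultimately have "area4 A' B' C' D' = (c + a * h) * (c + h / b) * ?p + (c + h / a) * (c + b * h) * ?r"
    by (simp add: area4_def)
  \<comment> \<open>The identity \<open>b * ?r = - a * ?p\<close> evaluates all brackets: the mixed
    term cancels and the \<open>h\<^sup>2\<close> term becomes minus the area.\<close>
  also have "\<dots> = c\<^sup>2 * (?p + ?r) + c * h * ((a * ?p + b * ?r) + (?p / b + ?r / a)) + h\<^sup>2 * (a * ?p / b + b * ?r / a)"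
    using ab by (simp add: algebra_simps power2_eq_square)
  also have "a * ?p + b * ?r = 0" using rt(6) by simp
  also have "?p / b + ?r / a = 0" using rt(6) ab by (simp add: field_simps)
  also have "a * ?p / b + b * ?r / a = - (?p + ?r)" using rt(6) ab by (simp add: field_simps)
  finally show ?thesis by (simp add: area4_def algebra_simps)
qed

text \<open>The right-hand side makes the triangle areas of the second quadrilateral proportional to
  those of the first when \<open>A'\<close> corresponds to \<open>B\<close>, \<open>B'\<close> to
  \<open>A\<close>, \<open>C'\<close> to \<open>D\<close> and \<open>D'\<close> to \<open>C\<close>;
  the fourth proportion follows from \<open>tri_sum\<close>. For \<open>A' = B\<close> and
  \<open>D' = C\<close> this says that an affine map fixing \<open>BC\<close> pointwise takes one to
  the other.\<close>

lemma rates_mirror_iff: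
  fixes A B C D A' B' C' D' :: vec2
  assumes cv: "convex4 A B C D" "convex4 A' B' C' D'"
  shows "base_rate A' B' C' D' = base_rate A B C D \<and> side_rate A' B' C' D' = 1 / side_rate A B C D \<longleftrightarrow>
    tri B C D * tri D' A' B' = tri C' D' A' * tri A B C \<and> tri D A B * tri D' A' B' = tri A' B' C' * tri A B C"
    (is "?L \<longleftrightarrow> ?R")
proof -
  let ?p = "tri A B C" and ?q = "tri B C D" and ?r = "tri C D A" and ?s = "tri D A B"
  let ?p' = "tri A' B' C'" and ?q' = "tri B' C' D'" and ?r' = "tri C' D' A'" and ?s' = "tri D' A' B'"
  let ?a = "base_rate A B C D" and ?b = "side_rate A B C D"
  let ?a' = "base_rate A' B' C' D'" and ?b' = "side_rate A' B' C' D'"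
  note rt = rates[OF cv(1)] and rt' = rates[OF cv(2)]
  have nz: "?p \<noteq> 0" "?q \<noteq> 0" "?r \<noteq> 0" "?s \<noteq> 0" "?p' \<noteq> 0" "?q' \<noteq> 0" "?r' \<noteq> 0" "?s' \<noteq> 0"
    using cv by (auto simp: convex4_def)
  have sum: "?p + ?r = ?q + ?s" "?p' + ?r' = ?q' + ?s'" by (rule tri_sum)+
  show ?thesis
  proof
    assume L: ?L
    have b: "?b \<noteq> 0" "?a \<noteq> 0" using rt by auto
    have bb: "?b' * ?b = 1" using L b by simp
    \<comment> \<open>Substituting the rates for \<open>?q\<close> and \<open>?r\<close> in
      \<open>sum\<close> expresses \<open>?p / ?s\<close> by the two rates; inverting the side rate
      inverts this quotient.\<close>
    have E1: "?s * (1 - ?a * ?b) * ?b = ?p * (?b - ?a)"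
      using rt(5,6) sum(1) by algebra
    have "?s' * (1 - ?a * ?b') * ?b' = ?p' * (?b' - ?a)"
      using rt'(5,6) sum(2) L by algebra
    then have E2: "?s' * (?b - ?a) = ?p' * (1 - ?a * ?b) * ?b" using bb by algebra
    have ba: "?b - ?a \<noteq> 0" using rt by linarith
    have "(?s * ?s') * (?b - ?a) = (?p' * ?p) * (?b - ?a)" using E1 E2 by algebra
    then have 2: "?s * ?s' = ?p' * ?p" using ba by simp
    have "?b * ?b' * ?r' = - ?a * ?p' * ?b" using rt'(6) L by algebra
    then have "?r' = - ?a * ?b * ?p'" using bb by algebra
    moreover have "?q = - ?a * ?b * ?s" using rt(5) by simp
    ultimately have "?q * ?s' = ?r' * ?p" using 2 by algebra
    then show ?R using 2 by simp
  next
    assume R: ?R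
    have "?q' * ?s' * ?p * ?p = ?r * ?s' * ?s' * ?p"
      using R sum by algebra
    then have q': "?q' * ?p = ?r * ?s'" using nz by auto
    have k: "?p' = ?s * ?s' / ?p" "?r' = ?q * ?s' / ?p" "?q' = ?r * ?s' / ?p"
      using R q' nz by (auto simp: field_simps)
    have a: "?a' = ?a" unfolding base_rate_def k using nz by (simp add: field_simps)
    have "?p' * ?q' / (?r' * ?s') = inverse (?p * ?q / (?r * ?s))" unfolding k using nz by (simp add: field_simps)
    then have "?b' = - inverse (sqrt (?p * ?q / (?r * ?s)))" unfolding side_rate_def real_sqrt_inverse[symmetric] by simp
    then have "?b' = 1 / ?b" by (simp add: side_rate_def inverse_eq_divide)
    then show ?L using a by simp
  qed
qed

subsection \<open>Parallel deformations of a plane grid\<close>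

text \<open>Combescure transforms are the grids whose edges are parallel to the given ones. This is
  what an isometric deformation does to the gradients once the common rotation is removed.\<close>

definition combescure :: "nat \<Rightarrow> nat \<Rightarrow> (nat \<Rightarrow> nat \<Rightarrow> vec2) \<Rightarrow> (real \<Rightarrow> nat \<Rightarrow> nat \<Rightarrow> vec2) \<Rightarrow> bool" where
  "combescure m n P D \<longleftrightarrow>
     (\<forall>k<m. \<forall>l<n. continuous_on {0..1} (\<lambda>t. D t k l) \<and> D 0 k l = P k l) \<and>
     (\<forall>t\<in>{0..1}.
       (\<forall>k l. Suc k < m \<and> l < n \<longrightarrow> (\<exists>\<alpha>. D t (Suc k) l - D t k l = \<alpha> *\<^sub>R (P (Suc k) l - P k l))) \<and>
       (\<forall>k l. k < m \<and> Suc l < n \<longrightarrow> (\<exists>\<beta>. D t k (Suc l) - D t k l = \<beta> *\<^sub>R (P k (Suc l) - P k l))) \<and>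
       (\<forall>k l. Suc k < m \<and> Suc l < n \<longrightarrow>
          area4 (D t k l) (D t (Suc k) l) (D t (Suc k) (Suc l)) (D t k (Suc l)) =
          area4 (P k l) (P (Suc k) l) (P (Suc k) (Suc l)) (P k (Suc l))))"

text \<open>A common translation of all gradients is the effect of adding one linear function of the
  top view to the heights, that is, of an isotropic congruence.\<close>

definition shifted :: "nat \<Rightarrow> nat \<Rightarrow> (nat \<Rightarrow> nat \<Rightarrow> vec2) \<Rightarrow> (real \<Rightarrow> nat \<Rightarrow> nat \<Rightarrow> vec2) \<Rightarrow> bool" where
  "shifted m n P D \<longleftrightarrow> (\<forall>t\<in>{0..1}. \<forall>k<m. \<forall>l<n. D t k l - P k l = D t 0 0 - P 0 0)"

text \<open>The scalings of the quadrilateral with corner $(k,l)$ at time $t$ are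
  $c + h\,(a, 1/a, b, 1/b)$; the two equations say that neighbours scale the common side equally.\<close>

definition rate_motion :: "nat \<Rightarrow> nat \<Rightarrow> (nat \<Rightarrow> nat \<Rightarrow> real) \<Rightarrow> (nat \<Rightarrow> nat \<Rightarrow> real) \<Rightarrow>
    (real \<Rightarrow> nat \<Rightarrow> nat \<Rightarrow> real) \<Rightarrow> (real \<Rightarrow> nat \<Rightarrow> nat \<Rightarrow> real) \<Rightarrow> bool" where
  "rate_motion m n a b c h \<longleftrightarrow>
     (\<forall>k l. Suc k < m \<and> Suc l < n \<longrightarrow>
        continuous_on {0..1} (\<lambda>t. c t k l) \<and> continuous_on {0..1} (\<lambda>t. h t k l) \<and> c 0 k l = 1 \<and> h 0 k l = 0) \<and>
     (\<forall>t\<in>{0..1}.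
       (\<forall>k l. Suc k < m \<and> Suc l < n \<longrightarrow> (c t k l)\<^sup>2 = 1 + (h t k l)\<^sup>2) \<and>
       (\<forall>k l. Suc (Suc k) < m \<and> Suc l < n \<longrightarrow>
          c t k l + h t k l / b k l = c t (Suc k) l + b (Suc k) l * h t (Suc k) l) \<and>
       (\<forall>k l. Suc k < m \<and> Suc (Suc l) < n \<longrightarrow>
          c t k l + h t k l / a k l = c t k (Suc l) + a k (Suc l) * h t k (Suc l)))"

definition moving :: "nat \<Rightarrow> nat \<Rightarrow> (real \<Rightarrow> nat \<Rightarrow> nat \<Rightarrow> real) \<Rightarrow> bool" where
  "moving m n h \<longleftrightarrow> (\<exists>t\<in>{0..1}. \<exists>k l. Suc k < m \<and> Suc l < n \<and> h t k l \<noteq> 0)"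

lemma rate_motion_pos:
  assumes "rate_motion m n a b c h" "Suc k < m" "Suc l < n" "t \<in> {0..1}"
  shows "1 \<le> c t k l"
proof -
  have sq: "(c s k l)\<^sup>2 = 1 + (h s k l)\<^sup>2" if "s \<in> {0..1}" for s
    using assms that by (auto simp: rate_motion_def)
  have nz: "c s k l \<noteq> 0" if "s \<in> {0..1}" for s
    using sq[OF that] add_pos_nonneg[OF zero_less_one zero_le_power2, of "h s k l"] by auto
  have "continuous_on {0..1} (\<lambda>s. c s k l)" "c 0 k l = 1" using assms by (auto simp: rate_motion_def)
  then have cont: "continuous_on {0..t} (\<lambda>s. c s k l)" and c0: "c 0 k l = 1"
    using assms(4) by (auto intro: continuous_on_subset)
  have "0 \<le> c t k l"
  proof (rule ccontr)
    assume "\<not> 0 \<le> c t k l"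
    then obtain s where "0 \<le> s" "s \<le> t" "c s k l = 0"
      using IVT2'[of "\<lambda>s. c s k l" t 0 0] cont c0 assms(4) by auto
    then show False using nz assms(4) by auto
  qed
  moreover have "1\<^sup>2 \<le> (c t k l)\<^sup>2" using sq[OF assms(4)] by simp
  ultimately show ?thesis using power2_le_imp_le by blast
qed

lemma quad_closing:
  fixes A B C D :: "'a::ab_group_add"
  assumes "B - A = u" "C - B = v'" "D - A = v"
  shows "u + v' = v + u' \<longleftrightarrow> C - D = u'"
  by (auto simp: algebra_simps simp flip: assms)

lemma same_shift:
  fixes D D' P P' :: "'a::ab_group_add"
  assumes "D' - D = P' - P" "D - P = x"
  shows "D' - P' = x"
proof -
  have "D' - P' = (D' - D) - (P' - P) + (D - P)" by simp
  then show ?thesis using assms by simp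
qed

lemma shift_diff:
  fixes D D' P P' :: "'a::ab_group_add"
  assumes "D - P = x" "D' - P' = x"
  shows "D' - D = P' - P"
proof -
  have "D' - D = (D' - P') - (D - P) + (P' - P)" by simp
  then show ?thesis using assms by simp
qed

section \<open>Edge scalings of a convex grid and their integration\<close>

locale convex_grid =
  fixes m n :: nat and P :: "nat \<Rightarrow> nat \<Rightarrow> vec2"
  assumes mn: "2 \<le> m" "2 \<le> n"
    and cv: "\<And>k l. Suc k < m \<Longrightarrow> Suc l < n \<Longrightarrow> convex4 (P k l) (P (Suc k) l) (P (Suc k) (Suc l)) (P k (Suc l))"
begin

definition a where "a k l = base_rate (P k l) (P (Suc k) l) (P (Suc k) (Suc l)) (P k (Suc l))"
definition b where "b k l = side_rate (P k l) (P (Suc k) l) (P (Suc k) (Suc l)) (P k (Suc l))"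

lemma a_pos: "Suc k < m \<Longrightarrow> Suc l < n \<Longrightarrow> 0 < a k l"
  and b_neg: "Suc k < m \<Longrightarrow> Suc l < n \<Longrightarrow> b k l < 0"
  using rates cv by (auto simp: a_def b_def)

lemma quad_edges_nonzero:
  assumes "Suc k < m" "Suc l < n"
  shows "P (Suc k) l \<noteq> P k l" "P k (Suc l) \<noteq> P k l"
    "P (Suc k) (Suc l) \<noteq> P k (Suc l)" "P (Suc k) (Suc l) \<noteq> P (Suc k) l"
  using cv[OF assms] by (auto simp: convex4_def tri_def det2_def)

lemma edges_nonzero:
  shows "Suc k < m \<Longrightarrow> l < n \<Longrightarrow> P (Suc k) l - P k l \<noteq> 0"
    and "k < m \<Longrightarrow> Suc l < n \<Longrightarrow> P k (Suc l) - P k l \<noteq> 0"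
proof -
  show "P (Suc k) l - P k l \<noteq> 0" if "Suc k < m" "l < n"
  proof (cases "Suc l < n")
    case True then show ?thesis using quad_edges_nonzero that by simp
  next
    case False
    then obtain l' where "l = Suc l'" using that mn by (cases l) auto
    then show ?thesis using quad_edges_nonzero(3)[of k l'] that by simp
  qed
  show "P k (Suc l) - P k l \<noteq> 0" if "k < m" "Suc l < n"
  proof (cases "Suc k < m")
    case True then show ?thesis using quad_edges_nonzero that by simp
  next
    case False
    then obtain k' where "k = Suc k'" using that mn by (cases k) auto
    then show ?thesis using quad_edges_nonzero(4)[of k' l] that by simp
  qed
qed

text \<open>The grid is integrated along the bottom row and then up the columns. That the remaining
  edges are parallel too follows row by row from the closing of the quadrilaterals.\<close>

lemma combescure_if_rate_motion:
  assumes rm: "rate_motion m n a b c h" and mv: "moving m n h"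
  shows "\<exists>D. combescure m n P D \<and> \<not> shifted m n P D"
proof -
  \<comment> \<open>In the last row no quadrilateral lies above the edge, so its scaling is read off
    as the opposite side of the quadrilateral below; likewise for \<open>\<beta>\<close> in the last
    column.\<close>
  define \<alpha> where "\<alpha> t k l = (if Suc l < n then c t k l + a k l * h t k l
      else c t k (l - 1) + h t k (l - 1) / a k (l - 1))" for t k l
  define \<beta> where "\<beta> t k l = (if Suc k < m then c t k l + b k l * h t k l
      else c t (k - 1) l + h t (k - 1) l / b (k - 1) l)" for t k l
  define D where "D t k l = P 0 0 + (\<Sum>i<k. \<alpha> t i 0 *\<^sub>R (P (Suc i) 0 - P i 0)) +
      (\<Sum>j<l. \<beta> t k j *\<^sub>R (P k (Suc j) - P k j))" for t k l
  have al: "\<alpha> t k (Suc l) = c t k l + h t k l / a k l" if "t \<in> {0..1}" "Suc k < m" "Suc l < n" for t k l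
    using rm that by (auto simp: \<alpha>_def rate_motion_def)
  have be: "\<beta> t (Suc k) l = c t k l + h t k l / b k l" if "t \<in> {0..1}" "Suc k < m" "Suc l < n" for t k l
    using rm that by (auto simp: \<beta>_def rate_motion_def)
  have Dl: "D t k (Suc l) - D t k l = \<beta> t k l *\<^sub>R (P k (Suc l) - P k l)" for t k l
    by (simp add: D_def)
  have Dk: "D t (Suc k) l - D t k l = \<alpha> t k l *\<^sub>R (P (Suc k) l - P k l)"
    if t: "t \<in> {0..1}" and "Suc k < m" "l < n" for t k l
    using \<open>l < n\<close>
  proof (induction l)
    case 0 show ?case by (simp add: D_def)
  next
    case (Suc l)
    have "\<alpha> t k l *\<^sub>R (P (Suc k) l - P k l) + \<beta> t (Suc k) l *\<^sub>R (P (Suc k) (Suc l) - P (Suc k) l) =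
       \<beta> t k l *\<^sub>R (P k (Suc l) - P k l) + \<alpha> t k (Suc l) *\<^sub>R (P (Suc k) (Suc l) - P k (Suc l))"
      unfolding parallel_quad_iff[OF cv[OF that(2) Suc.prems]] al[OF t that(2) Suc.prems] be[OF t that(2) Suc.prems]
      using that(2) Suc.prems by (auto simp: \<alpha>_def \<beta>_def a_def b_def)
    then show ?case
      using quad_closing[of "D t (Suc k) l" "D t k l" _ "D t (Suc k) (Suc l)" _ "D t k (Suc l)"]
        Suc Dl[of t "Suc k" l] Dl[of t k l] by simp
  qed
  have cont: "continuous_on {0..1} (\<lambda>t. \<alpha> t k l)" if "Suc k < m" "l < n" for k l
  proof -
    have "Suc (l - 1) < n" using that mn by auto
    then show ?thesis using rm that unfolding \<alpha>_def rate_motion_def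
      by (cases "Suc l < n") (auto intro!: continuous_intros simp: divide_inverse)
  qed
  have cont': "continuous_on {0..1} (\<lambda>t. \<beta> t k l)" if "k < m" "Suc l < n" for k l
  proof -
    have "Suc (k - 1) < m" using that mn by auto
    then show ?thesis using rm that unfolding \<beta>_def rate_motion_def
      by (cases "Suc k < m") (auto intro!: continuous_intros simp: divide_inverse)
  qed
  have al0: "\<alpha> 0 k l = 1" if "Suc k < m" "l < n" for k l
    using rm that mn unfolding \<alpha>_def rate_motion_def by auto
  have be0: "\<beta> 0 k l = 1" if "k < m" "Suc l < n" for k l
    using rm that mn unfolding \<beta>_def rate_motion_def by auto
  have "combescure m n P D"
    unfolding combescure_def
  proof (intro conjI allI impI ballI; (elim conjE)?)
    fix k l assume kl: "k < m" "l < n"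
    show "continuous_on {0..1} (\<lambda>t. D t k l)"
      unfolding D_def using kl by (intro continuous_intros cont cont') auto
    have "D 0 k l = P 0 0 + (\<Sum>i<k. P (Suc i) 0 - P i 0) + (\<Sum>j<l. P k (Suc j) - P k j)"
      unfolding D_def using kl by (simp add: al0 be0)
    then show "D 0 k l = P k l" by (simp add: sum_lessThan_telescope[of "\<lambda>i. P i 0"] sum_lessThan_telescope[of "P k"])
  next
    fix t :: real and k l assume "t \<in> {0..1}" "Suc k < m" "l < n"
    then show "\<exists>\<alpha>. D t (Suc k) l - D t k l = \<alpha> *\<^sub>R (P (Suc k) l - P k l)" using Dk by blast
  next
    fix t :: real and k l assume "k < m" "Suc l < n"
    then show "\<exists>\<alpha>. D t k (Suc l) - D t k l = \<alpha> *\<^sub>R (P k (Suc l) - P k l)" using Dl by blast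
  next
    fix t :: real and k l assume t: "t \<in> {0..1}" and kl: "Suc k < m" "Suc l < n"
    have kl': "k < m" "l < n" using kl by auto
    have "area4 (D t k l) (D t (Suc k) l) (D t (Suc k) (Suc l)) (D t k (Suc l)) =
          area4 (P k l) (P (Suc k) l) (P (Suc k) (Suc l)) (P k (Suc l)) * ((c t k l)\<^sup>2 - (h t k l)\<^sup>2)"
      by (rule parallel_quad_area[OF cv[OF kl]])
        (use Dk[OF t kl(1) kl'(2)] Dk[OF t kl] Dl[of t k l] Dl[of t "Suc k" l] al[OF t kl] be[OF t kl] kl
          in \<open>simp_all add: \<alpha>_def \<beta>_def a_def b_def\<close>)
    then show "area4 (D t k l) (D t (Suc k) l) (D t (Suc k) (Suc l)) (D t k (Suc l)) =
          area4 (P k l) (P (Suc k) l) (P (Suc k) (Suc l)) (P k (Suc l))"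
      using rm t kl by (simp add: rate_motion_def)
  qed
  moreover have "\<not> shifted m n P D"
  proof
    assume sh: "shifted m n P D"
    obtain t k l where t: "t \<in> {0..1}" and kl: "Suc k < m" "Suc l < n" and h: "h t k l \<noteq> 0"
      using mv by (auto simp: moving_def)
    have S: "D t i j - P i j = D t 0 0 - P 0 0" if "i < m" "j < n" for i j
      using sh t that unfolding shifted_def by blast
    have E: "D t k l - P k l = D t 0 0 - P 0 0" "D t (Suc k) l - P (Suc k) l = D t 0 0 - P 0 0"
      "D t k (Suc l) - P k (Suc l) = D t 0 0 - P 0 0"
      by (rule S; use kl in simp)+
    have "D t (Suc k) l - D t k l = P (Suc k) l - P k l" by (rule shift_diff[OF E(1,2)])
    then have "(\<alpha> t k l - 1) *\<^sub>R (P (Suc k) l - P k l) = 0" using Dk[OF t kl(1)] kl(2) by (simp add: algebra_simps)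
    then have 1: "\<alpha> t k l = 1" using edges_nonzero(1)[of k l] kl by simp
    have "D t k (Suc l) - D t k l = P k (Suc l) - P k l" by (rule shift_diff[OF E(1,3)])
    then have "(\<beta> t k l - 1) *\<^sub>R (P k (Suc l) - P k l) = 0" using Dl[of t k l] by (simp add: algebra_simps)
    then have "\<beta> t k l = 1" using edges_nonzero(2)[of k l] kl by simp
    then have "c t k l + b k l * h t k l = c t k l + a k l * h t k l" using 1 kl by (simp add: \<alpha>_def \<beta>_def)
    then have "(a k l - b k l) * h t k l = 0" by (auto simp: left_diff_distrib)
    then show False using h a_pos[OF kl] b_neg[OF kl] by simp
  qed
  ultimately show ?thesis by blast
qed

lemma rate_motion_if_combescure:
  assumes cb: "combescure m n P D" and ns: "\<not> shifted m n P D"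
  shows "\<exists>c h. rate_motion m n a b c h \<and> moving m n h"
proof -
  \<comment> \<open>Projection onto the original edge recovers the scalar, which
    \<open>combescure\<close> only asserts to exist at each time, as a continuous function of
    \<open>t\<close>.\<close>
  define \<alpha> where "\<alpha> t k l = (D t (Suc k) l - D t k l) \<bullet> (P (Suc k) l - P k l) /
      ((P (Suc k) l - P k l) \<bullet> (P (Suc k) l - P k l))" for t k l
  define \<beta> where "\<beta> t k l = (D t k (Suc l) - D t k l) \<bullet> (P k (Suc l) - P k l) /
      ((P k (Suc l) - P k l) \<bullet> (P k (Suc l) - P k l))" for t k l
  define h where "h t k l = (\<beta> t k l - \<alpha> t k l) / (b k l - a k l)" for t k l
  define c where "c t k l = \<alpha> t k l - a k l * h t k l" for t k l
  have Dk: "D t (Suc k) l - D t k l = \<alpha> t k l *\<^sub>R (P (Suc k) l - P k l)"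
    if t: "t \<in> {0..1}" and kl: "Suc k < m" "l < n" for t k l
  proof -
    obtain x where x: "D t (Suc k) l - D t k l = x *\<^sub>R (P (Suc k) l - P k l)"
      using cb t kl unfolding combescure_def by blast
    then have "\<alpha> t k l = x" using edges_nonzero(1)[OF kl] by (simp add: \<alpha>_def)
    then show ?thesis using x by simp
  qed
  have Dl: "D t k (Suc l) - D t k l = \<beta> t k l *\<^sub>R (P k (Suc l) - P k l)"
    if t: "t \<in> {0..1}" and kl: "k < m" "Suc l < n" for t k l
  proof -
    obtain x where x: "D t k (Suc l) - D t k l = x *\<^sub>R (P k (Suc l) - P k l)"
      using cb t kl unfolding combescure_def by blast
    then have "\<beta> t k l = x" using edges_nonzero(2)[OF kl] by (simp add: \<beta>_def)
    then show ?thesis using x by simp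
  qed
  have D0: "D 0 k l = P k l" and contD: "continuous_on {0..1} (\<lambda>t. D t k l)" if "k < m" "l < n" for k l
    using cb that unfolding combescure_def by auto
  have sc: "\<alpha> t k l = c t k l + a k l * h t k l \<and> \<alpha> t k (Suc l) = c t k l + h t k l / a k l \<and>
      \<beta> t k l = c t k l + b k l * h t k l \<and> \<beta> t (Suc k) l = c t k l + h t k l / b k l"
    if t: "t \<in> {0..1}" and kl: "Suc k < m" "Suc l < n" for t k l
  proof -
    have kl': "k < m" "l < n" using kl by auto
    have "\<alpha> t k l *\<^sub>R (P (Suc k) l - P k l) + \<beta> t (Suc k) l *\<^sub>R (P (Suc k) (Suc l) - P (Suc k) l) =
       \<beta> t k l *\<^sub>R (P k (Suc l) - P k l) + \<alpha> t k (Suc l) *\<^sub>R (P (Suc k) (Suc l) - P k (Suc l))"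
      using quad_closing[of "D t (Suc k) l" "D t k l" _ "D t (Suc k) (Suc l)" _ "D t k (Suc l)"]
        Dk[OF t kl(1) kl'(2)] Dk[OF t kl] Dl[OF t kl'(1) kl(2)] Dl[OF t kl] by blast
    then obtain c' h' where e: "\<alpha> t k l = c' + a k l * h'" "\<alpha> t k (Suc l) = c' + h' / a k l"
      "\<beta> t k l = c' + b k l * h'" "\<beta> t (Suc k) l = c' + h' / b k l"
      unfolding parallel_quad_iff[OF cv[OF kl]] a_def[symmetric] b_def[symmetric] by blast
    have "\<beta> t k l - \<alpha> t k l = (b k l - a k l) * h'" unfolding e by (simp add: algebra_simps)
    then have "h t k l = h'" using a_pos[OF kl] b_neg[OF kl] by (simp add: h_def)
    moreover from this have "c t k l = c'" using e(1) by (simp add: c_def)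
    ultimately show ?thesis using e by simp
  qed
  have sq: "(c t k l)\<^sup>2 = 1 + (h t k l)\<^sup>2" if t: "t \<in> {0..1}" and kl: "Suc k < m" "Suc l < n" for t k l
  proof -
    let ?A = "area4 (P k l) (P (Suc k) l) (P (Suc k) (Suc l)) (P k (Suc l))"
    have kl': "k < m" "l < n" using kl by auto
    have "area4 (D t k l) (D t (Suc k) l) (D t (Suc k) (Suc l)) (D t k (Suc l)) = ?A * ((c t k l)\<^sup>2 - (h t k l)\<^sup>2)"
      by (rule parallel_quad_area[OF cv[OF kl]])
        (use Dk[OF t kl(1) kl'(2)] Dk[OF t kl] Dl[OF t kl'(1) kl(2)] Dl[OF t kl] sc[OF t kl]
          in \<open>simp_all add: a_def b_def\<close>)
    moreover have "area4 (D t k l) (D t (Suc k) l) (D t (Suc k) (Suc l)) (D t k (Suc l)) = ?A"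
      using cb t kl unfolding combescure_def by blast
    moreover have "?A \<noteq> 0" using cv[OF kl] by (auto simp: area4_def convex4_def)
    ultimately show ?thesis by simp
  qed
  have ca: "continuous_on {0..1} (\<lambda>t. \<alpha> t k l)" "\<alpha> 0 k l = 1" if "Suc k < m" "l < n" for k l
    unfolding \<alpha>_def using that edges_nonzero(1)[OF that]
    by (auto intro!: continuous_intros contD simp: D0 simp del: eq_iff_diff_eq_0)
  have cb': "continuous_on {0..1} (\<lambda>t. \<beta> t k l)" "\<beta> 0 k l = 1" if "k < m" "Suc l < n" for k l
    unfolding \<beta>_def using that edges_nonzero(2)[OF that]
    by (auto intro!: continuous_intros contD simp: D0)
  have ch: "continuous_on {0..1} (\<lambda>t. h t k l)" "h 0 k l = 0" "continuous_on {0..1} (\<lambda>t. c t k l)" "c 0 k l = 1"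
    if kl: "Suc k < m" "Suc l < n" for k l
  proof -
    have "b k l - a k l \<noteq> 0" using a_pos[OF kl] b_neg[OF kl] by simp
    then show h: "continuous_on {0..1} (\<lambda>t. h t k l)" and h0: "h 0 k l = 0"
      using kl unfolding h_def by (auto intro!: continuous_intros ca cb' simp: ca cb')
    show "continuous_on {0..1} (\<lambda>t. c t k l)" "c 0 k l = 1"
      unfolding c_def using kl h h0 by (auto intro!: continuous_intros ca simp: ca)
  qed
  have rm: "rate_motion m n a b c h"
    unfolding rate_motion_def
  proof (intro conjI allI impI ballI; (elim conjE)?)
    fix t :: real and k l assume t: "t \<in> {0..1}" and kl: "Suc (Suc k) < m" "Suc l < n"
    show "c t k l + h t k l / b k l = c t (Suc k) l + b (Suc k) l * h t (Suc k) l"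
      using sc[OF t, of k l] sc[OF t, of "Suc k" l] kl by simp
  next
    fix t :: real and k l assume t: "t \<in> {0..1}" and kl: "Suc k < m" "Suc (Suc l) < n"
    show "c t k l + h t k l / a k l = c t k (Suc l) + a k (Suc l) * h t k (Suc l)"
      using sc[OF t, of k l] sc[OF t, of k "Suc l"] kl by simp
  qed (use ch sq in auto)
  moreover have "moving m n h"
  proof (rule ccontr)
    assume "\<not> moving m n h"
    then have h0: "h t k l = 0" if "t \<in> {0..1}" "Suc k < m" "Suc l < n" for t k l
      using that by (auto simp: moving_def)
    have c1: "c t k l = 1" if "t \<in> {0..1}" "Suc k < m" "Suc l < n" for t k l
      using rate_motion_pos[OF rm that(2,3,1)] sq[OF that] h0[OF that] by (auto simp: power2_eq_1_iff)
    have a1: "\<alpha> t k l = 1" if "t \<in> {0..1}" "Suc k < m" "l < n" for t k l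
    proof (cases "Suc l < n")
      case True then show ?thesis using sc[of t k l] h0[of t k l] c1[of t k l] that by simp
    next
      case False
      then obtain l' where "l = Suc l'" using that mn by (cases l) auto
      then show ?thesis using sc[of t k l'] h0[of t k l'] c1[of t k l'] that by simp
    qed
    have b1: "\<beta> t k l = 1" if "t \<in> {0..1}" "k < m" "Suc l < n" for t k l
    proof (cases "Suc k < m")
      case True then show ?thesis using sc[of t k l] h0[of t k l] c1[of t k l] that by simp
    next
      case False
      then obtain k' where "k = Suc k'" using that mn by (cases k) auto
      then show ?thesis using sc[of t k' l] h0[of t k' l] c1[of t k' l] that by simp
    qed
    have e0: "D t k 0 - P k 0 = D t 0 0 - P 0 0" if "t \<in> {0..1}" "k < m" for t k
      using that(2)
    proof (induction k)
      case (Suc k)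
      have "D t (Suc k) 0 - D t k 0 = P (Suc k) 0 - P k 0"
        using Dk[OF that(1), of k 0] a1[OF that(1), of k 0] Suc.prems mn by simp
      from same_shift[OF this] show ?case using Suc by simp
    qed simp
    have "D t k l - P k l = D t 0 0 - P 0 0" if "t \<in> {0..1}" "k < m" "l < n" for t k l
      using that(3)
    proof (induction l)
      case (Suc l)
      have "D t k (Suc l) - D t k l = P k (Suc l) - P k l"
        using Dl[OF that(1), of k l] b1[OF that(1), of k l] Suc.prems that by simp
      from same_shift[OF this] show ?case using Suc by simp
    qed (use e0[OF that(1,2)] in simp)
    then have "shifted m n P D" unfolding shifted_def by blast
    then show False using ns by simp
  qed
  ultimately show ?thesis by blast
qed

end

subsection \<open>Movable grids\<close>

text \<open>Mirroring in the first grid direction keeps the base rate and exchanges the two side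
  scalings, which inverts the side rate. Neighbours can then carry the same \<open>c\<close> and
  \<open>h\<close>.\<close>

definition pairs_mirrored :: "nat \<Rightarrow> nat \<Rightarrow> (nat \<Rightarrow> nat \<Rightarrow> real) \<Rightarrow> (nat \<Rightarrow> nat \<Rightarrow> real) \<Rightarrow> bool" where
  "pairs_mirrored m n a b \<longleftrightarrow>
     (\<forall>k l. Suc (Suc k) < m \<and> Suc l < n \<longrightarrow> a (Suc k) l = a k l \<and> b (Suc k) l = 1 / b k l)"

definition rates_matched :: "nat \<Rightarrow> nat \<Rightarrow> (nat \<Rightarrow> nat \<Rightarrow> real) \<Rightarrow> (nat \<Rightarrow> nat \<Rightarrow> real) \<Rightarrow> bool" where
  "rates_matched m n a b \<longleftrightarrow>
     (\<forall>k l. Suc (Suc k) < m \<and> Suc l < n \<longrightarrow> b (Suc k) l = 1 / b k l) \<and>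
     (\<forall>k l. Suc k < m \<and> Suc (Suc l) < n \<longrightarrow> a k (Suc l) = 1 / a k l)"

lemma continuous_small:
  fixes f :: "real \<Rightarrow> real"
  assumes "continuous_on {0..1} f" "t0 \<in> {0..1}" "f t0 = 0" "0 < \<delta>"
  obtains e where "0 < e" "\<And>t. t \<in> {0..1} \<Longrightarrow> \<bar>t - t0\<bar> < e \<Longrightarrow> \<bar>f t\<bar> < \<delta>"
  using assms unfolding continuous_on_iff dist_real_def by (metis diff_zero)

lemma rate_motion_swap:
  assumes "rate_motion m n a b c h"
  shows "rate_motion n m (\<lambda>k l. - b l k) (\<lambda>k l. - a l k) (\<lambda>t k l. c t l k) (\<lambda>t k l. - h t l k)"
  using assms unfolding rate_motion_def by (auto intro: continuous_intros)

lemma moving_swap: "moving m n h \<Longrightarrow> moving n m (\<lambda>t k l. - h t l k)"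
  unfolding moving_def by auto

locale rate_grid =
  fixes m n :: nat and a b :: "nat \<Rightarrow> nat \<Rightarrow> real"
  assumes mn: "2 \<le> m" "2 \<le> n"
    and a: "\<And>k l. Suc k < m \<Longrightarrow> Suc l < n \<Longrightarrow> 0 < a k l"
    and b: "\<And>k l. Suc k < m \<Longrightarrow> Suc l < n \<Longrightarrow> b k l < 0"
begin

text \<open>All four rates appear because, in the different blocks, a quadrilateral meets its
  neighbours along any of its sides.\<close>

definition small_motion :: "(real \<Rightarrow> nat \<Rightarrow> nat \<Rightarrow> real) \<Rightarrow> (real \<Rightarrow> nat \<Rightarrow> nat \<Rightarrow> real) \<Rightarrow> real set \<Rightarrow> bool" where
  "small_motion c h J \<longleftrightarrow> J \<subseteq> {0..1} \<and>
     (\<forall>k l. Suc k < m \<and> Suc l < n \<longrightarrow> infinite ((\<lambda>t. h t k l) ` J) \<and>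
        (\<forall>t\<in>J. 0 < h t k l + a k l * c t k l \<and> h t k l + b k l * c t k l < 0 \<and>
           0 < h t k l + (1 / a k l) * c t k l \<and> h t k l + (1 / b k l) * c t k l < 0))"

text \<open>Restrict to a time interval just after the last moment $t_0$ at which nothing has moved yet:
  there every $h$ is so small that the branch conditions hold, and if one $h$ is nonzero, all are.\<close>

lemma small_motion_exists:
  assumes rm: "rate_motion m n a b c h" and mv: "moving m n h"
  shows "\<exists>J. small_motion c h J"
proof -
  define K where "K = {(k, l). Suc k < m \<and> Suc l < n}"
  have "K \<subseteq> {..<m} \<times> {..<n}" by (auto simp: K_def)
  then have finK: "finite K" by (rule finite_subset) simp
  have K0: "(0, 0) \<in> K" using mn by (auto simp: K_def)
  define N where "N = {t \<in> {0..1}. \<exists>k l. (k, l) \<in> K \<and> h t k l \<noteq> 0}"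
  obtain t k l where "t \<in> {0..1}" "Suc k < m" "Suc l < n" "h t k l \<noteq> 0"
    using mv unfolding moving_def by blast
  then have "t \<in> N" unfolding N_def K_def by blast
  then have N: "N \<noteq> {}" by blast
  have bd: "bdd_below N" by (rule bdd_belowI[of _ 0]) (auto simp: N_def)
  define t0 where "t0 = Inf N"
  have ch: "continuous_on {0..1} (\<lambda>t. h t k l)" "h 0 k l = 0" if "(k, l) \<in> K" for k l
    using rm that unfolding rate_motion_def K_def by auto
  have t0: "t0 \<in> {0..1}"
  proof -
    obtain t where "t \<in> N" using N by blast
    then have "t0 \<le> t" "t \<le> 1" unfolding t0_def using bd by (auto intro: cInf_lower simp: N_def)
    moreover have "0 \<le> t0" unfolding t0_def using N by (intro cInf_greatest) (auto simp: N_def)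
    ultimately show ?thesis by simp
  qed
  have h0: "h t0 k l = 0" if kl: "(k, l) \<in> K" for k l
  proof (rule ccontr)
    assume ne: "h t0 k l \<noteq> 0"
    then have "t0 \<noteq> 0" using ch(2)[OF kl] by auto
    then have pos: "0 < t0" using t0 by simp
    have "continuous_on {0..1} (\<lambda>t. h t k l)" by (rule ch(1)[OF kl])
    then obtain e where e: "e > 0" "\<And>t. t \<in> {0..1} \<Longrightarrow> \<bar>t - t0\<bar> < e \<Longrightarrow> \<bar>h t k l - h t0 k l\<bar> < \<bar>h t0 k l\<bar>"
      using t0 ne unfolding continuous_on_iff dist_real_def by (metis zero_less_abs_iff)
    define t where "t = max 0 (t0 - e / 2)"
    have t: "t \<in> {0..1}" "\<bar>t - t0\<bar> < e" "t < t0" using e(1) pos t0 by (auto simp: t_def)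
    have "\<bar>h t k l - h t0 k l\<bar> < \<bar>h t0 k l\<bar>" using e(2) t by blast
    then have "h t k l \<noteq> 0" by auto
    then have "t \<in> N" using t kl by (auto simp: N_def)
    then have "t0 \<le> t" unfolding t0_def using bd by (rule cInf_lower)
    then show False using t by simp
  qed
  \<comment> \<open>No rate or reciprocal has absolute value below \<open>\<delta>\<close>; with
    \<open>1 \<le> c\<close>, the bound \<open>\<bar>h\<bar> < \<delta>\<close> yields every branch
    inequality.\<close>
  define \<delta> where "\<delta> = Min ((\<lambda>(k, l). min (min (a k l) (1 / a k l)) (min (- b k l) (- 1 / b k l))) ` K)"
  have \<delta>_le: "\<delta> \<le> a k l" "\<delta> \<le> 1 / a k l" "\<delta> \<le> - b k l" "\<delta> \<le> - 1 / b k l" if "(k, l) \<in> K" for k l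
  proof -
    have "\<delta> \<le> min (min (a k l) (1 / a k l)) (min (- b k l) (- 1 / b k l))"
      unfolding \<delta>_def using finK that by (intro Min_le) (auto intro!: image_eqI[of _ _ "(k, l)"])
    then show "\<delta> \<le> a k l" "\<delta> \<le> 1 / a k l" "\<delta> \<le> - b k l" "\<delta> \<le> - 1 / b k l" by auto
  qed
  have \<delta>: "0 < \<delta>"
    unfolding \<delta>_def using finK K0 a b by (subst Min_gr_iff) (auto simp: K_def zero_less_divide_iff)
  have "\<exists>e>0. \<forall>t\<in>{0..1}. \<bar>t - t0\<bar> < e \<longrightarrow> \<bar>h t k l\<bar> < \<delta>" if "(k, l) \<in> K" for k l
    using continuous_small[OF ch(1)[OF that] t0 h0[OF that] \<delta>] by metis
  then have "\<forall>x\<in>K. \<exists>e>0. \<forall>t\<in>{0..1}. \<bar>t - t0\<bar> < e \<longrightarrow> \<bar>h t (fst x) (snd x)\<bar> < \<delta>" by auto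
  then obtain e where e: "\<And>x. x \<in> K \<Longrightarrow> 0 < e x \<and> (\<forall>t\<in>{0..1}. \<bar>t - t0\<bar> < e x \<longrightarrow> \<bar>h t (fst x) (snd x)\<bar> < \<delta>)"
    by metis
  define e0 where "e0 = Min (e ` K)"
  have e0: "0 < e0" unfolding e0_def using finK K0 e by (subst Min_gr_iff) auto
  have e0_le: "e0 \<le> e x" if "x \<in> K" for x unfolding e0_def using finK that by simp
  have small: "\<bar>h t k l\<bar> < \<delta>" if "t \<in> {0..1}" "\<bar>t - t0\<bar> < e0" "(k, l) \<in> K" for t k l
    using e[OF that(3)] e0_le[OF that(3)] that by force
  have "Inf N < t0 + e0" using e0 by (simp add: t0_def)
  then obtain t1 where t1: "t1 \<in> N" "t1 < t0 + e0" using cInf_lessD[OF N] by blast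
  have "t0 \<le> t1" unfolding t0_def using t1(1) bd by (rule cInf_lower)
  moreover have "t0 \<noteq> t1" using t1(1) h0 by (auto simp: N_def)
  ultimately have lt: "t0 < t1" by simp
  define J where "J = {t0..t1}"
  have J: "t \<in> {0..1} \<and> \<bar>t - t0\<bar> < e0" if "t \<in> J" for t
    using that t0 t1 by (auto simp: J_def N_def)
  have t1J: "t1 \<in> J" using lt by (simp add: J_def)
  have c1: "1 \<le> c t k l" if "t \<in> J" "(k, l) \<in> K" for t k l
    using rate_motion_pos[OF rm] J that by (auto simp: K_def)
  have br: "0 < h t k l + x * c t k l" if "t \<in> J" "(k, l) \<in> K" "\<delta> \<le> x" for t k l x
  proof -
    have "x * 1 \<le> x * c t k l" using that \<delta> c1[OF that(1,2)] by (intro mult_left_mono) auto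
    then show ?thesis using small[of t k l] J[OF that(1)] that by auto
  qed
  have br': "h t k l + x * c t k l < 0" if "t \<in> J" "(k, l) \<in> K" "\<delta> \<le> - x" for t k l x
  proof -
    have "- x * 1 \<le> - x * c t k l" using that \<delta> c1[OF that(1,2)] by (intro mult_left_mono) auto
    then show ?thesis using small[of t k l] J[OF that(1)] that by auto
  qed
  have branch: "0 < h t k l + a k l * c t k l" "h t k l + b k l * c t k l < 0"
      "0 < h t k l + (1 / a k l) * c t k l" "h t k l + (1 / b k l) * c t k l < 0" if "t \<in> J" "(k, l) \<in> K" for t k l
    using br[OF that] br'[OF that] \<delta>_le[OF that(2)] by (simp_all del: times_divide_eq_left)
  have sq: "(c t k l)\<^sup>2 = 1 + (h t k l)\<^sup>2" if "t \<in> J" "(k, l) \<in> K" for t k l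
    using rm J[OF that(1)] that(2) unfolding rate_motion_def K_def by blast
  \<comment> \<open>A quadrilateral at rest has scaling 1 on the common side;
    \<open>branch_unique\<close>, applied to its neighbour and the rest position
    \<open>(1, 0)\<close>, puts the neighbour at rest as well.\<close>
  have zero_iff: "h t1 k l = 0 \<longleftrightarrow> h t1 k' l' = 0"
    if kl: "(k, l) \<in> K" "(k', l') \<in> K" and eq: "c t1 k l + x * h t1 k l = c t1 k' l' + y * h t1 k' l'"
      and x: "0 < x \<and> 0 < y \<and> 0 < h t1 k l + x * c t1 k l \<and> 0 < h t1 k' l' + y * c t1 k' l' \<or>
        x < 0 \<and> y < 0 \<and> h t1 k l + x * c t1 k l < 0 \<and> h t1 k' l' + y * c t1 k' l' < 0" for k l k' l' x y
  proof -
    have *: "h2 = 0" if "h1 = 0" "c1\<^sup>2 = 1 + h1\<^sup>2" "c2\<^sup>2 = 1 + h2\<^sup>2" "1 \<le> c1" "1 \<le> c2" "c1 + x * h1 = c2 + y * h2"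
      "0 < y \<and> 0 < h1 + x * c1 \<and> 0 < h2 + y * c2 \<or> y < 0 \<and> h1 + x * c1 < 0 \<and> h2 + y * c2 < 0" for c1 h1 c2 h2 x y :: real
    proof -
      have c1: "c1 = 1" using that by (auto simp: power2_eq_1_iff)
      have "1 + y * 0 = c2 + y * h2" using that c1 by simp
      then show ?thesis
        using branch_unique[of 1 0 c2 h2 y] that c1 by auto
    qed
    show ?thesis
      using *[of "h t1 k l" "c t1 k l" "c t1 k' l'" "h t1 k' l'" x y]
        *[of "h t1 k' l'" "c t1 k' l'" "c t1 k l" "h t1 k l" y x] sq[OF t1J kl(1)] sq[OF t1J kl(2)]
        c1[OF t1J kl(1)] c1[OF t1J kl(2)] eq x by auto
  qed
  have t1': "t1 \<in> {0..1}" using J[OF t1J] by simp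
  have sgn: "0 < a k l" "b k l < 0" "0 < 1 / a k l" "1 / b k l < 0" if "(k, l) \<in> K" for k l
    using a[of k l] b[of k l] that by (auto simp: K_def)
  have stepk: "h t1 (Suc k) l = 0 \<longleftrightarrow> h t1 k l = 0" if "Suc (Suc k) < m" "Suc l < n" for k l
  proof -
    have kl: "(k, l) \<in> K" "(Suc k, l) \<in> K" using that by (auto simp: K_def)
    have "c t1 k l + (1 / b k l) * h t1 k l = c t1 (Suc k) l + b (Suc k) l * h t1 (Suc k) l"
      using rm t1' that unfolding rate_motion_def by simp
    then show ?thesis using zero_iff[OF kl] branch[OF t1J kl(1)] branch[OF t1J kl(2)] sgn[OF kl(1)] sgn[OF kl(2)] by blast
  qed
  have stepl: "h t1 k (Suc l) = 0 \<longleftrightarrow> h t1 k l = 0" if "Suc k < m" "Suc (Suc l) < n" for k l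
  proof -
    have kl: "(k, l) \<in> K" "(k, Suc l) \<in> K" using that by (auto simp: K_def)
    have "c t1 k l + (1 / a k l) * h t1 k l = c t1 k (Suc l) + a k (Suc l) * h t1 k (Suc l)"
      using rm t1' that unfolding rate_motion_def by simp
    then show ?thesis using zero_iff[OF kl] branch[OF t1J kl(1)] branch[OF t1J kl(2)] sgn[OF kl(1)] sgn[OF kl(2)] by blast
  qed
  have allk: "h t1 k 0 = 0 \<longleftrightarrow> h t1 0 0 = 0" if "Suc k < m" for k
    using that by (induction k) (use stepk mn in auto)
  have all: "h t1 k l = 0 \<longleftrightarrow> h t1 0 0 = 0" if "Suc k < m" "Suc l < n" for k l
    using that(2) by (induction l) (use stepl allk[OF that(1)] that(1) in auto)
  have ne: "h t1 k l \<noteq> 0" if "(k, l) \<in> K" for k l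
  proof -
    obtain k' l' where "(k', l') \<in> K" "h t1 k' l' \<noteq> 0" using t1(1) by (auto simp: N_def)
    then show ?thesis using all[of k' l'] all[of k l] that by (auto simp: K_def)
  qed
  have "infinite ((\<lambda>t. h t k l) ` J)" if kl: "(k, l) \<in> K" for k l
  proof -
    have "continuous_on J (\<lambda>t. h t k l)" by (rule continuous_on_subset[OF ch(1)[OF kl]]) (use J in blast)
    then have "connected ((\<lambda>t. h t k l) ` J)" unfolding J_def by (intro connected_continuous_image) auto
    moreover have "h t0 k l \<in> (\<lambda>t. h t k l) ` J" "h t1 k l \<in> (\<lambda>t. h t k l) ` J" using lt by (auto simp: J_def)
    ultimately show ?thesis using h0[OF kl] ne[OF kl] connected_finite_iff_sing by (metis empty_iff singletonD)
  qed
  then have "small_motion c h J"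
    unfolding small_motion_def using branch J by (auto simp: K_def)
  then show ?thesis by blast
qed

text \<open>Around the common corner the block runs through \<open>(k, l)\<close>,
  \<open>(Suc k, l)\<close>, \<open>(Suc k, Suc l)\<close>, \<open>(k, Suc l)\<close>. A
  quadrilateral enters with the rate itself where it shows its bottom or left side to a neighbour,
  and with the reciprocal at its top or right side.\<close>

lemma block_types:
  assumes rm: "rate_motion m n a b c h" and sm: "small_motion c h J" and kl: "Suc (Suc k) < m" "Suc (Suc l) < n"
  shows "b (Suc k) l = 1 / b k l \<and> a (Suc k) (Suc l) = 1 / a (Suc k) l \<and>
      b (Suc k) (Suc l) = 1 / b k (Suc l) \<and> a k (Suc l) = 1 / a k l \<or>
    a (Suc k) l = a k l \<and> b (Suc k) l = 1 / b k l \<and> a (Suc k) (Suc l) = a k (Suc l) \<and>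
      b (Suc k) (Suc l) = 1 / b k (Suc l) \<or>
    a k (Suc l) = 1 / a k l \<and> b k (Suc l) = b k l \<and> a (Suc k) (Suc l) = 1 / a (Suc k) l \<and>
      b (Suc k) (Suc l) = b (Suc k) l"
proof -
  have kl': "Suc k < m" "Suc l < n" using kl by auto
  have J: "t \<in> {0..1}" if "t \<in> J" for t using that sm by (auto simp: small_motion_def)
  have pt: "motion J x y (\<lambda>t. c t i j) (\<lambda>t. h t i j)"
    if "Suc i < m" "Suc j < n" "x = a i j \<or> x = 1 / a i j" "y = b i j \<or> y = 1 / b i j" for i j x y
  proof -
    have "0 < c t i j \<and> (c t i j)\<^sup>2 = 1 + (h t i j)\<^sup>2" if "t \<in> J" for t
      using rate_motion_pos[OF rm \<open>Suc i < m\<close> \<open>Suc j < n\<close> J[OF that]] rm J[OF that] \<open>Suc i < m\<close> \<open>Suc j < n\<close>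
      unfolding rate_motion_def by force
    moreover have "0 < x" "y < 0" using a[OF that(1,2)] b[OF that(1,2)] that(3,4) by (auto simp: divide_neg_neg)
    ultimately show ?thesis
      using sm that unfolding motion_def small_motion_def by blast
  qed
  have link: "c t i j + (1 / b i j) * h t i j = c t (Suc i) j + b (Suc i) j * h t (Suc i) j"
    if "t \<in> J" "Suc (Suc i) < m" "Suc j < n" for t i j
    using rm J[OF that(1)] that(2,3) unfolding rate_motion_def by simp
  have link': "c t i j + (1 / a i j) * h t i j = c t i (Suc j) + a i (Suc j) * h t i (Suc j)"
    if "t \<in> J" "Suc i < m" "Suc (Suc j) < n" for t i j
    using rm J[OF that(1)] that(2,3) unfolding rate_motion_def by simp
  have "block_motion J (1 / a k l) (1 / b k l) (\<lambda>t. c t k l) (\<lambda>t. h t k l)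
     (1 / a (Suc k) l) (b (Suc k) l) (\<lambda>t. c t (Suc k) l) (\<lambda>t. h t (Suc k) l)
     (a (Suc k) (Suc l)) (b (Suc k) (Suc l)) (\<lambda>t. c t (Suc k) (Suc l)) (\<lambda>t. h t (Suc k) (Suc l))
     (a k (Suc l)) (1 / b k (Suc l)) (\<lambda>t. c t k (Suc l)) (\<lambda>t. h t k (Suc l))"
    unfolding block_motion_def
  proof (intro conjI ballI)
    fix t assume t: "t \<in> J"
    show "c t k l + 1 / b k l * h t k l = c t (Suc k) l + b (Suc k) l * h t (Suc k) l"
      using link[OF t kl(1) kl'(2)] .
    show "c t (Suc k) l + 1 / a (Suc k) l * h t (Suc k) l = c t (Suc k) (Suc l) + a (Suc k) (Suc l) * h t (Suc k) (Suc l)"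
      using link'[OF t kl] .
    show "c t (Suc k) (Suc l) + b (Suc k) (Suc l) * h t (Suc k) (Suc l) = c t k (Suc l) + 1 / b k (Suc l) * h t k (Suc l)"
      using link[OF t kl] by simp
    show "c t k (Suc l) + a k (Suc l) * h t k (Suc l) = c t k l + 1 / a k l * h t k l"
      using link'[OF t kl'(1) kl(2)] by simp
  qed (use pt kl in auto)
  from block_classification[OF this] show ?thesis
    by (auto simp: divide_inverse)
qed

end

text \<open>One block of mirrored but unmatched type forces its whole row pair, and then every row pair,
  to be mirrored.\<close>

lemma propagate_blocks:
  fixes a b :: "nat \<Rightarrow> nat \<Rightarrow> real"
  assumes bl: "\<And>k l. Suc (Suc k) < m \<Longrightarrow> Suc (Suc l) < n \<Longrightarrow>
    b (Suc k) l = 1 / b k l \<and> a (Suc k) (Suc l) = 1 / a (Suc k) l \<and>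
      b (Suc k) (Suc l) = 1 / b k (Suc l) \<and> a k (Suc l) = 1 / a k l \<or>
    a (Suc k) l = a k l \<and> b (Suc k) l = 1 / b k l \<and> a (Suc k) (Suc l) = a k (Suc l) \<and>
      b (Suc k) (Suc l) = 1 / b k (Suc l) \<or>
    a k (Suc l) = 1 / a k l \<and> b k (Suc l) = b k l \<and> a (Suc k) (Suc l) = 1 / a (Suc k) l \<and>
      b (Suc k) (Suc l) = b (Suc k) l"
    and bad: "Suc k0 < m" "Suc (Suc l0) < n" "a k0 (Suc l0) \<noteq> 1 / a k0 l0"
  shows "pairs_mirrored m n a b"
proof -
  define X where "X k = (a k (Suc l0) = 1 / a k l0)" for k
  define E where "E k l = (a (Suc k) l = a k l \<and> b (Suc k) l = 1 / b k l)" for k l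
  \<comment> \<open>Types one and three contain both \<open>X k\<close> and
    \<open>X (Suc k)\<close>, so a failure leaves only the mirrored type, which carries the failure
    over to the neighbouring index.\<close>
  have row: "E k l0 \<and> E k (Suc l0) \<and> \<not> X k \<and> \<not> X (Suc k)"
    if "Suc (Suc k) < m" "\<not> X k \<or> \<not> X (Suc k)" for k
    using bl[OF that(1) bad(2)] that(2) unfolding X_def E_def by auto
  have "\<not> X (k0 + i)" if "Suc (k0 + i) < m" for i
    using that bad(3) by (induction i) (use row X_def in auto)
  moreover have "\<not> X (k0 - i)" for i
  proof (induction i)
    case (Suc i)
    show ?case
    proof (cases "k0 - i")
      case 0 then show ?thesis using Suc by (simp add: diff_Suc)
    next
      case (Suc j)
      then have "\<not> X (Suc j)" "Suc (Suc j) < m" using \<open>\<not> X (k0 - i)\<close> bad(1) by auto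
      then show ?thesis using row[of j] Suc by (simp add: diff_Suc)
    qed
  qed (use bad(3) X_def in auto)
  ultimately have nX: "\<not> X k" if "Suc k < m" for k
    using that by (metis le_add_diff_inverse diff_diff_cancel nat_le_linear)
  have start: "E k l0" if "Suc (Suc k) < m" for k using row nX that by auto
  \<comment> \<open>Whichever type the block has, it carries the mirror relation of one row to the
    adjacent row.\<close>
  have up: "E k (Suc l)" if "E k l" "Suc (Suc k) < m" "Suc (Suc l) < n" for k l
    using bl[OF that(2,3)] that(1) unfolding E_def by auto
  have down: "E k l" if "E k (Suc l)" "Suc (Suc k) < m" "Suc (Suc l) < n" for k l
    using bl[OF that(2,3)] that(1) unfolding E_def by (auto simp: divide_inverse)
  have "E k (l0 + i)" if "Suc (l0 + i) < n" "Suc (Suc k) < m" for k i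
    using that by (induction i) (use start up in auto)
  moreover have "E k (l0 - i)" if "Suc (Suc k) < m" for k i
  proof (induction i)
    case (Suc i)
    show ?case
    proof (cases "l0 - i")
      case 0 then show ?thesis using Suc by (simp add: diff_Suc)
    next
      case (Suc j)
      then have "E k (Suc j)" "Suc (Suc j) < n" using \<open>E k (l0 - i)\<close> bad(2) by auto
      then show ?thesis using down[of k j] that Suc by (simp add: diff_Suc)
    qed
  qed (use start that in auto)
  ultimately have "E k l" if "Suc (Suc k) < m" "Suc l < n" for k l
    using that by (metis le_add_diff_inverse diff_diff_cancel nat_le_linear)
  then show ?thesis unfolding pairs_mirrored_def E_def by blast
qed

section \<open>Movable rate grids: necessity and existence\<close>

context rate_grid begin

lemma rates_if_moving:
  assumes rm: "rate_motion m n a b c h" and mv: "moving m n h"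
  shows "pairs_mirrored m n a b \<or> pairs_mirrored n m (\<lambda>k l. - b l k) (\<lambda>k l. - a l k) \<or> rates_matched m n a b"
proof -
  obtain J where sm: "small_motion c h J" using small_motion_exists[OF rm mv] by blast
  note bt = block_types[OF rm sm]
  consider "m = 2" | "n = 2" | "3 \<le> m" "3 \<le> n" using mn by linarith
  then show ?thesis
  proof cases
    case 1 then show ?thesis by (auto simp: pairs_mirrored_def)
  next
    case 2 then show ?thesis by (auto simp: pairs_mirrored_def)
  next
    case 3
    show ?thesis
    proof (cases "rates_matched m n a b")
      case False
      then consider k l where "Suc k < m" "Suc (Suc l) < n" "a k (Suc l) \<noteq> 1 / a k l"
        | k l where "Suc (Suc k) < m" "Suc l < n" "b (Suc k) l \<noteq> 1 / b k l"
        unfolding rates_matched_def by blast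
      then show ?thesis
      proof cases
        case 1
        from propagate_blocks[OF bt 1] show ?thesis by blast
      next
        case 2
        have "pairs_mirrored n m (\<lambda>k l. - b l k) (\<lambda>k l. - a l k)"
          by (rule propagate_blocks[of n m "\<lambda>k l. - a l k" "\<lambda>k l. - b l k" l k])
            (use bt 2 in auto)
        then show ?thesis by blast
      qed
    qed blast
  qed
qed

lemma moving_if_matched:
  assumes "rates_matched m n a b"
  shows "\<exists>c h. rate_motion m n a b c h \<and> moving m n h"
proof (intro exI conjI)
  show "rate_motion m n a b (\<lambda>t k l. sqrt (1 + t\<^sup>2)) (\<lambda>t k l. t)"
    using assms unfolding rate_motion_def rates_matched_def
    by (auto intro!: continuous_intros)
  show "moving m n (\<lambda>t k l. t)"
    unfolding moving_def using mn by (intro bexI[of _ 1] exI[of _ 0]) auto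
qed

text \<open>\<open>hsol\<close> and \<open>csol\<close> solve $c + a h = \alpha$, $c^2 - h^2 = 1$ on the branch $h \ge 0$,
  in a form that is continuous also at $a = 1$.\<close>

definition hsol :: "real \<Rightarrow> real \<Rightarrow> real" where
  "hsol x \<alpha> = (\<alpha>\<^sup>2 - 1) / (x * \<alpha> + sqrt (\<alpha>\<^sup>2 + x\<^sup>2 - 1))"
definition csol :: "real \<Rightarrow> real \<Rightarrow> real" where
  "csol x \<alpha> = (\<alpha> * sqrt (\<alpha>\<^sup>2 + x\<^sup>2 - 1) + x) / (x * \<alpha> + sqrt (\<alpha>\<^sup>2 + x\<^sup>2 - 1))"

text \<open>Eliminating \<open>c\<close> gives a quadratic for \<open>h\<close> with root
  \<open>(x * \<alpha> - r) / (x\<^sup>2 - 1)\<close>, where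
  \<open>r = sqrt (\<alpha>\<^sup>2 + x\<^sup>2 - 1)\<close>. Extending the fraction by
  \<open>x * \<alpha> + r\<close> cancels the factor \<open>x\<^sup>2 - 1\<close>.\<close>

lemma hsol_csol:
  assumes "0 < x" "1 \<le> \<alpha>"
  shows "csol x \<alpha> + x * hsol x \<alpha> = \<alpha>" "(csol x \<alpha>)\<^sup>2 = 1 + (hsol x \<alpha>)\<^sup>2" "0 \<le> hsol x \<alpha>" "1 \<le> csol x \<alpha>"
    "1 < \<alpha> \<Longrightarrow> 0 < hsol x \<alpha>" "0 < x * \<alpha> + sqrt (\<alpha>\<^sup>2 + x\<^sup>2 - 1)"
proof -
  define r where "r = sqrt (\<alpha>\<^sup>2 + x\<^sup>2 - 1)"
  have al: "1 \<le> \<alpha>\<^sup>2" using assms by simp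
  then have "1 \<le> \<alpha>\<^sup>2 + x\<^sup>2" by (simp add: add_increasing2)
  then have r2: "r\<^sup>2 = \<alpha>\<^sup>2 + x\<^sup>2 - 1" and r0: "0 \<le> r" by (auto simp: r_def)
  define d where "d = x * \<alpha> + r"
  have d: "0 < d" using assms r0 by (simp add: d_def add_pos_nonneg)
  then show "0 < x * \<alpha> + sqrt (\<alpha>\<^sup>2 + x\<^sup>2 - 1)" by (simp add: d_def r_def)
  have h: "hsol x \<alpha> * d = \<alpha>\<^sup>2 - 1" and c: "csol x \<alpha> * d = \<alpha> * r + x"
    using d by (auto simp: hsol_def csol_def d_def r_def)
  have "(csol x \<alpha> + x * hsol x \<alpha>) * d = \<alpha> * d" using h c unfolding d_def by algebra
  then show "csol x \<alpha> + x * hsol x \<alpha> = \<alpha>" using d by simp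
  have "(csol x \<alpha>)\<^sup>2 * d\<^sup>2 = (1 + (hsol x \<alpha>)\<^sup>2) * d\<^sup>2"
  proof -
    have "(csol x \<alpha> * d)\<^sup>2 = d\<^sup>2 + (hsol x \<alpha> * d)\<^sup>2"
      unfolding h c unfolding d_def using r2 by algebra
    then show ?thesis by (simp add: algebra_simps power_mult_distrib)
  qed
  then show sq: "(csol x \<alpha>)\<^sup>2 = 1 + (hsol x \<alpha>)\<^sup>2" using d by simp
  show "0 \<le> hsol x \<alpha>" unfolding hsol_def using al d by (simp add: d_def r_def)
  show "0 < hsol x \<alpha>" if "1 < \<alpha>"
    unfolding hsol_def using that d by (simp add: d_def r_def one_less_power)
  have "0 \<le> csol x \<alpha>" unfolding csol_def using assms d r0 by (simp add: d_def r_def)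
  moreover have "1\<^sup>2 \<le> (csol x \<alpha>)\<^sup>2" unfolding sq by simp
  ultimately show "1 \<le> csol x \<alpha>" using power2_le_imp_le by blast
qed

text \<open>All quadrilaterals with the same \<open>l\<close> share one pair \<open>(c, h)\<close>,
  since the base rate depends on \<open>l\<close> alone and reciprocal side rates fit. It remains to
  pass the top scaling of each row on as bottom scaling of the next, starting from
  \<open>1 + t\<close>; it stays at least 1, as \<open>hsol_csol\<close> requires.\<close>

lemma moving_if_mirrored:
  assumes pm: "pairs_mirrored m n a b"
  shows "\<exists>c h. rate_motion m n a b c h \<and> moving m n h"
proof -
  define al :: "real \<Rightarrow> nat \<Rightarrow> real" where
    "al t = rec_nat (1 + t) (\<lambda>l x. csol (a 0 l) x + hsol (a 0 l) x / a 0 l)" for t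
  have al_0: "al t 0 = 1 + t" and al_Suc: "al t (Suc l) = csol (a 0 l) (al t l) + hsol (a 0 l) (al t l) / a 0 l" for t l
    by (auto simp: al_def)
  have a0: "0 < a 0 l" if "Suc l < n" for l using a that mn by simp
  have al1: "1 \<le> al t l" if "l < n" "0 \<le> t" for t l
    using that(1)
  proof (induction l)
    case (Suc l)
    then have "1 \<le> al t l" "0 < a 0 l" using a0 by auto
    then show ?case using hsol_csol(3,4)[of "a 0 l" "al t l"] unfolding al_Suc
      by (simp add: add_increasing2)
  qed (use that al_0 in simp)
  have ch0: "csol x 1 = 1" "hsol x 1 = 0" if "0 < x" for x using that by (auto simp: csol_def hsol_def)
  have al00: "al 0 l = 1" if "l < n" for l
    using that by (induction l) (use al_0 al_Suc ch0 a0 in auto)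
  have cs: "continuous_on {0..1} (\<lambda>t. csol x (f t))" "continuous_on {0..1} (\<lambda>t. hsol x (f t))"
    if "continuous_on {0..1} f" "0 < x" "\<And>t. 0 \<le> t \<Longrightarrow> 1 \<le> f t" for f x
  proof -
    have "x * f t + sqrt ((f t)\<^sup>2 + x\<^sup>2 - 1) \<noteq> 0" if "t \<in> {0..1}" for t
      using hsol_csol(6)[of x "f t"] \<open>0 < x\<close> \<open>\<And>t. 0 \<le> t \<Longrightarrow> 1 \<le> f t\<close>[of t] that by simp
    then show "continuous_on {0..1} (\<lambda>t. csol x (f t))" "continuous_on {0..1} (\<lambda>t. hsol x (f t))"
      unfolding csol_def hsol_def using that(1) by (auto intro!: continuous_intros)
  qed
  have alc: "continuous_on {0..1} (\<lambda>t. al t l)" if "l < n" for l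
    using that
  proof (induction l)
    case (Suc l)
    then show ?case unfolding al_Suc divide_inverse
      using al1 a0[of l] by (intro continuous_intros cs) auto
  qed (auto simp: al_0 intro!: continuous_intros)
  have a_eq: "a k l = a 0 l" if "Suc k < m" "Suc l < n" for k l
    using that pm unfolding pairs_mirrored_def by (induction k) auto
  define c where "c t k l = csol (a 0 l) (al t l)" for t and k l :: nat
  define h where "h t k l = hsol (a 0 l) (al t l)" for t and k l :: nat
  have "rate_motion m n a b c h"
    unfolding rate_motion_def
  proof (intro conjI allI impI ballI; (elim conjE)?)
    fix k l assume kl: "Suc k < m" "Suc l < n"
    show "continuous_on {0..1} (\<lambda>t. c t k l)" "continuous_on {0..1} (\<lambda>t. h t k l)"
      unfolding c_def h_def using kl alc al1 a0 by (auto intro!: cs)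
    show "c 0 k l = 1" "h 0 k l = 0" using kl al00 ch0 a0 by (auto simp: c_def h_def)
  next
    fix t :: real and k l assume "t \<in> {0..1}" "Suc k < m" "Suc l < n"
    then show "(c t k l)\<^sup>2 = 1 + (h t k l)\<^sup>2"
      unfolding c_def h_def using al1 a0 by (intro hsol_csol) auto
  next
    fix t :: real and k l assume "t \<in> {0..1}" "Suc (Suc k) < m" "Suc l < n"
    then show "c t k l + h t k l / b k l = c t (Suc k) l + b (Suc k) l * h t (Suc k) l"
      using pm by (simp add: pairs_mirrored_def c_def h_def)
  next
    fix t :: real and k l assume t: "t \<in> {0..1}" and kl: "Suc k < m" "Suc (Suc l) < n"
    then have "c t k (Suc l) + a k (Suc l) * h t k (Suc l) = al t (Suc l)"
      unfolding c_def h_def a_eq[OF kl] using al1 a0 by (intro hsol_csol) auto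
    then show "c t k l + h t k l / a k l = c t k (Suc l) + a k (Suc l) * h t k (Suc l)"
      using kl a_eq[of k l] by (simp add: al_Suc c_def h_def)
  qed
  moreover have "0 < h 1 0 0" unfolding h_def using hsol_csol(5)[of "a 0 0" "al 1 0"] a0 mn by (simp add: al_0)
  then have "moving m n h" unfolding moving_def using mn by (intro bexI[of _ 1] exI[of _ 0]) auto
  ultimately show ?thesis by blast
qed

end

lemma moving_iff_rates:
  assumes "rate_grid m n a b"
  shows "(\<exists>c h. rate_motion m n a b c h \<and> moving m n h) \<longleftrightarrow>
    pairs_mirrored m n a b \<or> pairs_mirrored n m (\<lambda>k l. - b l k) (\<lambda>k l. - a l k) \<or> rates_matched m n a b"
    (is "?L \<longleftrightarrow> ?M \<or> ?M' \<or> ?R")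
proof -
  interpret rate_grid m n a b by fact
  interpret sw: rate_grid n m "\<lambda>k l. - b l k" "\<lambda>k l. - a l k"
    using mn a b by unfold_locales auto
  have "?L" if ?M'
  proof -
    obtain c h where "rate_motion n m (\<lambda>k l. - b l k) (\<lambda>k l. - a l k) c h" "moving n m h"
      using sw.moving_if_mirrored[OF \<open>?M'\<close>] by blast
    then show ?thesis using rate_motion_swap moving_swap by force
  qed
  then show ?thesis using moving_if_mirrored moving_if_matched rates_if_moving by blast
qed

subsection \<open>Planes and hedral angles in isotropic space\<close>

definition top_view :: "pt \<Rightarrow> vec2" where "top_view p = (xc p, yc p)"

definition grad :: "real \<times> real \<times> real \<Rightarrow> vec2" where "grad q = (fst q, fst (snd q))"

definition aff :: "real \<times> real \<times> real \<Rightarrow> vec2 \<Rightarrow> real" where "aff q v = grad q \<bullet> v + snd (snd q)"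

lemmas pt_simps = top_view_def grad_def aff_def xc_def yc_def zc_def

lemma inner_vec2: "(u :: vec2) \<bullet> v = fst u * fst v + snd u * snd v"
  by (cases u; cases v) simp

lemma mem_nplane: "p \<in> nplane q \<longleftrightarrow> zc p = aff q (top_view p)"
  by (simp add: nplane_def pt_simps inner_vec2)

lemma pt_eq_iff: "p = p' \<longleftrightarrow> top_view p = top_view p' \<and> zc p = zc p'"
  by (auto simp: pt_simps prod_eq_iff)

lemma coeffs_nplane [simp]: "coeffs (nplane q) = q"
proof -
  have "q' = q" if e: "nplane q' = nplane q" for q'
  proof -
    have 1: "aff q' (x, y) = aff q (x, y)" for x y
    proof -
      have "(x, y, aff q (x, y)) \<in> nplane q'" unfolding e by (simp add: mem_nplane pt_simps)
      then show ?thesis by (simp add: mem_nplane pt_simps)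
    qed
    show ?thesis using 1[of 0 0] 1[of 1 0] 1[of 0 1] by (auto simp: pt_simps prod_eq_iff)
  qed
  then show ?thesis unfolding coeffs_def by (intro the_equality) auto
qed

lemma dual_top_nplane [simp]: "dual_top (nplane q) = grad q"
  by (simp add: dual_top_def grad_def)

lemma iang_nplane: "iang (nplane q) (nplane q') = norm (grad q - grad q')"
  by (simp add: iang_def grad_def norm_prod_def)

lemma affine_nplane: "affine (nplane q)"
  unfolding affine_def
proof (intro ballI allI impI)
  fix x y :: pt and u v :: real assume *: "x \<in> nplane q" "y \<in> nplane q" "u + v = 1"
  then have "zc (u *\<^sub>R x + v *\<^sub>R y) = u * aff q (top_view x) + v * aff q (top_view y)"
    by (simp add: mem_nplane zc_def)
  also have "\<dots> = aff q (top_view (u *\<^sub>R x + v *\<^sub>R y))"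
  proof -
    have v: "v = 1 - u" using *(3) by simp
    show ?thesis unfolding v by (simp add: pt_simps inner_vec2 algebra_simps)
  qed
  finally show "u *\<^sub>R x + v *\<^sub>R y \<in> nplane q" by (simp add: mem_nplane)
qed

lemma vec2_affine_combination:
  assumes "tri X Y Z \<noteq> 0"
  obtains u v w where "u + v + w = 1" "W = u *\<^sub>R X + v *\<^sub>R Y + w *\<^sub>R (Z :: vec2)"
proof
  let ?d = "tri X Y Z"
  show "tri W Y Z / ?d + tri X W Z / ?d + tri X Y W / ?d = 1"
    unfolding add_divide_distrib[symmetric] using assms by (simp add: tri_def det2_def algebra_simps)
  have "?d *\<^sub>R W = tri W Y Z *\<^sub>R X + tri X W Z *\<^sub>R Y + tri X Y W *\<^sub>R Z"
    by (auto simp: tri_def det2_def algebra_simps prod_eq_iff)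
  then have "(1 / ?d) *\<^sub>R (?d *\<^sub>R W) = (1 / ?d) *\<^sub>R (tri W Y Z *\<^sub>R X + tri X W Z *\<^sub>R Y + tri X Y W *\<^sub>R Z)" by simp
  then show "W = (tri W Y Z / ?d) *\<^sub>R X + (tri X W Z / ?d) *\<^sub>R Y + (tri X Y W / ?d) *\<^sub>R Z"
    using assms by (simp add: scaleR_add_right)
qed

text \<open>An affine combination of three non-collinear top views reaches every top view and lifts
  to the same combination of points of the plane.\<close>

lemma affine_hull_nplane:
  assumes "S \<subseteq> nplane q" "A \<in> S" "B \<in> S" "C \<in> S" "tri (top_view A) (top_view B) (top_view C) \<noteq> 0"
  shows "affine hull S = nplane q"
proof
  show "affine hull S \<subseteq> nplane q" by (rule hull_minimal[of S "nplane q" affine, OF assms(1) affine_nplane])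
  show "nplane q \<subseteq> affine hull S"
  proof
    fix p assume p: "p \<in> nplane q"
    obtain u v w where s: "u + v + w = 1"
      and t: "top_view p = u *\<^sub>R top_view A + v *\<^sub>R top_view B + w *\<^sub>R top_view C"
      using vec2_affine_combination[OF assms(5)] by blast
    let ?r = "u *\<^sub>R A + v *\<^sub>R B + w *\<^sub>R C"
    have r: "?r \<in> affine hull {A, B, C}" using s by (auto simp: affine_hull_3)
    also have "\<dots> \<subseteq> affine hull S" using assms(2-4) by (intro hull_mono) auto
    finally have rS: "?r \<in> affine hull S" .
    also have "\<dots> \<subseteq> nplane q" by (rule hull_minimal[of S "nplane q" affine, OF assms(1) affine_nplane])
    finally have "?r \<in> nplane q" .
    moreover have "top_view ?r = top_view p" unfolding t by (simp add: pt_simps)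
    ultimately have "?r = p" using p by (simp add: pt_eq_iff mem_nplane)
    then show "p \<in> affine hull S" using rS by simp
  qed
qed

section \<open>Orientations of edge rays and face normals at a vertex\<close>

definition cross :: "pt \<Rightarrow> pt \<Rightarrow> pt" where
  "cross u v = (yc u * zc v - zc u * yc v, zc u * xc v - xc u * zc v, xc u * yc v - yc u * xc v)"

definition det3 :: "pt \<Rightarrow> pt \<Rightarrow> pt \<Rightarrow> real" where
  "det3 u v w = xc (cross u v) * xc w + yc (cross u v) * yc w + zc (cross u v) * zc w"

lemmas det3_simps = det3_def cross_def xc_def yc_def zc_def

lemma det3_cross: "det3 (cross a b) (cross b c) (cross c d) = det3 a b c * det3 b c d"
  by (simp add: det3_simps algebra_simps)

lemma det3_rotate: "det3 u v w = det3 v w u"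
  by (simp add: det3_simps algebra_simps)

lemma det3_linear: "det3 u v (x + y) = det3 u v x + det3 u v y" "det3 u v (k *\<^sub>R x) = k * det3 u v x"
    "det3 u v (x - y) = det3 u v x - det3 u v y"
  by (auto simp: det3_simps algebra_simps)

lemma det3_same: "det3 u v u = 0" "det3 u v v = 0"
  by (simp_all add: det3_simps algebra_simps)

lemma cross_eq_0_collinear:
  assumes "cross (B - A) (C - A) = 0"
  shows "collinear {A, B, C}"
proof -
  define u w where "u = B - A" "w = C - A"
  have c: "yc u * zc w = zc u * yc w" "zc u * xc w = xc u * zc w" "xc u * yc w = yc u * xc w"
    using assms by (auto simp: cross_def u_w_def zero_prod_def)
  have "u = 0 \<or> (\<exists>k. w = k *\<^sub>R u)"
  proof -
    consider "u = 0" | "xc u \<noteq> 0" | "yc u \<noteq> 0" | "zc u \<noteq> 0" by (auto simp: xc_def yc_def zc_def prod_eq_iff)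
    then show ?thesis
    proof cases
      case 2 then have "w = (xc w / xc u) *\<^sub>R u" using c by (simp add: prod_eq_iff xc_def yc_def zc_def field_simps)
      then show ?thesis by blast
    next
      case 3 then have "w = (yc w / yc u) *\<^sub>R u" using c by (simp add: prod_eq_iff xc_def yc_def zc_def field_simps)
      then show ?thesis by blast
    next
      case 4 then have "w = (zc w / zc u) *\<^sub>R u" using c by (simp add: prod_eq_iff xc_def yc_def zc_def field_simps)
      then show ?thesis by blast
    qed blast
  qed
  then have "collinear {0, u, w}" by (auto simp: collinear_lemma)
  then have "collinear {B, A, C}" unfolding u_w_def using collinear_3[of B A C] by simp
  then show ?thesis by (simp add: insert_commute)
qed

lemma coplanar_in_hull:
  assumes nc: "\<not> collinear {A, B, C}" and d: "det3 (A - V) (B - V) (C - V) = 0"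
  shows "V \<in> affine hull {A, B, C}"
proof -
  define u w v where "u = B - A" "w = C - A" "v = V - A"
  define N where "N = cross u w"
  have "N \<noteq> 0" using nc cross_eq_0_collinear unfolding N_def u_w_v_def by blast
  have e: "xc N * xc v + yc N * yc v + zc N * zc v = 0"
    using d unfolding N_def u_w_v_def by (simp add: det3_simps algebra_simps)
  define k l where "k = cross v w" "l = cross u v"
  have N: "N = (yc u * zc w - zc u * yc w, zc u * xc w - xc u * zc w, xc u * yc w - yc u * xc w)"
    by (simp add: N_def cross_def)
  have kl: "k = (yc v * zc w - zc v * yc w, zc v * xc w - xc v * zc w, xc v * yc w - yc v * xc w)"
    "l = (yc u * zc v - zc u * yc v, zc u * xc v - xc u * zc v, xc u * yc v - yc u * xc v)"
    by (simp_all add: k_l_def cross_def)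
  have E: "xc N *\<^sub>R v = xc k *\<^sub>R u + xc l *\<^sub>R w" "yc N *\<^sub>R v = yc k *\<^sub>R u + yc l *\<^sub>R w" "zc N *\<^sub>R v = zc k *\<^sub>R u + zc l *\<^sub>R w"
    using e unfolding N kl by (simp_all add: prod_eq_iff xc_def yc_def zc_def algebra_simps)
  have "\<exists>x y. v = x *\<^sub>R u + y *\<^sub>R w"
  proof -
    have *: "\<exists>x y. v = x *\<^sub>R u + y *\<^sub>R w" if "s \<noteq> 0" "s *\<^sub>R v = x *\<^sub>R u + y *\<^sub>R w" for s x y
    proof -
      have "v = (1 / s) *\<^sub>R (s *\<^sub>R v)" using that(1) by simp
      also have "\<dots> = (x / s) *\<^sub>R u + (y / s) *\<^sub>R w" unfolding that(2) by (simp add: scaleR_add_right)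
      finally show ?thesis by blast
    qed
    have "xc N \<noteq> 0 \<or> yc N \<noteq> 0 \<or> zc N \<noteq> 0" using \<open>N \<noteq> 0\<close> by (auto simp: xc_def yc_def zc_def prod_eq_iff)
    then show ?thesis using * E by blast
  qed
  then obtain x y where "v = x *\<^sub>R u + y *\<^sub>R w" by blast
  then have "V = (1 - x - y) *\<^sub>R A + x *\<^sub>R B + y *\<^sub>R C"
    unfolding u_w_v_def by (simp add: algebra_simps)
  then show ?thesis unfolding affine_hull_3 by (smt (verit) mem_Collect_eq)
qed

lemma noncollinear_top_view:
  assumes "\<not> collinear {A, B, C}" "A \<in> nplane q" "B \<in> nplane q" "C \<in> nplane q"
  shows "tri (top_view A) (top_view B) (top_view C) \<noteq> 0"
proof
  assume 0: "tri (top_view A) (top_view B) (top_view C) = 0"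
  define x y where "x = B - A" "y = C - A"
  have z: "zc x = grad q \<bullet> top_view x" "zc y = grad q \<bullet> top_view y"
    using assms(2-4) unfolding mem_nplane x_y_def by (auto simp: pt_simps algebra_simps inner_vec2)
  have d: "xc x * yc y = yc x * xc y"
    using 0 by (simp add: x_y_def tri_def det2_def top_view_def xc_def yc_def)
  have "cross x y = 0"
    unfolding cross_def z zero_prod_def using d by (simp add: top_view_def inner_vec2) algebra
  then show False using assms(1) cross_eq_0_collinear unfolding x_y_def by blast
qed

text \<open>The diagonals cross, so a positive combination of \<open>a\<close> and \<open>c\<close>
  equals one of \<open>b\<close> and \<open>d\<close>. Pairing this relation with two rays at a time
  shows that the four determinants have one sign; none vanishes, because the apex is off the
  plane.\<close>

lemma convex_quad_det3:
  assumes cq: "convex_quad A B C D" and V: "V \<notin> affine hull {A, B, C, D}"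
  obtains \<epsilon> where "0 < \<epsilon> * det3 (A - V) (B - V) (C - V)" "0 < \<epsilon> * det3 (B - V) (C - V) (D - V)"
    "0 < \<epsilon> * det3 (C - V) (D - V) (A - V)" "0 < \<epsilon> * det3 (D - V) (A - V) (B - V)"
proof -
  define a b c d where abcd: "a = A - V" "b = B - V" "c = C - V" "d = D - V"
  let ?E1 = "det3 a b c" and ?E2 = "det3 b c d" and ?E3 = "det3 c d a" and ?E4 = "det3 d a b"
  obtain X where X: "X \<in> open_segment A C" "X \<in> open_segment B D" using cq by (auto simp: convex_quad_def)
  obtain l where l: "0 < l" "l < 1" "X = (1 - l) *\<^sub>R A + l *\<^sub>R C" using X(1) unfolding in_segment by blast
  obtain k where k: "0 < k" "k < 1" "X = (1 - k) *\<^sub>R B + k *\<^sub>R D" using X(2) unfolding in_segment by blast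
  have e: "(1 - l) *\<^sub>R a + l *\<^sub>R c = (1 - k) *\<^sub>R b + k *\<^sub>R d"
    using l(3) k(3) unfolding abcd by (simp add: algebra_simps)
  have 1: "(1 - l) * ?E1 = k * ?E2"
    using arg_cong[OF e, of "det3 b c"] by (simp add: det3_linear det3_same det3_rotate[of a b])
  have 2: "l * ?E3 = (1 - k) * ?E4"
    using arg_cong[OF e, of "det3 d a"] by (simp add: det3_linear det3_same det3_rotate[of c d])
  have 3: "(1 - l) * ?E3 = (1 - k) * ?E2"
    using arg_cong[OF e, of "det3 c d"] by (simp add: det3_linear det3_same det3_rotate[of b c])
  have "V \<notin> affine hull {A, B, C}" using V hull_mono[of "{A, B, C}" "{A, B, C, D}" affine] by auto
  then have E1: "?E1 \<noteq> 0" using coplanar_in_hull cq unfolding abcd convex_quad_def by blast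
  have s2: "0 < ?E1 * ?E2"
  proof -
    have "k * (?E1 * ?E2) = (1 - l) * ?E1\<^sup>2" using 1 by algebra
    then have "0 < k * (?E1 * ?E2)" using l E1 by simp
    then show ?thesis using k by (simp add: zero_less_mult_iff)
  qed
  have s3: "0 < ?E1 * ?E3"
  proof -
    have "(1 - l) * (?E1 * ?E3) = (1 - k) * (?E1 * ?E2)" using 3 by algebra
    moreover have "0 < (1 - k) * (?E1 * ?E2)" using s2 k by simp
    ultimately have "0 < (1 - l) * (?E1 * ?E3)" by linarith
    then show ?thesis using l by (simp add: zero_less_mult_iff)
  qed
  have s4: "0 < ?E1 * ?E4"
  proof -
    have "(1 - k) * (?E1 * ?E4) = l * (?E1 * ?E3)" using 2 by algebra
    moreover have "0 < l * (?E1 * ?E3)" using s3 l by simp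
    ultimately have "0 < (1 - k) * (?E1 * ?E4)" by linarith
    then show ?thesis using k by (simp add: zero_less_mult_iff)
  qed
  have "0 < ?E1 * ?E1" using E1 not_real_square_gt_zero by blast
  then show ?thesis using that[of ?E1] s2 s3 s4 unfolding abcd by blast
qed

lemma hedralE:
  assumes "p \<in> hedral V A B C D"
  obtains t q where "t \<ge> 0" "q \<in> convex hull {A, B, C, D}" "p = V + t *\<^sub>R (q - V)"
proof -
  have "\<exists>t q. p = V + t *\<^sub>R (q - V) \<and> t \<ge> 0 \<and> q \<in> convex hull {A, B, C, D}"
    using assms by (simp add: hedral_def del: split_paired_Ex)
  then show ?thesis using that by metis
qed

text \<open>Each side plane of the hedral angle is supporting, so the interior vertical vector lies
  strictly on the inner side.\<close>

lemma hedral_side: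
  assumes int: "V + (0, 0, s) \<in> interior (hedral V A B C D)"
    and d: "0 < \<epsilon> * det3 (A - V) (B - V) (C - V)" "0 < \<epsilon> * det3 (A - V) (B - V) (D - V)"
  shows "0 < \<epsilon> * s * zc (cross (A - V) (B - V))"
proof -
  let ?a = "A - V" and ?b = "B - V" and ?c = "C - V"
  have nn: "0 \<le> \<epsilon> * det3 ?a ?b (p - V)" if p: "p \<in> hedral V A B C D" for p
  proof -
    obtain t q where t: "t \<ge> 0" "q \<in> convex hull {A, B, C, D}" and pq: "p = V + t *\<^sub>R (q - V)"
      using p by (rule hedralE)
    let ?H = "{x. 0 \<le> \<epsilon> * det3 ?a ?b (x - V)}"
    have "convex ?H"
    proof (rule convexI)
      fix x y :: pt and u v :: real
      assume xy: "x \<in> ?H" "y \<in> ?H" and uv: "0 \<le> u" "0 \<le> v" "u + v = 1"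
      have "u *\<^sub>R (x - V) + v *\<^sub>R (y - V) = u *\<^sub>R x + v *\<^sub>R y - (u + v) *\<^sub>R V" by (simp add: algebra_simps)
      then have E: "u *\<^sub>R x + v *\<^sub>R y - V = u *\<^sub>R (x - V) + v *\<^sub>R (y - V)" using uv(3) by simp
      have "\<epsilon> * det3 ?a ?b (u *\<^sub>R x + v *\<^sub>R y - V) = u * (\<epsilon> * det3 ?a ?b (x - V)) + v * (\<epsilon> * det3 ?a ?b (y - V))"
        unfolding E det3_linear(1,2) by (simp add: distrib_left mult.left_commute)
      then show "u *\<^sub>R x + v *\<^sub>R y \<in> ?H" using xy uv by simp
    qed
    moreover have "{A, B, C, D} \<subseteq> ?H"
      using d by (simp add: det3_same)
    ultimately have "q \<in> ?H" using t(2) hull_minimal[of "{A, B, C, D}" ?H convex] by blast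
    then have "0 \<le> t * (\<epsilon> * det3 ?a ?b (q - V))" using t(1) by simp
    then show ?thesis by (simp add: pq det3_linear(2) mult.left_commute)
  qed
  obtain e where e: "0 < e" "ball (V + (0, 0, s)) e \<subseteq> hedral V A B C D"
    using int by (auto simp: mem_interior)
  \<comment> \<open>Chosen so that a step of \<open>k\<close> against the direction of
    \<open>C\<close> stays in the ball. Nonnegativity at the displaced point then gains the positive
    amount \<open>k * (\<epsilon> * det3 ?a ?b ?c)\<close>, hence the strict inequality.\<close>
  define k where "k = e / 2 / (norm ?c + 1)"
  have k: "0 < k" using e by (simp add: k_def add_nonneg_pos)
  have "norm (k *\<^sub>R ?c) < e"
  proof -
    have n: "norm ?c + 1 \<noteq> 0" using norm_ge_zero[of ?c] by linarith
    have "norm (k *\<^sub>R ?c) \<le> k * (norm ?c + 1)" using k by (simp add: distrib_left)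
    also have "\<dots> = e / 2"
    proof -
      have "e / 2 / N * N = e / 2" if "N \<noteq> 0" for N :: real using that by simp
      then show ?thesis unfolding k_def using n .
    qed
    finally show ?thesis using e by simp
  qed
  then have "V + ((0, 0, s) - k *\<^sub>R ?c) \<in> ball (V + (0, 0, s)) e" by (simp add: dist_norm del: scaleR_Pair)
  then have "V + ((0, 0, s) - k *\<^sub>R ?c) \<in> hedral V A B C D" using e(2) by blast
  from nn[OF this] have "0 \<le> \<epsilon> * det3 ?a ?b ((0, 0, s) - k *\<^sub>R ?c)" by (simp only: add_diff_cancel_left')
  then have "k * (\<epsilon> * det3 ?a ?b ?c) \<le> \<epsilon> * det3 ?a ?b (0, 0, s)"
    unfolding det3_linear(2,3) by (simp add: right_diff_distrib mult.left_commute)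
  moreover have "0 < k * (\<epsilon> * det3 ?a ?b ?c)" using k d(1) by simp
  moreover have "det3 ?a ?b (0, 0, s) = s * zc (cross ?a ?b)" by (simp add: det3_def xc_def yc_def zc_def)
  ultimately show ?thesis by (simp add: mult.assoc)
qed

definition plane_of :: "pt \<Rightarrow> pt \<Rightarrow> real \<times> real \<times> real" where
  "plane_of V N = (- xc N / zc N, - yc N / zc N, zc V + (xc N / zc N) * xc V + (yc N / zc N) * yc V)"

lemma hull_plane_of:
  assumes "zc (cross (A - V) (B - V)) \<noteq> 0"
  shows "affine hull {V, A, B} = nplane (plane_of V (cross (A - V) (B - V)))"
proof (rule affine_hull_nplane[where A = V and B = A and C = B])
  let ?N = "cross (A - V) (B - V)"
  have *: "p \<in> nplane (plane_of V ?N) \<longleftrightarrow> zc p * zc ?N = zc V * zc ?N - xc ?N * (xc p - xc V) - yc ?N * (yc p - yc V)" for p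
  proof -
    have "aff (plane_of V ?N) (top_view p) * zc ?N = zc V * zc ?N - xc ?N * (xc p - xc V) - yc ?N * (yc p - yc V)"
      using assms by (simp add: plane_of_def aff_def grad_def inner_vec2 top_view_def algebra_simps)
    then show ?thesis unfolding mem_nplane using assms by (metis mult_right_cancel)
  qed
  show "{V, A, B} \<subseteq> nplane (plane_of V ?N)"
    unfolding insert_subset * by (simp add: cross_def xc_def yc_def zc_def algebra_simps)
  show "tri (top_view V) (top_view A) (top_view B) \<noteq> 0"
    using assms by (simp add: tri_def det2_def top_view_def cross_def xc_def yc_def zc_def)
qed auto

text \<open>Dividing a normal by its last coordinate moves it to height 1, where \<open>det3\<close>
  of three vectors is the planar determinant \<open>tri\<close>; the gradient is the negative of its
  top view, and a point reflection preserves orientation in the plane.\<close>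

lemma tri_plane_of:
  assumes "zc N1 \<noteq> 0" "zc N2 \<noteq> 0" "zc N3 \<noteq> 0"
  shows "tri (grad (plane_of V N1)) (grad (plane_of V N2)) (grad (plane_of V N3)) =
    det3 N1 N2 N3 / (zc N1 * zc N2 * zc N3)"
proof -
  define x1 y1 x2 y2 x3 y3 where xy: "x1 = xc N1 / zc N1" "y1 = yc N1 / zc N1"
    "x2 = xc N2 / zc N2" "y2 = yc N2 / zc N2" "x3 = xc N3 / zc N3" "y3 = yc N3 / zc N3"
  have c: "xc N1 = x1 * zc N1" "yc N1 = y1 * zc N1" "xc N2 = x2 * zc N2" "yc N2 = y2 * zc N2"
     "xc N3 = x3 * zc N3" "yc N3 = y3 * zc N3" using assms by (auto simp: xy)
  have g: "grad (plane_of V N1) = (- x1, - y1)" "grad (plane_of V N2) = (- x2, - y2)" "grad (plane_of V N3) = (- x3, - y3)"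
    by (auto simp: xy grad_def plane_of_def)
  have "det3 N1 N2 N3 = (yc N1 * zc N2 - zc N1 * yc N2) * xc N3 + (zc N1 * xc N2 - xc N1 * zc N2) * yc N3 +
     (xc N1 * yc N2 - yc N1 * xc N2) * zc N3" by (simp add: det3_simps)
  also have "\<dots> = tri (- x1, - y1) (- x2, - y2) (- x3, - y3) * (zc N1 * zc N2 * zc N3)"
    unfolding c by (simp add: tri_def det2_def algebra_simps)
  finally show ?thesis using assms unfolding g by simp
qed

text \<open>By admissibility the last coordinates of the four normals have the common sign of
  \<open>\<epsilon> * s\<close>. So all side planes are graphs, and \<open>det3_cross\<close> with
  \<open>tri_plane_of\<close> gives one orientation to all four gradient triples.\<close>

lemma admissible_planes:
  assumes cq: "convex_quad A B C D" and V: "V \<notin> affine hull {A, B, C, D}" and ad: "admissible V A B C D"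
  obtains q1 q2 q3 q4 where "affine hull {V, A, B} = nplane q1" "affine hull {V, B, C} = nplane q2"
    "affine hull {V, C, D} = nplane q3" "affine hull {V, D, A} = nplane q4"
    "convex4 (grad q1) (grad q2) (grad q3) (grad q4)"
proof -
  obtain \<epsilon> where E: "0 < \<epsilon> * det3 (A - V) (B - V) (C - V)" "0 < \<epsilon> * det3 (B - V) (C - V) (D - V)"
    "0 < \<epsilon> * det3 (C - V) (D - V) (A - V)" "0 < \<epsilon> * det3 (D - V) (A - V) (B - V)"
    using convex_quad_det3[OF cq V] by blast
  obtain s where s: "V + (0, 0, s) \<in> interior (hedral V A B C D)" using ad by (auto simp: admissible_def)
  have rot: "hedral V A B C D = hedral V B C D A" "hedral V A B C D = hedral V C D A B" "hedral V A B C D = hedral V D A B C"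
    by (simp_all add: hedral_def insert_commute)
  let ?N1 = "cross (A - V) (B - V)" and ?N2 = "cross (B - V) (C - V)" and ?N3 = "cross (C - V) (D - V)" and ?N4 = "cross (D - V) (A - V)"
  have n1: "0 < \<epsilon> * s * zc ?N1" by (rule hedral_side[OF s]) (use E det3_rotate in metis)+
  have n2: "0 < \<epsilon> * s * zc ?N2" by (rule hedral_side[OF s[unfolded rot(1)]]) (use E det3_rotate in metis)+
  have n3: "0 < \<epsilon> * s * zc ?N3" by (rule hedral_side[OF s[unfolded rot(2)]]) (use E det3_rotate in metis)+
  have n4: "0 < \<epsilon> * s * zc ?N4" by (rule hedral_side[OF s[unfolded rot(3)]]) (use E det3_rotate in metis)+
  have nz: "zc ?N1 \<noteq> 0" "zc ?N2 \<noteq> 0" "zc ?N3 \<noteq> 0" "zc ?N4 \<noteq> 0" using n1 n2 n3 n4 by auto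
  define \<kappa> where "\<kappa> = \<epsilon> * s"
  have t: "0 < \<kappa> * tri (grad (plane_of V N1)) (grad (plane_of V N2)) (grad (plane_of V N3))"
    if "0 < \<kappa> * zc N1" "0 < \<kappa> * zc N2" "0 < \<kappa> * zc N3" "det3 N1 N2 N3 = x * y" "0 < \<epsilon> * x" "0 < \<epsilon> * y" for N1 N2 N3 x y
  proof -
    have "0 < (\<epsilon> * x) * (\<epsilon> * y)" using that by simp
    then have "0 < \<epsilon>\<^sup>2 * (x * y)" by (simp add: power2_eq_square mult_ac)
    then have xy: "0 < x * y" using zero_le_power2[of \<epsilon>] by (simp add: zero_less_mult_iff)
    have "0 < (\<kappa> * zc N1) * ((\<kappa> * zc N2) * (\<kappa> * zc N3))" using that by simp
    also have "\<dots> = \<kappa>\<^sup>2 * (\<kappa> * (zc N1 * zc N2 * zc N3))" by (simp add: power2_eq_square algebra_simps)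
    finally have "0 < \<kappa> * (zc N1 * zc N2 * zc N3)" by (simp add: zero_less_mult_iff)
    moreover have "zc N1 \<noteq> 0" "zc N2 \<noteq> 0" "zc N3 \<noteq> 0" using that by auto
    ultimately have "0 < (\<kappa> * (zc N1 * zc N2 * zc N3)) * (x * y) / (zc N1 * zc N2 * zc N3)\<^sup>2"
      using xy by simp
    also have "\<dots> = \<kappa> * (x * y / (zc N1 * zc N2 * zc N3))" by (simp add: power2_eq_square)
    finally show ?thesis using that(1-3) by (subst tri_plane_of) (auto simp: that(4))
  qed
  have "0 < \<kappa> * tri (grad (plane_of V ?N1)) (grad (plane_of V ?N2)) (grad (plane_of V ?N3))"
     "0 < \<kappa> * tri (grad (plane_of V ?N2)) (grad (plane_of V ?N3)) (grad (plane_of V ?N4))"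
     "0 < \<kappa> * tri (grad (plane_of V ?N3)) (grad (plane_of V ?N4)) (grad (plane_of V ?N1))"
     "0 < \<kappa> * tri (grad (plane_of V ?N4)) (grad (plane_of V ?N1)) (grad (plane_of V ?N2))"
    using t[OF _ _ _ det3_cross] n1 n2 n3 n4 E unfolding \<kappa>_def by blast+
  then have "convex4 (grad (plane_of V ?N1)) (grad (plane_of V ?N2)) (grad (plane_of V ?N3)) (grad (plane_of V ?N4))"
    unfolding convex4_def by (auto simp: zero_less_mult_iff)
  then show ?thesis using that hull_plane_of nz by blast
qed

subsection \<open>Deformations of the net and of its dual grid\<close>

definition turn :: "real \<Rightarrow> real \<Rightarrow> vec2 \<Rightarrow> vec2" where
  "turn x y v = (x * fst v - y * snd v, y * fst v + x * snd v)"

text \<open>Isotropic congruences with cosine and sine as free parameters \<open>x\<close> and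
  \<open>y\<close>, which keeps computations polynomial; the linear height term refers to the top
  view before the rotation.\<close>

definition move :: "real \<Rightarrow> real \<Rightarrow> vec2 \<Rightarrow> vec2 \<Rightarrow> real \<Rightarrow> pt \<Rightarrow> pt" where
  "move x y w c d p = (let v = turn x y (top_view p) + w in (fst v, snd v, zc p + c \<bullet> top_view p + d))"

lemma top_view_move [simp]: "top_view (move x y w c d p) = turn x y (top_view p) + w"
  and zc_move [simp]: "zc (move x y w c d p) = zc p + c \<bullet> top_view p + d"
  by (simp_all add: move_def Let_def top_view_def xc_def yc_def zc_def prod_eq_iff)

lemma iso_cong_iff_move: "iso_cong C \<longleftrightarrow> (\<exists>x y w c d. x\<^sup>2 + y\<^sup>2 = 1 \<and> C = move x y w c d)"
proof
  assume "iso_cong C"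
  then obtain \<phi> c1 c2 b1 b2 b3 where C: "\<And>x y z. C (x, y, z) = (cos \<phi> * x - sin \<phi> * y + b1, sin \<phi> * x + cos \<phi> * y + b2,
                     c1 * x + c2 * y + z + b3)" unfolding iso_cong_def by blast
  have "C = move (cos \<phi>) (sin \<phi>) (b1, b2) (c1, c2) b3"
  proof
    fix p show "C p = move (cos \<phi>) (sin \<phi>) (b1, b2) (c1, c2) b3 p"
      by (cases p) (simp add: C move_def turn_def top_view_def xc_def yc_def zc_def inner_vec2)
  qed
  then show "\<exists>x y w c d. x\<^sup>2 + y\<^sup>2 = 1 \<and> C = move x y w c d" using sin_cos_squared_add2 by blast
next
  assume "\<exists>x y w c d. x\<^sup>2 + y\<^sup>2 = 1 \<and> C = move x y w c d"
  then obtain x y w c d where xy: "x\<^sup>2 + y\<^sup>2 = 1" and C: "C = move x y w c d" by blast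
  obtain \<phi> where "x = cos \<phi>" "y = sin \<phi>" using sincos_total_2pi[OF xy] by metis
  then show "iso_cong C"
    unfolding iso_cong_def C
    by (intro exI[of _ \<phi>] exI[of _ "fst c"] exI[of _ "snd c"] exI[of _ "fst w"] exI[of _ "snd w"] exI[of _ d])
      (simp add: move_def turn_def top_view_def xc_def yc_def zc_def inner_vec2)
qed

lemma turn_linear: "turn x y (u + v) = turn x y u + turn x y v" "turn x y (u - v) = turn x y u - turn x y v"
  by (simp_all add: turn_def algebra_simps)

lemma turn_one [simp]: "turn 1 0 v = v"
  by (simp add: turn_def)

lemma det2_turn: "x\<^sup>2 + y\<^sup>2 = 1 \<Longrightarrow> det2 (turn x y u) (turn x y v) = det2 u v"
proof -
  assume "x\<^sup>2 + y\<^sup>2 = 1"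
  moreover have "det2 (turn x y u) (turn x y v) = (x\<^sup>2 + y\<^sup>2) * det2 u v"
    by (simp add: det2_def turn_def power2_eq_square algebra_simps)
  ultimately show ?thesis by simp
qed

lemma inner_turn: "x\<^sup>2 + y\<^sup>2 = 1 \<Longrightarrow> turn x y u \<bullet> turn x y v = u \<bullet> v"
proof -
  assume "x\<^sup>2 + y\<^sup>2 = 1"
  moreover have "turn x y u \<bullet> turn x y v = (x\<^sup>2 + y\<^sup>2) * (u \<bullet> v)"
    by (simp add: inner_vec2 turn_def power2_eq_square algebra_simps)
  ultimately show ?thesis by simp
qed

lemma tri_turn: "x\<^sup>2 + y\<^sup>2 = 1 \<Longrightarrow> tri (turn x y A + w) (turn x y B + w) (turn x y C + w) = tri A B C"
  by (simp add: tri_def det2_turn flip: turn_linear)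

lemma turn_unique:
  assumes "turn x y v = turn x' y' v" "v \<noteq> 0"
  shows "x = x' \<and> y = y'"
proof -
  have e: "(x - x') * fst v = (y - y') * snd v" "(y - y') * fst v = - (x - x') * snd v"
    using assms(1) by (auto simp: turn_def algebra_simps)
  have n: "fst v * fst v + snd v * snd v \<noteq> 0"
    using assms(2) by (simp add: sum_squares_eq_zero_iff prod_eq_iff)
  have "(x - x') * (fst v * fst v + snd v * snd v) = 0" "(y - y') * (fst v * fst v + snd v * snd v) = 0"
    using e by algebra+
  then show ?thesis using n by auto
qed

lemma move_nplane:
  assumes "x\<^sup>2 + y\<^sup>2 = 1"
  shows "\<exists>q'. grad q' = turn x y (grad q + c) \<and> (\<forall>p\<in>nplane q. move x y w c d p \<in> nplane q')"
proof -
  let ?g = "turn x y (grad q + c)"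
  let ?q = "(fst ?g, snd ?g, snd (snd q) + d - ?g \<bullet> w)"
  have g: "grad ?q = ?g" by (simp add: grad_def)
  have "move x y w c d p \<in> nplane ?q" if "p \<in> nplane q" for p
    using that assms unfolding mem_nplane aff_def g
    by (simp add: inner_turn inner_add_right inner_add_left)
  then show ?thesis using g by blast
qed

lemma perp_parallel:
  fixes u w e :: vec2
  assumes "e \<noteq> 0" "u \<noteq> 0" "u \<bullet> e = 0" "w \<bullet> e = 0"
  shows "\<exists>k. w = k *\<^sub>R u"
proof -
  have "det2 u w = 0"
  proof -
    have "det2 u w * fst e = 0" "det2 u w * snd e = 0"
      using assms(3,4) unfolding det2_def inner_vec2 by algebra+
    then show ?thesis using assms(1) by (auto simp: prod_eq_iff)
  qed
  then have d: "fst u * snd w = snd u * fst w" by (simp add: det2_def)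
  have "w = (fst w / fst u) *\<^sub>R u \<or> w = (snd w / snd u) *\<^sub>R u"
    using assms(2) d by (cases "fst u = 0") (auto simp: prod_eq_iff field_simps)
  then show ?thesis by blast
qed

lemma perp_basis:
  fixes c u v :: vec2
  assumes "c \<bullet> u = 0" "c \<bullet> v = 0" "det2 u v \<noteq> 0"
  shows "c = 0"
proof -
  have "det2 u v * fst c = 0" "det2 u v * snd c = 0"
    using assms(1,2) unfolding det2_def inner_vec2 by algebra+
  then show ?thesis using assms(3) by (simp add: prod_eq_iff)
qed

lemma collinear_3_iff: "collinear {A, B, C} \<longleftrightarrow> B - A = 0 \<or> C - A = 0 \<or> (\<exists>k. C - A = k *\<^sub>R (B - A))"
proof -
  have "collinear {A, B, C} \<longleftrightarrow> collinear {0, B - A, C - A}"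
    using collinear_3[of B A C] by (simp add: insert_commute)
  then show ?thesis by (simp add: collinear_lemma)
qed

lemma convex_quad_shear:
  assumes "convex_quad A B C D"
  shows "convex_quad (move 1 0 0 c d A) (move 1 0 0 c d B) (move 1 0 0 c d C) (move 1 0 0 c d D)"
proof -
  define L where "L p = (xc p, yc p, zc p + c \<bullet> top_view p)" for p
  have lin: "linear L"
    by (rule linearI) (auto simp: L_def xc_def yc_def zc_def top_view_def inner_vec2 algebra_simps)
  have inj: "inj L"
    by (rule injI) (auto simp: L_def xc_def yc_def zc_def top_view_def prod_eq_iff inner_vec2)
  define b where "b = ((0, 0, d) :: pt)"
  have M: "move 1 0 0 c d p = b + L p" for p
    by (simp add: move_def b_def L_def xc_def yc_def zc_def top_view_def)
  have col: "collinear {b + L p, b + L q, b + L r} \<longleftrightarrow> collinear {p, q, r}" for p q r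
  proof -
    have "b + L q - (b + L p) = L (q - p)" "b + L r - (b + L p) = L (r - p)"
      using linear_diff[OF lin] by simp_all
    moreover have "L u = 0 \<longleftrightarrow> u = 0" for u using injD[OF inj, of u 0] linear_0[OF lin] by auto
    moreover have "L v = k *\<^sub>R L u \<longleftrightarrow> v = k *\<^sub>R u" for u v k
      using injD[OF inj, of v "k *\<^sub>R u"] linear_scale[OF lin, of k u] by auto
    ultimately show ?thesis unfolding collinear_3_iff by metis
  qed
  have seg: "open_segment (b + L p) (b + L q) = (\<lambda>x. b + L x) ` open_segment p q" for p q
    using open_segment_translation[of b "L p" "L q"] open_segment_linear_image[OF lin inj, of p q] by (simp add: image_image)
  show ?thesis
    using assms unfolding convex_quad_def M col seg by auto
qed

text \<open>Here \<open>f\<close> and \<open>z\<close> are the top views and heights of the vertices, \<open>q\<close> the coefficients of the face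
  planes. Convexity of the faces is left out to make the locale invariant under transposition, which
  reduces the second half of condition (i) to the first.\<close>

locale dual_grid =
  fixes m n :: nat and q :: "nat \<Rightarrow> nat \<Rightarrow> real \<times> real \<times> real" and f :: "nat \<Rightarrow> nat \<Rightarrow> vec2"
    and z :: "nat \<Rightarrow> nat \<Rightarrow> real"
  assumes mn: "2 \<le> m" "2 \<le> n"
    and cv: "\<And>k l. Suc k < m \<Longrightarrow> Suc l < n \<Longrightarrow>
      convex4 (grad (q k l)) (grad (q (Suc k) l)) (grad (q (Suc k) (Suc l))) (grad (q k (Suc l)))"
    and on: "\<And>k l. k < m \<Longrightarrow> l < n \<Longrightarrow> aff (q k l) (f k l) = z k l"
      "\<And>k l. k < m \<Longrightarrow> l < n \<Longrightarrow> aff (q k l) (f (Suc k) l) = z (Suc k) l"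
      "\<And>k l. k < m \<Longrightarrow> l < n \<Longrightarrow> aff (q k l) (f (Suc k) (Suc l)) = z (Suc k) (Suc l)"
      "\<And>k l. k < m \<Longrightarrow> l < n \<Longrightarrow> aff (q k l) (f k (Suc l)) = z k (Suc l)"
    and nondeg: "\<And>k l. k < m \<Longrightarrow> l < n \<Longrightarrow> tri (f k l) (f (Suc k) l) (f k (Suc l)) \<noteq> 0"
      "\<And>k l. k < m \<Longrightarrow> l < n \<Longrightarrow> tri (f (Suc k) (Suc l)) (f (Suc k) l) (f k (Suc l)) \<noteq> 0"
begin

definition P where "P k l = grad (q k l)"

sublocale cg: convex_grid m n P
  by unfold_locales (use mn cv in \<open>auto simp: P_def\<close>)

lemma edge_top:
  assumes "k < m" "l < n"
  shows "f (Suc k) l \<noteq> f k l" "f k (Suc l) \<noteq> f k l" "f (Suc k) (Suc l) \<noteq> f (Suc k) l" "f (Suc k) (Suc l) \<noteq> f k (Suc l)"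
  using nondeg[OF assms] by (auto simp: tri_def det2_def)

text \<open>Both planes pass through the two ends of the common edge, so the difference of their
  gradients annihilates its top view.\<close>

lemma perp_k:
  assumes "Suc k < m" "l < n"
  shows "(P (Suc k) l - P k l) \<bullet> (f (Suc k) (Suc l) - f (Suc k) l) = 0"
proof -
  have "aff (q (Suc k) l) (f (Suc k) l) = aff (q k l) (f (Suc k) l)"
    "aff (q (Suc k) l) (f (Suc k) (Suc l)) = aff (q k l) (f (Suc k) (Suc l))"
    using on assms by auto
  then show ?thesis by (simp add: aff_def P_def inner_diff_left inner_diff_right)
qed

lemma perp_l:
  assumes "k < m" "Suc l < n"
  shows "(P k (Suc l) - P k l) \<bullet> (f (Suc k) (Suc l) - f k (Suc l)) = 0"
proof -
  have "aff (q k (Suc l)) (f k (Suc l)) = aff (q k l) (f k (Suc l))"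
    "aff (q k (Suc l)) (f (Suc k) (Suc l)) = aff (q k l) (f (Suc k) (Suc l))"
    using on assms by auto
  then show ?thesis by (simp add: aff_def P_def inner_diff_left inner_diff_right)
qed

end

locale dual_net = dual_grid m n q "\<lambda>i j. top_view (F i j)" "\<lambda>i j. zc (F i j)"
  for m n :: nat and F :: "nat \<Rightarrow> nat \<Rightarrow> pt" and q +
  assumes net: "is_net m n F"
    and fp: "\<And>k l. k < m \<Longrightarrow> l < n \<Longrightarrow> face_plane F k l = nplane (q k l)"
begin

abbreviation "f i j \<equiv> top_view (F i j)"

lemma curv_P:
  assumes "Suc k < m" "Suc l < n"
  shows "curv F (Suc k) (Suc l) = area4 (P k l) (P (Suc k) l) (P (Suc k) (Suc l)) (P k (Suc l)) / 2"
  using assms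
  by (simp add: curv_def Let_def fp area4_def tri_def P_def det2_def algebra_simps)

lemma face_on:
  assumes "k < m" "l < n"
  shows "{F k l, F (Suc k) l, F (Suc k) (Suc l), F k (Suc l)} \<subseteq> nplane (q k l)"
  using on assms by (auto simp: mem_nplane)

lemma face_moved:
  assumes kl: "k < m" "l < n" and xy: "x\<^sup>2 + y\<^sup>2 = 1"
    and G: "move x y w c d (F k l) = G k l" "move x y w c d (F (Suc k) l) = G (Suc k) l"
      "move x y w c d (F (Suc k) (Suc l)) = G (Suc k) (Suc l)" "move x y w c d (F k (Suc l)) = G k (Suc l)"
  shows "dual_top (face_plane G k l) = turn x y (P k l + c)"
proof -
  obtain q' where q': "grad q' = turn x y (grad (q k l) + c)" "\<And>p. p \<in> nplane (q k l) \<Longrightarrow> move x y w c d p \<in> nplane q'"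
    using move_nplane[OF xy] by blast
  have "{G k l, G (Suc k) l, G (Suc k) (Suc l), G k (Suc l)} \<subseteq> nplane q'"
    using face_on[OF kl] q'(2) unfolding G[symmetric] by auto
  moreover have "tri (top_view (G k l)) (top_view (G (Suc k) l)) (top_view (G k (Suc l))) \<noteq> 0"
    unfolding G[symmetric] top_view_move tri_turn[OF xy] using nondeg(1)[OF kl] .
  ultimately have "face_plane G k l = nplane q'"
    unfolding face_plane_def by (intro affine_hull_nplane) auto
  then show ?thesis using q'(1) by (simp add: P_def)
qed

lemma area4_turn:
  assumes "x\<^sup>2 + y\<^sup>2 = 1"
  shows "area4 (turn x y A) (turn x y B) (turn x y C) (turn x y D) = area4 A B C D"
  using tri_turn[OF assms, of _ 0] by (simp add: area4_def)

text \<open>Each face is sheared by the affine function with gradient \<open>c\<close>, the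
  displacement of its own gradient. Neighbouring shears agree on the common edge: along it because
  \<open>c\<close> changes perpendicularly to the edge, and at one end through the choice of the
  constants \<open>d\<close>.\<close>

lemma flexible_if_combescure:
  assumes cb: "combescure m n P D" and ns: "\<not> shifted m n P D"
  shows "flexible m n F"
proof -
  define c where "c t k l = D t k l - P k l" for t k l
  define d where "d t k l = (\<Sum>i<k. (c t i 0 - c t (Suc i) 0) \<bullet> f (Suc i) 0) + (\<Sum>j<l. (c t k j - c t k (Suc j)) \<bullet> f k (Suc j))" for t k l
  define \<delta> where "\<delta> t k l v = c t k l \<bullet> v + d t k l" for t k l v
  have pk: "(c t (Suc k) l - c t k l) \<bullet> (f (Suc k) (Suc l) - f (Suc k) l) = 0"
    if t: "t \<in> {0..1}" and kl: "Suc k < m" "l < n" for t k l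
  proof -
    obtain \<alpha> where "D t (Suc k) l - D t k l = \<alpha> *\<^sub>R (P (Suc k) l - P k l)"
      using cb t kl unfolding combescure_def by blast
    then have "c t (Suc k) l - c t k l = (\<alpha> - 1) *\<^sub>R (P (Suc k) l - P k l)" by (simp add: c_def algebra_simps)
    then show ?thesis using perp_k[OF kl] by simp
  qed
  have pl: "(c t k (Suc l) - c t k l) \<bullet> (f (Suc k) (Suc l) - f k (Suc l)) = 0"
    if t: "t \<in> {0..1}" and kl: "k < m" "Suc l < n" for t k l
  proof -
    obtain \<alpha> where "D t k (Suc l) - D t k l = \<alpha> *\<^sub>R (P k (Suc l) - P k l)"
      using cb t kl unfolding combescure_def by blast
    then have "c t k (Suc l) - c t k l = (\<alpha> - 1) *\<^sub>R (P k (Suc l) - P k l)" by (simp add: c_def algebra_simps)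
    then show ?thesis using perp_l[OF kl] by simp
  qed
  have dl: "d t k (Suc l) = d t k l + (c t k l - c t k (Suc l)) \<bullet> f k (Suc l)" for t k l by (simp add: d_def)
  have dk: "d t (Suc k) l = d t k l + (c t k l - c t (Suc k) l) \<bullet> f (Suc k) l"
    if t: "t \<in> {0..1}" and k: "Suc k < m" and "l < n" for t k l
    using \<open>l < n\<close>
  proof (induction l)
    case 0 show ?case by (simp add: d_def)
  next
    case (Suc l)
    have l: "l < n" using Suc by simp
    have 1: "(c t k l - c t (Suc k) l) \<bullet> f (Suc k) l = (c t k l - c t (Suc k) l) \<bullet> f (Suc k) (Suc l)"
      using pk[OF t k l] by (simp add: inner_diff_left inner_diff_right)
    have 2: "(c t k l - c t k (Suc l)) \<bullet> f k (Suc l) = (c t k l - c t k (Suc l)) \<bullet> f (Suc k) (Suc l)"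
      using pl[OF t _ Suc.prems, of k] k by (simp add: inner_diff_left inner_diff_right)
    show ?case unfolding dl using Suc.IH[OF l] 1 2 by (simp add: inner_diff_left)
  qed
  have \<delta>k: "\<delta> t (Suc k) l (f (Suc k) l) = \<delta> t k l (f (Suc k) l)"
      "\<delta> t (Suc k) l (f (Suc k) (Suc l)) = \<delta> t k l (f (Suc k) (Suc l))"
    if t: "t \<in> {0..1}" and kl: "Suc k < m" "l < n" for t k l
    using dk[OF t kl] pk[OF t kl] by (simp_all add: \<delta>_def inner_diff_left inner_diff_right)
  have \<delta>l: "\<delta> t k (Suc l) (f k (Suc l)) = \<delta> t k l (f k (Suc l))"
      "\<delta> t k (Suc l) (f (Suc k) (Suc l)) = \<delta> t k l (f (Suc k) (Suc l))"
    if t: "t \<in> {0..1}" and kl: "k < m" "Suc l < n" for t k l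
    using dl[of t k l] pl[OF t kl] by (simp_all add: \<delta>_def inner_diff_left inner_diff_right)
  \<comment> \<open>A vertex follows the face that has it as first corner; in the last row and
    column, where there is none, the index is cut off to the last face.\<close>
  define G where "G t i j = (let k = min i (m - 1); l = min j (n - 1) in move 1 0 0 (c t k l) (d t k l) (F i j))" for t i j
  have Gmove: "G t i j = move 1 0 0 (c t k l) (d t k l) (F i j)"
    if t: "t \<in> {0..1}" and kl: "k < m" "l < n" and ij: "i = k \<or> i = Suc k" "j = l \<or> j = Suc l" for t k l i j
  proof -
    have eq: "move 1 0 0 (c t k' l') (d t k' l') p = move 1 0 0 (c t k l) (d t k l) p"
      if "\<delta> t k' l' (top_view p) = \<delta> t k l (top_view p)" for k' l' k l p
      using that by (simp add: pt_eq_iff \<delta>_def)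
    define k' l' where "k' = min i (m - 1)" "l' = min j (n - 1)"
    have G: "G t i j = move 1 0 0 (c t k' l') (d t k' l') (F i j)" by (simp add: G_def k'_l'_def Let_def)
    have k': "k' = k \<or> k' = Suc k \<and> i = Suc k \<and> Suc k < m" and l': "l' = l \<or> l' = Suc l \<and> j = Suc l \<and> Suc l < n"
      using ij kl by (auto simp: k'_l'_def)
    have "\<delta> t k' l' (f i j) = \<delta> t k l (f i j)"
      using k'
    proof
      assume k: "k' = k"
      show ?thesis using l' \<delta>l[OF t kl(1)] ij unfolding k by auto
    next
      assume k: "k' = Suc k \<and> i = Suc k \<and> Suc k < m"
      have 1: "\<delta> t (Suc k) l (f i j) = \<delta> t k l (f i j)" using \<delta>k[OF t _ kl(2), of k] k ij by auto
      show ?thesis using l' \<delta>l(1)[OF t, of "Suc k" l] 1 k by auto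
    qed
    then show ?thesis unfolding G by (rule eq)
  qed
  have corners: "move 1 0 0 (c t k l) (d t k l) (F k l) = G t k l" "move 1 0 0 (c t k l) (d t k l) (F (Suc k) l) = G t (Suc k) l"
      "move 1 0 0 (c t k l) (d t k l) (F (Suc k) (Suc l)) = G t (Suc k) (Suc l)"
      "move 1 0 0 (c t k l) (d t k l) (F k (Suc l)) = G t k (Suc l)"
    if "t \<in> {0..1}" "k < m" "l < n" for t k l
    using Gmove[OF that] by auto
  have contc: "continuous_on {0..1} (\<lambda>t. c t k l)" if "k < m" "l < n" for k l
    using cb that unfolding combescure_def c_def by (auto intro!: continuous_intros)
  have contd: "continuous_on {0..1} (\<lambda>t. d t k l)" if "k < m" "l < n" for k l
    unfolding d_def using that by (auto intro!: continuous_intros contc)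
  have c0: "c 0 k l = 0" if "k < m" "l < n" for k l using cb that by (auto simp: combescure_def c_def)
  have d0: "d 0 k l = 0" if "k < m" "l < n" for k l using that by (auto simp: d_def c0)
  have grad_G: "dual_top (face_plane (G t) k l) = D t k l" if "t \<in> {0..1}" "k < m" "l < n" for t k l
    using face_moved[OF that(2,3) _ corners[OF that]] by (simp add: c_def)
  have "iso_deform m n F G"
    unfolding iso_deform_def
  proof (intro conjI allI impI ballI; (elim conjE)?)
    fix i j assume ij: "i \<le> m" "j \<le> n"
    have kl: "min i (m - 1) < m" "min j (n - 1) < n" using mn by auto
    show "continuous_on {0..1} (\<lambda>t. G t i j)"
      unfolding G_def move_def Let_def using contc[OF kl] contd[OF kl] by (auto intro!: continuous_intros)
    show "G 0 i j = F i j" unfolding G_def Let_def c0[OF kl] d0[OF kl] by (simp add: pt_eq_iff)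
  next
    fix t :: real assume t: "t \<in> {0..1}"
    show "is_net m n (G t)"
      unfolding is_net_def
    proof (intro conjI allI impI)
      fix k l assume kl: "k < m" "l < n"
      have "convex_quad (F k l) (F (Suc k) l) (F (Suc k) (Suc l)) (F k (Suc l))"
        using net kl by (simp add: is_net_def)
      from convex_quad_shear[OF this, of "c t k l" "d t k l"]
      show "convex_quad (G t k l) (G t (Suc k) l) (G t (Suc k) (Suc l)) (G t k (Suc l))"
        unfolding corners[OF t kl] .
    qed (use mn in auto)
  next
    fix t :: real and k l assume t: "t \<in> {0..1}" and kl: "k < m" "l < n"
    have "iso_cong (move 1 0 0 (c t k l) (d t k l))" unfolding iso_cong_iff_move
      by (rule exI[of _ 1], rule exI[of _ 0], rule exI[of _ 0], rule exI[of _ "c t k l"], rule exI[of _ "d t k l"]) simp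
    then show "\<exists>C. iso_cong C \<and> C (F k l) = G t k l \<and> C (F (Suc k) l) = G t (Suc k) l \<and>
          C (F (Suc k) (Suc l)) = G t (Suc k) (Suc l) \<and> C (F k (Suc l)) = G t k (Suc l)"
      using corners[OF t kl] by blast
  next
    fix t :: real and i j assume t: "t \<in> {0..1}" and ij: "0 < i" "i < m" "0 < j" "j < n"
    obtain k l where kl: "i = Suc k" "j = Suc l" using ij by (metis Suc_pred)
    have kl': "Suc k < m" "Suc l < n" "k < m" "l < n" using ij kl by auto
    have "curv (G t) i j = area4 (D t k l) (D t (Suc k) l) (D t (Suc k) (Suc l)) (D t k (Suc l)) / 2"
      using kl' unfolding kl curv_def Let_def by (simp add: grad_G[OF t] area4_def tri_def det2_def algebra_simps)
    also have "\<dots> = curv F i j" unfolding kl curv_P[OF kl'(1,2)] using cb t kl' unfolding combescure_def by simp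
    finally show "curv (G t) i j = curv F i j" .
  qed
  moreover have "\<not> trivial_deform m n F G"
  proof
    assume tr: "trivial_deform m n F G"
    have "D t k l - P k l = D t 0 0 - P 0 0" if t: "t \<in> {0..1}" and kl: "k < m" "l < n" for t k l
    proof -
      obtain x y w c' d' where "\<forall>i\<le>m. \<forall>j\<le>n. G t i j = move x y w c' d' (F i j)"
        using tr t unfolding trivial_deform_def iso_cong_iff_move by blast
      then have C: "G t i j = move x y w c' d' (F i j)" if "i \<le> m" "j \<le> n" for i j using that by blast
      have "c t k l = c'" if kl: "k < m" "l < n" for k l
      proof -
        have e: "c t k l \<bullet> f i j + d t k l = c' \<bullet> f i j + d'"
          if "i = k \<or> i = Suc k" "j = l \<or> j = Suc l" for i j
        proof -
          have "i \<le> m" "j \<le> n" using that kl by auto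
          then have "move 1 0 0 (c t k l) (d t k l) (F i j) = move x y w c' d' (F i j)"
            using Gmove[OF t kl that] C by simp
          then show ?thesis by (simp add: pt_eq_iff)
        qed
        have "(c t k l - c') \<bullet> (f (Suc k) l - f k l) = 0" "(c t k l - c') \<bullet> (f k (Suc l) - f k l) = 0"
          using e[of k l] e[of "Suc k" l] e[of k "Suc l"] by (simp_all add: inner_diff_left inner_diff_right)
        then have "c t k l - c' = 0" using nondeg(1)[OF kl] unfolding tri_def by (rule perp_basis)
        then show ?thesis by simp
      qed
      from this[OF kl] this[of 0 0] show ?thesis using mn by (simp add: c_def)
    qed
    then have "shifted m n P D" unfolding shifted_def by blast
    then show False using ns by simp
  qed
  ultimately show ?thesis unfolding flexible_def by blast
qed

lemma combescure_if_flexible: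
  assumes fl: "flexible m n F"
  shows "\<exists>D. combescure m n P D \<and> \<not> shifted m n P D"
proof -
  obtain G where G: "iso_deform m n F G" and nt: "\<not> trivial_deform m n F G"
    using fl by (auto simp: flexible_def)
  define Q where "Q t k l x y w c d \<longleftrightarrow> x\<^sup>2 + y\<^sup>2 = 1 \<and>
      move x y w c d (F k l) = G t k l \<and> move x y w c d (F (Suc k) l) = G t (Suc k) l \<and>
      move x y w c d (F (Suc k) (Suc l)) = G t (Suc k) (Suc l) \<and> move x y w c d (F k (Suc l)) = G t k (Suc l)"
    for t :: real and k l x y w c d
  have ex: "\<exists>x y w c d. Q t k l x y w c d" if tkl: "t \<in> {0..1}" "k < m" "l < n" for t k l
  proof -
    obtain C where C: "iso_cong C" and e: "C (F k l) = G t k l" "C (F (Suc k) l) = G t (Suc k) l"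
      "C (F (Suc k) (Suc l)) = G t (Suc k) (Suc l)" "C (F k (Suc l)) = G t k (Suc l)"
      using G tkl unfolding iso_deform_def by meson
    obtain x y w c d where "x\<^sup>2 + y\<^sup>2 = 1" "C = move x y w c d" using C unfolding iso_cong_iff_move by blast
    then have "Q t k l x y w c d" unfolding Q_def using e by simp
    then show ?thesis by blast
  qed
  have "\<forall>t k l. \<exists>x y w c d. t \<in> {0..1} \<and> k < m \<and> l < n \<longrightarrow> Q t k l x y w c d" using ex by meson
  then obtain x y w c d where Q: "\<forall>t k l. t \<in> {0..1} \<and> k < m \<and> l < n \<longrightarrow> Q t k l (x t k l) (y t k l) (w t k l) (c t k l) (d t k l)"
    unfolding choice_iff by blast
  have xy: "(x t k l)\<^sup>2 + (y t k l)\<^sup>2 = 1"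
    and mv: "move (x t k l) (y t k l) (w t k l) (c t k l) (d t k l) (F k l) = G t k l \<and>
      move (x t k l) (y t k l) (w t k l) (c t k l) (d t k l) (F (Suc k) l) = G t (Suc k) l \<and>
      move (x t k l) (y t k l) (w t k l) (c t k l) (d t k l) (F (Suc k) (Suc l)) = G t (Suc k) (Suc l) \<and>
      move (x t k l) (y t k l) (w t k l) (c t k l) (d t k l) (F k (Suc l)) = G t k (Suc l)"
    if "t \<in> {0..1}" "k < m" "l < n" for t k l
    using Q[rule_format, of t k l] that unfolding Q_def by auto
  have top: "top_view (G t i j) = turn (x t k l) (y t k l) (f i j) + w t k l"
    and zcG: "zc (G t i j) = zc (F i j) + c t k l \<bullet> f i j + d t k l"
    if "t \<in> {0..1}" "k < m" "l < n" "i = k \<or> i = Suc k" "j = l \<or> j = Suc l" for t k l i j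
  proof -
    have "G t i j = move (x t k l) (y t k l) (w t k l) (c t k l) (d t k l) (F i j)"
      using mv[OF that(1-3)] that(4,5) by auto
    then show "top_view (G t i j) = turn (x t k l) (y t k l) (f i j) + w t k l"
      "zc (G t i j) = zc (F i j) + c t k l \<bullet> f i j + d t k l" by simp_all
  qed
  text \<open>Two neighbouring faces share an edge with nonzero top view, which determines the rotation.\<close>
  have share: "x t k l = x t k' l' \<and> y t k l = y t k' l' \<and> w t k l = w t k' l' \<and>
      (c t k' l' - c t k l) \<bullet> (f i' j' - f i j) = 0 \<and> (c t k l = c t k' l' \<longrightarrow> d t k l = d t k' l')"
    if t: "t \<in> {0..1}" and "k < m" "l < n" "k' < m" "l' < n"
      "i = k \<or> i = Suc k" "j = l \<or> j = Suc l" "i' = k \<or> i' = Suc k" "j' = l \<or> j' = Suc l"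
      "i = k' \<or> i = Suc k'" "j = l' \<or> j = Suc l'" "i' = k' \<or> i' = Suc k'" "j' = l' \<or> j' = Suc l'"
      and ne: "f i' j' \<noteq> f i j" for t k l k' l' i j i' j'
  proof -
    have 1: "turn (x t k l) (y t k l) (f i j) + w t k l = turn (x t k' l') (y t k' l') (f i j) + w t k' l'"
      "turn (x t k l) (y t k l) (f i' j') + w t k l = turn (x t k' l') (y t k' l') (f i' j') + w t k' l'"
      using top[OF t that(2,3,6,7)] top[OF t that(4,5,10,11)] top[OF t that(2,3,8,9)] top[OF t that(4,5,12,13)] by simp_all
    have "turn (x t k l) (y t k l) (f i' j' - f i j) =
        (turn (x t k l) (y t k l) (f i' j') + w t k l) - (turn (x t k l) (y t k l) (f i j) + w t k l)"
      by (simp add: turn_linear)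
    also have "\<dots> = turn (x t k' l') (y t k' l') (f i' j' - f i j)" unfolding 1 by (simp add: turn_linear)
    finally have xy: "x t k l = x t k' l' \<and> y t k l = y t k' l'"
      by (rule turn_unique) (use ne in simp)
    have 2: "c t k l \<bullet> f i j + d t k l = c t k' l' \<bullet> f i j + d t k' l'"
      "c t k l \<bullet> f i' j' + d t k l = c t k' l' \<bullet> f i' j' + d t k' l'"
      using zcG[OF t that(2,3,6,7)] zcG[OF t that(4,5,10,11)] zcG[OF t that(2,3,8,9)] zcG[OF t that(4,5,12,13)] by simp_all
    show ?thesis using xy 1 2 by (auto simp: inner_diff_left inner_diff_right)
  qed
  have sk: "x t k l = x t (Suc k) l \<and> y t k l = y t (Suc k) l \<and> w t k l = w t (Suc k) l \<and>
      (c t (Suc k) l - c t k l) \<bullet> (f (Suc k) (Suc l) - f (Suc k) l) = 0 \<and> (c t k l = c t (Suc k) l \<longrightarrow> d t k l = d t (Suc k) l)"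
    if "t \<in> {0..1}" "Suc k < m" "l < n" for t k l
    by (rule share) (use that edge_top(3)[of k l] in auto)
  have sl: "x t k l = x t k (Suc l) \<and> y t k l = y t k (Suc l) \<and> w t k l = w t k (Suc l) \<and>
      (c t k (Suc l) - c t k l) \<bullet> (f (Suc k) (Suc l) - f k (Suc l)) = 0 \<and> (c t k l = c t k (Suc l) \<longrightarrow> d t k l = d t k (Suc l))"
    if "t \<in> {0..1}" "k < m" "Suc l < n" for t k l
    by (rule share) (use that edge_top(4)[of k l] in auto)
  define D where "D t k l = P k l + c t k l" for t k l
  \<comment> \<open>The congruences were chosen separately for each time, so nothing is known about
    their continuity; but the heights of three vertices determine \<open>c\<close> by Cramer's rule,
    which makes it continuous.\<close>
  have cramer: "fst (c t k l) * tri (f k l) (f (Suc k) l) (f k (Suc l)) =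
        (zc (G t (Suc k) l) - zc (F (Suc k) l) - (zc (G t k l) - zc (F k l))) * snd (f k (Suc l) - f k l) -
        (zc (G t k (Suc l)) - zc (F k (Suc l)) - (zc (G t k l) - zc (F k l))) * snd (f (Suc k) l - f k l)"
    "snd (c t k l) * tri (f k l) (f (Suc k) l) (f k (Suc l)) =
        (zc (G t k (Suc l)) - zc (F k (Suc l)) - (zc (G t k l) - zc (F k l))) * fst (f (Suc k) l - f k l) -
        (zc (G t (Suc k) l) - zc (F (Suc k) l) - (zc (G t k l) - zc (F k l))) * fst (f k (Suc l) - f k l)"
    if "t \<in> {0..1}" "k < m" "l < n" for t k l
    using zcG[OF that, of k l] zcG[OF that, of "Suc k" l] zcG[OF that, of k "Suc l"]
    by (simp_all add: tri_def det2_def inner_vec2 algebra_simps)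
  have contc: "continuous_on {0..1} (\<lambda>t. c t k l)" if kl: "k < m" "l < n" for k l
  proof -
    let ?T = "tri (f k l) (f (Suc k) l) (f k (Suc l))"
    have G': "continuous_on {0..1} (\<lambda>t. zc (G t i j))" if "i \<le> m" "j \<le> n" for i j
      using G that unfolding iso_deform_def zc_def by (auto intro!: continuous_intros)
    have "continuous_on {0..1} (\<lambda>t. (
        ((zc (G t (Suc k) l) - zc (F (Suc k) l) - (zc (G t k l) - zc (F k l))) * snd (f k (Suc l) - f k l) -
        (zc (G t k (Suc l)) - zc (F k (Suc l)) - (zc (G t k l) - zc (F k l))) * snd (f (Suc k) l - f k l)) / ?T,
        ((zc (G t k (Suc l)) - zc (F k (Suc l)) - (zc (G t k l) - zc (F k l))) * fst (f (Suc k) l - f k l) -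
        (zc (G t (Suc k) l) - zc (F (Suc k) l) - (zc (G t k l) - zc (F k l))) * fst (f k (Suc l) - f k l)) / ?T))"
      using kl nondeg(1)[OF kl] by (intro continuous_intros G') auto
    then show ?thesis
      by (rule continuous_on_eq) (simp only: cramer[OF _ kl, symmetric] nonzero_mult_div_cancel_right[OF nondeg(1)[OF kl]] prod.collapse)
  qed
  have c0: "c 0 k l = 0" if kl: "k < m" "l < n" for k l
  proof -
    have "G 0 k l = F k l" "G 0 (Suc k) l = F (Suc k) l" "G 0 k (Suc l) = F k (Suc l)"
      using G kl unfolding iso_deform_def by auto
    then have "fst (c 0 k l) = 0" "snd (c 0 k l) = 0" using cramer[of 0 k l] kl nondeg(1)[OF kl] by simp_all
    then show ?thesis by (simp add: prod_eq_iff)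
  qed
  have "combescure m n P D"
    unfolding combescure_def
  proof (intro conjI allI impI ballI; (elim conjE)?)
    fix k l assume kl: "k < m" "l < n"
    show "continuous_on {0..1} (\<lambda>t. D t k l)" "D 0 k l = P k l"
      unfolding D_def using contc[OF kl] c0[OF kl] by (auto intro!: continuous_intros)
  next
    fix t :: real and k l assume t: "t \<in> {0..1}" and kl: "Suc k < m" "l < n"
    have "\<exists>\<alpha>. c t (Suc k) l - c t k l = \<alpha> *\<^sub>R (P (Suc k) l - P k l)"
      by (rule perp_parallel[OF _ cg.edges_nonzero(1)[OF kl] perp_k[OF kl]])
        (use edge_top(3)[of k l] sk[OF t kl] kl in auto)
    then obtain \<alpha> where "c t (Suc k) l - c t k l = \<alpha> *\<^sub>R (P (Suc k) l - P k l)" by blast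
    then have "D t (Suc k) l - D t k l = (\<alpha> + 1) *\<^sub>R (P (Suc k) l - P k l)" by (simp add: D_def algebra_simps)
    then show "\<exists>\<alpha>. D t (Suc k) l - D t k l = \<alpha> *\<^sub>R (P (Suc k) l - P k l)" by blast
  next
    fix t :: real and k l assume t: "t \<in> {0..1}" and kl: "k < m" "Suc l < n"
    have "\<exists>\<alpha>. c t k (Suc l) - c t k l = \<alpha> *\<^sub>R (P k (Suc l) - P k l)"
      by (rule perp_parallel[OF _ cg.edges_nonzero(2)[OF kl] perp_l[OF kl]])
        (use edge_top(4)[of k l] sl[OF t kl] kl in auto)
    then obtain \<alpha> where "c t k (Suc l) - c t k l = \<alpha> *\<^sub>R (P k (Suc l) - P k l)" by blast
    then have "D t k (Suc l) - D t k l = (\<alpha> + 1) *\<^sub>R (P k (Suc l) - P k l)" by (simp add: D_def algebra_simps)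
    then show "\<exists>\<alpha>. D t k (Suc l) - D t k l = \<alpha> *\<^sub>R (P k (Suc l) - P k l)" by blast
  next
    fix t :: real and k l assume t: "t \<in> {0..1}" and kl: "Suc k < m" "Suc l < n"
    have kl': "k < m" "l < n" using kl by auto
    have dt: "dual_top (face_plane (G t) i j) = turn (x t i j) (y t i j) (D t i j)" if "i < m" "j < n" for i j
      unfolding D_def by (rule face_moved[OF that xy[OF t that], of "w t i j" _ "d t i j"]) (use mv[OF t that] in auto)
    have e: "x t (Suc k) l = x t k l" "y t (Suc k) l = y t k l" "x t k (Suc l) = x t k l" "y t k (Suc l) = y t k l"
      "x t (Suc k) (Suc l) = x t k l" "y t (Suc k) (Suc l) = y t k l"
      using sk[OF t kl(1) kl'(2)] sl[OF t kl'(1) kl(2)] sk[OF t kl] by auto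
    have "curv (G t) (Suc k) (Suc l) = area4 (turn (x t k l) (y t k l) (D t k l)) (turn (x t k l) (y t k l) (D t (Suc k) l))
        (turn (x t k l) (y t k l) (D t (Suc k) (Suc l))) (turn (x t k l) (y t k l) (D t k (Suc l))) / 2"
      unfolding curv_def Let_def using kl kl' by (simp add: dt e area4_def tri_def det2_def algebra_simps)
    also have "\<dots> = area4 (D t k l) (D t (Suc k) l) (D t (Suc k) (Suc l)) (D t k (Suc l)) / 2"
      by (simp add: area4_turn[OF xy[OF t kl']])
    finally have "area4 (D t k l) (D t (Suc k) l) (D t (Suc k) (Suc l)) (D t k (Suc l)) = 2 * curv (G t) (Suc k) (Suc l)" by simp
    also have "curv (G t) (Suc k) (Suc l) = curv F (Suc k) (Suc l)"
      using G t kl unfolding iso_deform_def by blast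
    finally show "area4 (D t k l) (D t (Suc k) l) (D t (Suc k) (Suc l)) (D t k (Suc l)) =
          area4 (P k l) (P (Suc k) l) (P (Suc k) (Suc l)) (P k (Suc l))"
      by (simp add: curv_P[OF kl])
  qed
  moreover have "\<not> shifted m n P D"
  proof
    assume sh: "shifted m n P D"
    have c: "c t k l = c t 0 0" if "t \<in> {0..1}" "k < m" "l < n" for t k l
    proof -
      have "D t k l - P k l = D t 0 0 - P 0 0" using sh that unfolding shifted_def by blast
      then show ?thesis by (simp add: D_def)
    qed
    have "trivial_deform m n F G"
      unfolding trivial_deform_def
    proof
      fix t :: real assume t: "t \<in> {0..1}"
      define par where "par k l = (x t k l, y t k l, w t k l, c t k l, d t k l)" for k l
      have stepk: "par (Suc k) l = par k l" if "Suc k < m" "l < n" for k l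
        using sk[OF t that] c[OF t, of k l] c[OF t, of "Suc k" l] that by (simp add: par_def)
      have stepl: "par k (Suc l) = par k l" if "k < m" "Suc l < n" for k l
        using sl[OF t that] c[OF t, of k l] c[OF t, of k "Suc l"] that by (simp add: par_def)
      have p0: "par k 0 = par 0 0" if "k < m" for k
        using that by (induction k) (use stepk mn in auto)
      have pp: "par k l = par 0 0" if "k < m" "l < n" for k l
        using that(2) by (induction l) (use stepl p0[OF that(1)] that(1) in auto)
      have par: "x t k l = x t 0 0" "y t k l = y t 0 0" "w t k l = w t 0 0" "d t k l = d t 0 0" if "k < m" "l < n" for k l
        using pp[OF that] by (simp_all add: par_def)
      have "G t i j = move (x t 0 0) (y t 0 0) (w t 0 0) (c t 0 0) (d t 0 0) (F i j)" if "i \<le> m" "j \<le> n" for i j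
      proof -
        define k l where "k = min i (m - 1)" "l = min j (n - 1)"
        have kl: "k < m" "l < n" "i = k \<or> i = Suc k" "j = l \<or> j = Suc l" using that mn by (auto simp: k_l_def)
        have "G t i j = move (x t k l) (y t k l) (w t k l) (c t k l) (d t k l) (F i j)"
          using mv[OF t kl(1,2)] kl(3,4) by auto
        then show ?thesis unfolding par[OF kl(1,2)] c[OF t kl(1,2)] .
      qed
      moreover have "iso_cong (move (x t 0 0) (y t 0 0) (w t 0 0) (c t 0 0) (d t 0 0))"
      proof -
        have "(x t 0 0)\<^sup>2 + (y t 0 0)\<^sup>2 = 1" using xy[OF t, of 0 0] mn by simp
        then show ?thesis unfolding iso_cong_iff_move by blast
      qed
      ultimately show "\<exists>C. iso_cong C \<and> (\<forall>i\<le>m. \<forall>j\<le>n. G t i j = C (F i j))" by blast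
    qed
    then show False using nt by simp
  qed
  ultimately show ?thesis by blast
qed

lemma flexible_iff_rate_motion:
  "flexible m n F \<longleftrightarrow> (\<exists>c h. rate_motion m n cg.a cg.b c h \<and> moving m n h)"
  using flexible_if_combescure combescure_if_flexible cg.combescure_if_rate_motion cg.rate_motion_if_combescure
  by blast

end

subsection \<open>Opposite ratios and common isotropic planes\<close>

lemma dual_net_if_dual_convex:
  assumes dc: "dual_convex m n F"
  shows "\<exists>q. dual_net m n F q"
proof -
  have net: "is_net m n F" and mn: "2 \<le> m" "2 \<le> n" using dc by (auto simp: dual_convex_def)
  have block: "\<exists>q1 q2 q3 q4. face_plane F k l = nplane q1 \<and> face_plane F (Suc k) l = nplane q2 \<and>
      face_plane F (Suc k) (Suc l) = nplane q3 \<and> face_plane F k (Suc l) = nplane q4 \<and>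
      convex4 (grad q1) (grad q2) (grad q3) (grad q4)"
    if "Suc k < m" "Suc l < n" for k l
  proof -
    have "0 < Suc k \<and> Suc k < m \<and> 0 < Suc l \<and> Suc l < n" using that by simp
    then obtain V A B C D where "convex_quad A B C D" "V \<notin> affine hull {A, B, C, D}" "admissible V A B C D"
      and f: "face_plane F k l = affine hull {V, A, B}" "face_plane F (Suc k) l = affine hull {V, B, C}"
        "face_plane F (Suc k) (Suc l) = affine hull {V, C, D}" "face_plane F k (Suc l) = affine hull {V, D, A}"
      using dc unfolding dual_convex_def by (metis diff_Suc_1)
    then obtain q1 q2 q3 q4 where "affine hull {V, A, B} = nplane q1" "affine hull {V, B, C} = nplane q2"
      "affine hull {V, C, D} = nplane q3" "affine hull {V, D, A} = nplane q4"
      "convex4 (grad q1) (grad q2) (grad q3) (grad q4)"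
      by (elim admissible_planes)
    then show ?thesis unfolding f by blast
  qed
  define q where "q k l = coeffs (face_plane F k l)" for k l
  have fp: "face_plane F k l = nplane (q k l)" if kl: "k < m" "l < n" for k l
  proof -
    \<comment> \<open>Every face belongs to a block around a non-boundary vertex; the cut-off at
      \<open>m - 2\<close> and \<open>n - 2\<close> covers the last row and column.\<close>
    define k' l' where "k' = min k (m - 2)" "l' = min l (n - 2)"
    have kl': "Suc k' < m" "Suc l' < n" "k = k' \<or> k = Suc k'" "l = l' \<or> l = Suc l'"
      using kl mn by (auto simp: k'_l'_def)
    obtain q1 q2 q3 q4 where "face_plane F k' l' = nplane q1" "face_plane F (Suc k') l' = nplane q2"
      "face_plane F (Suc k') (Suc l') = nplane q3" "face_plane F k' (Suc l') = nplane q4"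
      using block[OF kl'(1,2)] by blast
    then have "\<exists>q. face_plane F k l = nplane q" using kl'(3,4) by blast
    then show ?thesis unfolding q_def by (metis coeffs_nplane)
  qed
  have vert: "F k l \<in> nplane (q k l)" "F (Suc k) l \<in> nplane (q k l)" "F (Suc k) (Suc l) \<in> nplane (q k l)"
    "F k (Suc l) \<in> nplane (q k l)" if "k < m" "l < n" for k l
    unfolding fp[OF that, symmetric] face_plane_def by (auto intro: hull_inc)
  have quad: "convex_quad (F k l) (F (Suc k) l) (F (Suc k) (Suc l)) (F k (Suc l))" if "k < m" "l < n" for k l
    using net that by (simp add: is_net_def)
  have "dual_net m n F q"
  proof
    fix k l assume kl: "Suc k < m" "Suc l < n"
    obtain q1 q2 q3 q4 where "face_plane F k l = nplane q1" "face_plane F (Suc k) l = nplane q2"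
      "face_plane F (Suc k) (Suc l) = nplane q3" "face_plane F k (Suc l) = nplane q4"
      "convex4 (grad q1) (grad q2) (grad q3) (grad q4)" using block[OF kl] by blast
    then show "convex4 (grad (q k l)) (grad (q (Suc k) l)) (grad (q (Suc k) (Suc l))) (grad (q k (Suc l)))"
      by (simp add: q_def)
  next
    fix k l assume kl: "k < m" "l < n"
    have nc: "\<not> collinear {F k l, F (Suc k) l, F k (Suc l)}" "\<not> collinear {F (Suc k) (Suc l), F (Suc k) l, F k (Suc l)}"
      using quad[OF kl] unfolding convex_quad_def by (simp_all add: insert_commute)
    show "tri (top_view (F k l)) (top_view (F (Suc k) l)) (top_view (F k (Suc l))) \<noteq> 0"
      by (rule noncollinear_top_view[OF nc(1) vert(1,2,4)[OF kl]])
    show "tri (top_view (F (Suc k) (Suc l))) (top_view (F (Suc k) l)) (top_view (F k (Suc l))) \<noteq> 0"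
      by (rule noncollinear_top_view[OF nc(2) vert(3,2,4)[OF kl]])
  qed (use mn net fp vert in \<open>simp_all add: mem_nplane\<close>)
  then show ?thesis by blast
qed

definition quarter :: "vec2 \<Rightarrow> vec2" where "quarter v = (- snd v, fst v)"

lemma quarter_simps: "u \<bullet> quarter v = - det2 u v" "det2 (quarter u) (quarter v) = det2 u v"
  by (simp_all add: quarter_def det2_def inner_vec2)

lemma quarter_perp: "v \<bullet> quarter v = 0" "quarter v \<bullet> v = 0" "quarter v = 0 \<longleftrightarrow> v = 0"
  by (auto simp: quarter_def inner_vec2 prod_eq_iff)

lemma perp_eq_quarter:
  assumes "v \<noteq> 0" "v \<bullet> g = 0"
  shows "\<exists>k. g = k *\<^sub>R quarter v"
  using perp_parallel[of v "quarter v" g] assms quarter_perp by (simp add: inner_commute)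

lemma grad_linear: "grad (x + y) = grad x + grad y" "grad (x - y) = grad x - grad y" "grad (k *\<^sub>R x) = k *\<^sub>R grad x"
  by (simp_all add: grad_def)

lemma aff_linear: "aff (x + y) v = aff x v + aff y v" "aff (x - y) v = aff x v - aff y v" "aff (k *\<^sub>R x) v = k * aff x v"
  by (simp_all add: aff_def grad_linear inner_add_left inner_diff_left algebra_simps)

lemma aff_diff: "aff x v - aff x w = grad x \<bullet> (v - w)"
  by (simp add: aff_def inner_diff_right)

lemma triple_eq_iff: "x = y \<longleftrightarrow> grad x = grad y \<and> aff x v = aff y v"
  by (auto simp: aff_def grad_def prod_eq_iff)

text \<open>The plane $p$ in the opposite ratio is dual to the intersection point of the diagonals of the
  gradient quadrilateral.\<close>

lemma opp_ratio_nplane: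
  assumes cv: "convex4 (grad q1) (grad q2) (grad q3) (grad q4)"
    and V: "V \<in> nplane q1" "V \<in> nplane q2" "V \<in> nplane q3" "V \<in> nplane q4"
  shows "opp_ratio (nplane q1) (nplane q2) (nplane q3) (nplane q4) =
    (tri (grad q3) (grad q4) (grad q1) * tri (grad q4) (grad q1) (grad q2)) /
    (tri (grad q1) (grad q2) (grad q3) * tri (grad q2) (grad q3) (grad q4))"
proof -
  let ?g1 = "grad q1" and ?g2 = "grad q2" and ?g3 = "grad q3" and ?g4 = "grad q4"
  define p q r s where pqrs: "p = tri ?g1 ?g2 ?g3" "q = tri ?g2 ?g3 ?g4" "r = tri ?g3 ?g4 ?g1" "s = tri ?g4 ?g1 ?g2"
  have sum: "p + r = q + s" unfolding pqrs by (rule tri_sum)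
  have sg: "0 < p \<and> 0 < q \<and> 0 < r \<and> 0 < s \<or> p < 0 \<and> q < 0 \<and> r < 0 \<and> s < 0"
    using cv unfolding convex4_def pqrs by auto
  then have nz: "p \<noteq> 0" "q \<noteq> 0" "r \<noteq> 0" "s \<noteq> 0" "q + s \<noteq> 0" "p + r \<noteq> 0" by auto
  \<comment> \<open>The diagonals of the gradient quadrilateral cross at the point with weights
    \<open>q : s\<close> on one and \<open>r : p\<close> on the other. The same weights applied to
    the whole coefficient triples give a plane through both intersection lines, as all four planes
    pass through \<open>V\<close>.\<close>
  define Q where "Q = (1 / (q + s)) *\<^sub>R (q *\<^sub>R q1 + s *\<^sub>R q3)"
  have "q *\<^sub>R q1 + s *\<^sub>R q3 = r *\<^sub>R q2 + p *\<^sub>R q4"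
  proof -
    have "q *\<^sub>R ?g1 + s *\<^sub>R ?g3 = r *\<^sub>R ?g2 + p *\<^sub>R ?g4"
      unfolding pqrs by (simp add: prod_eq_iff tri_def det2_def algebra_simps)
    moreover have "q * zc V + s * zc V = r * zc V + p * zc V"
      using sum by (metis add.commute distrib_right)
    ultimately show ?thesis
      using V unfolding triple_eq_iff[of _ _ "top_view V"] mem_nplane by (simp add: grad_linear aff_linear)
  qed
  then have Q': "Q = (1 / (p + r)) *\<^sub>R (r *\<^sub>R q2 + p *\<^sub>R q4)" unfolding Q_def sum by simp
  have in1: "nplane q1 \<inter> nplane q3 \<subseteq> nplane Q"
  proof
    fix x assume "x \<in> nplane q1 \<inter> nplane q3"
    then have "aff Q (top_view x) = (1 / (q + s)) * ((q + s) * zc x)"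
      unfolding Q_def aff_linear by (simp add: mem_nplane distrib_right)
    then show "x \<in> nplane Q" using nz by (simp add: mem_nplane)
  qed
  have in2: "nplane q2 \<inter> nplane q4 \<subseteq> nplane Q"
  proof
    fix x assume "x \<in> nplane q2 \<inter> nplane q4"
    then have "aff Q (top_view x) = (1 / (p + r)) * ((p + r) * zc x)"
      unfolding Q' aff_linear by (simp add: mem_nplane distrib_right add.commute)
    then show "x \<in> nplane Q" using nz by (simp add: mem_nplane)
  qed
  \<comment> \<open>A second point on the line in which two of the planes meet: in the top view this
    line runs perpendicular to the gradient difference.\<close>
  have pt: "\<exists>x. x \<in> nplane a \<inter> nplane b \<and> top_view x = top_view V + quarter (grad b - grad a)"
    if ab: "V \<in> nplane a" "V \<in> nplane b" for a b
  proof -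
    define v where "v = top_view V + quarter (grad b - grad a)"
    have "aff b v - aff a v = (aff b (top_view V) - aff a (top_view V)) + (grad b - grad a) \<bullet> quarter (grad b - grad a)"
      by (simp add: v_def aff_def inner_add_right inner_diff_left)
    also have "\<dots> = 0" using ab by (simp add: mem_nplane quarter_perp)
    finally have "aff b v = aff a v" by simp
    then have "(fst v, snd v, aff a v) \<in> nplane a \<inter> nplane b"
      by (simp add: mem_nplane top_view_def xc_def yc_def zc_def)
    then show ?thesis by (intro exI[of _ "(fst v, snd v, aff a v)"]) (simp add: v_def top_view_def xc_def yc_def prod_eq_iff)
  qed
  obtain B where B: "B \<in> nplane q1 \<inter> nplane q3" "top_view B = top_view V + quarter (?g3 - ?g1)"
    using pt[OF V(1,3)] by blast
  obtain C where C: "C \<in> nplane q2 \<inter> nplane q4" "top_view C = top_view V + quarter (?g4 - ?g2)"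
    using pt[OF V(2,4)] by blast
  have "det2 (?g3 - ?g1) (?g4 - ?g2) = p + r" unfolding pqrs by (simp add: tri_def det2_def algebra_simps)
  then have "tri (top_view V) (top_view B) (top_view C) \<noteq> 0"
    unfolding tri_def B(2) C(2) using nz by (simp add: quarter_simps)
  then have hull: "affine hull (nplane q1 \<inter> nplane q3 \<union> nplane q2 \<inter> nplane q4) = nplane Q"
    using in1 in2 V B(1) C(1) by (intro affine_hull_nplane[where A = V and B = B and C = C]) auto
  have grads: "?g1 - grad Q = (s / (q + s)) *\<^sub>R (?g1 - ?g3)" "?g3 - grad Q = (q / (q + s)) *\<^sub>R (?g3 - ?g1)"
    "?g4 - grad Q = (r / (p + r)) *\<^sub>R (?g4 - ?g2)" "?g2 - grad Q = (p / (p + r)) *\<^sub>R (?g2 - ?g4)"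
  proof -
    have *: "u - (1 / (x + y)) *\<^sub>R (x *\<^sub>R u + y *\<^sub>R v) = (y / (x + y)) *\<^sub>R (u - v)" if "x + y \<noteq> 0" for u v :: vec2 and x y
    proof -
      have "u = (1 / (x + y)) *\<^sub>R ((x + y) *\<^sub>R u)" using that by simp
      then have "u - (1 / (x + y)) *\<^sub>R (x *\<^sub>R u + y *\<^sub>R v) = (1 / (x + y)) *\<^sub>R ((x + y) *\<^sub>R u - (x *\<^sub>R u + y *\<^sub>R v))"
        by (metis scaleR_right_diff_distrib)
      also have "\<dots> = (1 / (x + y)) *\<^sub>R (y *\<^sub>R (u - v))" by (simp add: algebra_simps)
      finally show ?thesis by simp
    qed
    show "?g1 - grad Q = (s / (q + s)) *\<^sub>R (?g1 - ?g3)" unfolding Q_def grad_linear using *[of q s ?g1 ?g3] nz by simp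
    show "?g3 - grad Q = (q / (q + s)) *\<^sub>R (?g3 - ?g1)" unfolding Q_def grad_linear using *[of s q ?g3 ?g1] nz by (simp add: add.commute)
    show "?g4 - grad Q = (r / (p + r)) *\<^sub>R (?g4 - ?g2)" unfolding Q' grad_linear using *[of p r ?g4 ?g2] nz by (simp add: add.commute)
    show "?g2 - grad Q = (p / (p + r)) *\<^sub>R (?g2 - ?g4)" unfolding Q' grad_linear using *[of r p ?g2 ?g4] nz by (simp add: add.commute)
  qed
  have ne: "norm (?g1 - ?g3) \<noteq> 0" "norm (?g2 - ?g4) \<noteq> 0"
    using nz unfolding pqrs by (auto simp: tri_def det2_def)
  have i: "iang (nplane q1) (nplane Q) = \<bar>s / (q + s)\<bar> * norm (?g1 - ?g3)" "iang (nplane q3) (nplane Q) = \<bar>q / (q + s)\<bar> * norm (?g1 - ?g3)"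
    "iang (nplane q4) (nplane Q) = \<bar>r / (p + r)\<bar> * norm (?g2 - ?g4)" "iang (nplane q2) (nplane Q) = \<bar>p / (p + r)\<bar> * norm (?g2 - ?g4)"
    unfolding iang_nplane grads norm_scaleR by (simp_all add: norm_minus_commute)
  have ratio: "\<bar>x / t\<bar> * N / (\<bar>y / t\<bar> * N) = x / y" if "N \<noteq> 0" "t \<noteq> 0" "0 < x \<and> 0 < y \<or> x < 0 \<and> y < 0" for x y t N :: real
    using that by (auto simp: abs_divide)
  have "iang (nplane q1) (nplane Q) / iang (nplane q3) (nplane Q) = s / q"
    unfolding i using sg nz by (intro ratio ne) auto
  moreover have "iang (nplane q4) (nplane Q) / iang (nplane q2) (nplane Q) = r / p"
    unfolding i using sg nz by (intro ratio ne) auto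
  ultimately show ?thesis unfolding opp_ratio_def Let_def hull pqrs[symmetric] by (simp add: mult.commute)
qed

section \<open>Opposite ratios in terms of the rates\<close>

context dual_net begin

lemma orat:
  assumes kl: "Suc k < m" "Suc l < n"
  shows "orat_im F (Suc k) (Suc l) = 1 / (cg.b k l)\<^sup>2" "orat_ip F (Suc k) (Suc l) = (cg.b k l)\<^sup>2"
    "orat_jp F (Suc k) (Suc l) = (cg.a k l)\<^sup>2" "orat_jm F (Suc k) (Suc l) = 1 / (cg.a k l)\<^sup>2"
proof -
  let ?q1 = "q k l" and ?q2 = "q (Suc k) l" and ?q3 = "q (Suc k) (Suc l)" and ?q4 = "q k (Suc l)"
  let ?V = "F (Suc k) (Suc l)"
  have f: "face_plane F k l = nplane ?q1" "face_plane F (Suc k) l = nplane ?q2"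
    "face_plane F (Suc k) (Suc l) = nplane ?q3" "face_plane F k (Suc l) = nplane ?q4"
    using fp kl by auto
  have V: "?V \<in> nplane ?q1" "?V \<in> nplane ?q2" "?V \<in> nplane ?q3" "?V \<in> nplane ?q4"
    using face_on[of k l] face_on[of "Suc k" l] face_on[of k "Suc l"] face_on[of "Suc k" "Suc l"] kl by auto
  note cv1 = cv[OF kl]
  have cv2: "convex4 (grad ?q2) (grad ?q3) (grad ?q4) (grad ?q1)" "convex4 (grad ?q3) (grad ?q4) (grad ?q1) (grad ?q2)"
    "convex4 (grad ?q4) (grad ?q1) (grad ?q2) (grad ?q3)" using cv1 unfolding convex4_def by auto
  note sq = rates(3,4)[OF cv1, folded P_def, folded cg.a_def cg.b_def]
  show "orat_im F (Suc k) (Suc l) = 1 / (cg.b k l)\<^sup>2"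
    unfolding orat_im_def diff_Suc_1 f sq opp_ratio_nplane[OF cv1 V] by (simp add: P_def mult_ac)
  show "orat_ip F (Suc k) (Suc l) = (cg.b k l)\<^sup>2"
    unfolding orat_ip_def diff_Suc_1 f sq opp_ratio_nplane[OF cv2(2) V(3,4,1,2)] by (simp add: P_def mult_ac)
  show "orat_jp F (Suc k) (Suc l) = (cg.a k l)\<^sup>2"
    unfolding orat_jp_def diff_Suc_1 f sq opp_ratio_nplane[OF cv2(3) V(4,1,2,3)] by (simp add: P_def mult_ac)
  show "orat_jm F (Suc k) (Suc l) = 1 / (cg.a k l)\<^sup>2"
    unfolding orat_jm_def diff_Suc_1 f sq opp_ratio_nplane[OF cv2(1) V(2,3,4,1)] by (simp add: P_def mult_ac)
qed

lemma rates_matched_iff: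
  "rates_matched m n cg.a cg.b \<longleftrightarrow>
    (\<forall>i j. 0 < i \<and> i + 1 < m \<and> 0 < j \<and> j < n \<longrightarrow> orat_ip F i j = orat_im F (i + 1) j) \<and>
    (\<forall>i j. 0 < i \<and> i < m \<and> 0 < j \<and> j + 1 < n \<longrightarrow> orat_jp F i j = orat_jm F i (j + 1))"
proof -
  \<comment> \<open>Neighbouring rates have the same sign, so the squares in the opposite ratios can
    be removed.\<close>
  have sq: "x\<^sup>2 = 1 / y\<^sup>2 \<longleftrightarrow> y = 1 / x" if "0 < x \<and> 0 < y \<or> x < 0 \<and> y < 0" for x y :: real
  proof -
    have xy: "0 < x * y" using that by (auto simp: zero_less_mult_iff)
    have nz: "x \<noteq> 0" "y \<noteq> 0" using that by auto
    have "x\<^sup>2 = 1 / y\<^sup>2 \<longleftrightarrow> (x * y)\<^sup>2 = 1" using nz by (simp add: power_mult_distrib field_simps)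
    also have "\<dots> \<longleftrightarrow> x * y = 1" using xy by (auto simp: power2_eq_1_iff)
    also have "\<dots> \<longleftrightarrow> y = 1 / x" using nz by (auto simp: field_simps)
    finally show ?thesis .
  qed
  have 1: "(\<forall>i j. 0 < i \<and> i + 1 < m \<and> 0 < j \<and> j < n \<longrightarrow> orat_ip F i j = orat_im F (i + 1) j) \<longleftrightarrow>
    (\<forall>k l. Suc (Suc k) < m \<and> Suc l < n \<longrightarrow> cg.b (Suc k) l = 1 / cg.b k l)" (is "?L \<longleftrightarrow> ?R")
  proof -
    have e: "orat_ip F (Suc k) (Suc l) = orat_im F (Suc (Suc k)) (Suc l) \<longleftrightarrow> cg.b (Suc k) l = 1 / cg.b k l"
      if "Suc (Suc k) < m" "Suc l < n" for k l
      using orat(2)[of k l] orat(1)[of "Suc k" l] sq[of "cg.b k l" "cg.b (Suc k) l"]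
        cg.b_neg[of k l] cg.b_neg[of "Suc k" l] that by simp
    have "?L \<longleftrightarrow> (\<forall>k l. Suc (Suc k) < m \<and> Suc l < n \<longrightarrow> orat_ip F (Suc k) (Suc l) = orat_im F (Suc (Suc k)) (Suc l))"
      by (metis Suc_eq_plus1 Suc_pred zero_less_Suc)
    then show ?thesis using e by blast
  qed
  have 2: "(\<forall>i j. 0 < i \<and> i < m \<and> 0 < j \<and> j + 1 < n \<longrightarrow> orat_jp F i j = orat_jm F i (j + 1)) \<longleftrightarrow>
    (\<forall>k l. Suc k < m \<and> Suc (Suc l) < n \<longrightarrow> cg.a k (Suc l) = 1 / cg.a k l)" (is "?L \<longleftrightarrow> ?R")
  proof -
    have e: "orat_jp F (Suc k) (Suc l) = orat_jm F (Suc k) (Suc (Suc l)) \<longleftrightarrow> cg.a k (Suc l) = 1 / cg.a k l"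
      if "Suc k < m" "Suc (Suc l) < n" for k l
      using orat(3)[of k l] orat(4)[of k "Suc l"] sq[of "cg.a k l" "cg.a k (Suc l)"]
        cg.a_pos[of k l] cg.a_pos[of k "Suc l"] that by simp
    have "?L \<longleftrightarrow> (\<forall>k l. Suc k < m \<and> Suc (Suc l) < n \<longrightarrow> orat_jp F (Suc k) (Suc l) = orat_jm F (Suc k) (Suc (Suc l)))"
      by (metis Suc_eq_plus1 Suc_pred zero_less_Suc)
    then show ?thesis using e by blast
  qed
  show ?thesis unfolding 1 2 rates_matched_def ..
qed

end

section \<open>Common isotropic planes in terms of the rates\<close>

context dual_grid begin

text \<open>The coefficient difference \<open>d\<close> of planes \<open>k\<close> and
  \<open>k + 2\<close> is an affine function whose values at the ends of the edge between faces
  \<open>(Suc k, l)\<close> and \<open>(Suc k, Suc l)\<close> are, up to the factor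
  \<open>\<kappa>\<close>, the areas \<open>det2 u2 v\<close> and \<open>- det2 u1 v\<close>.
  Comparing values and gradients with those of \<open>d'\<close> yields the two area proportions of
  \<open>rates_mirror_iff\<close>.\<close>

lemma proportional_iff_mirrored:
  assumes k: "Suc (Suc k) < m" and l: "Suc l < n"
  shows "(\<exists>\<rho>. q (Suc (Suc k)) (Suc l) - q k (Suc l) = \<rho> *\<^sub>R (q (Suc (Suc k)) l - q k l)) \<longleftrightarrow>
    cg.a (Suc k) l = cg.a k l \<and> cg.b (Suc k) l = 1 / cg.b k l"
proof -
  have kl: "Suc k < m" "Suc l < n" "k < m" "l < n" using k l by auto
  define u1 u2 u1' u2' v where u: "u1 = P (Suc k) l - P k l" "u2 = P (Suc (Suc k)) l - P (Suc k) l"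
    "u1' = P (Suc k) (Suc l) - P k (Suc l)" "u2' = P (Suc (Suc k)) (Suc l) - P (Suc k) (Suc l)"
    "v = P (Suc k) (Suc l) - P (Suc k) l"
  define d d' where d: "d = q (Suc (Suc k)) l - q k l" "d' = q (Suc (Suc k)) (Suc l) - q k (Suc l)"
  define f1 f2 where f12: "f1 = f (Suc k) (Suc l)" "f2 = f (Suc (Suc k)) (Suc l)"
  have gd: "grad d = u1 + u2" "grad d' = u1' + u2'" by (simp_all add: d u grad_linear P_def)
  have v0: "v \<noteq> 0" using cg.edges_nonzero(2)[of "Suc k" l] k l by (simp add: u)
  have "v \<bullet> (f2 - f1) = 0" using perp_l[of "Suc k" l] k l by (simp add: u f12)
  then obtain \<kappa> where \<kappa>: "f2 - f1 = \<kappa> *\<^sub>R quarter v" using perp_eq_quarter[OF v0] by blast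
  have "f2 - f1 \<noteq> 0" using edge_top(4)[of "Suc k" l] kl k by (simp add: f12)
  then have \<kappa>0: "\<kappa> \<noteq> 0" using \<kappa> by auto
  have at1: "aff (q k l) f1 = aff (q (Suc k) l) f1" "aff (q k (Suc l)) f1 = aff (q (Suc k) (Suc l)) f1"
    and at2: "aff (q (Suc k) l) f2 = aff (q (Suc (Suc k)) l) f2" "aff (q (Suc k) (Suc l)) f2 = aff (q (Suc (Suc k)) (Suc l)) f2"
    unfolding f12 using on k l by auto
  \<comment> \<open>At \<open>f1\<close> planes \<open>k\<close> and \<open>Suc k\<close> agree, at
    \<open>f2\<close> planes \<open>Suc k\<close> and \<open>k + 2\<close>; so only the increments
    between the two points along the edge count.\<close>
  have D2: "aff d f2 = - \<kappa> * det2 u1 v" "aff d' f2 = - \<kappa> * det2 u1' v"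
  proof -
    have "aff d f2 = (aff (q (Suc k) l) f2 - aff (q (Suc k) l) f1) - (aff (q k l) f2 - aff (q k l) f1)"
      using at1 at2 by (simp add: d aff_linear)
    also have "\<dots> = u1 \<bullet> (f2 - f1)" unfolding aff_diff by (simp add: u P_def inner_diff_left)
    finally show "aff d f2 = - \<kappa> * det2 u1 v" unfolding \<kappa> by (simp add: quarter_simps)
    have "aff d' f2 = (aff (q (Suc k) (Suc l)) f2 - aff (q (Suc k) (Suc l)) f1) - (aff (q k (Suc l)) f2 - aff (q k (Suc l)) f1)"
      using at1 at2 by (simp add: d aff_linear)
    also have "\<dots> = u1' \<bullet> (f2 - f1)" unfolding aff_diff by (simp add: u P_def inner_diff_left)
    finally show "aff d' f2 = - \<kappa> * det2 u1' v" unfolding \<kappa> by (simp add: quarter_simps)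
  qed
  have D1: "aff d f1 = \<kappa> * det2 u2 v" "aff d' f1 = \<kappa> * det2 u2' v"
  proof -
    have "aff d f2 - aff d f1 = - \<kappa> * (det2 u1 v + det2 u2 v)" "aff d' f2 - aff d' f1 = - \<kappa> * (det2 u1' v + det2 u2' v)"
      unfolding aff_diff gd \<kappa> by (simp_all add: quarter_simps det2_simps algebra_simps)
    then show "aff d f1 = \<kappa> * det2 u2 v" "aff d' f1 = \<kappa> * det2 u2' v" using D2 by (simp_all add: algebra_simps)
  qed
  have t: "tri (P k l) (P (Suc k) l) (P (Suc k) (Suc l)) = det2 u1 v"
    "tri (P (Suc k) l) (P (Suc k) (Suc l)) (P k (Suc l)) = det2 u1' v"
    "tri (P k (Suc l)) (P k l) (P (Suc k) l) = det2 u1 v - det2 u1 u1'"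
    "tri (P (Suc k) l) (P (Suc (Suc k)) l) (P (Suc (Suc k)) (Suc l)) = det2 u2 v + det2 u2 u2'"
    "tri (P (Suc (Suc k)) (Suc l)) (P (Suc k) (Suc l)) (P (Suc k) l) = det2 u2' v"
    "tri (P (Suc k) (Suc l)) (P (Suc k) l) (P (Suc (Suc k)) l) = det2 u2 v"
    by (simp_all add: u tri_def det2_def algebra_simps)
  have nz: "det2 u1 v \<noteq> 0" "det2 u2 v \<noteq> 0"
    using cg.cv[OF kl(1,2)] cg.cv[OF k l] unfolding convex4_def t by auto
  have exp: "det2 x v *\<^sub>R y = det2 y v *\<^sub>R x + det2 x y *\<^sub>R v" for x y
    by (simp add: det2_def prod_eq_iff algebra_simps)
  \<comment> \<open>Expansion of \<open>u1'\<close> and \<open>u2'\<close> in the bases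
    \<open>u1, v\<close> and \<open>u2, v\<close>. If \<open>d'\<close> is a multiple of
    \<open>d\<close>, the component along \<open>v\<close> must vanish, which is the second
    proportion.\<close>
  have main: "(det2 u1 v * det2 u2 v) *\<^sub>R (u1' + u2') = (det2 u2 v * det2 u1' v) *\<^sub>R u1 + (det2 u1 v * det2 u2' v) *\<^sub>R u2
      + (det2 u2 v * det2 u1 u1' + det2 u1 v * det2 u2 u2') *\<^sub>R v"
  proof -
    have "(det2 u1 v * det2 u2 v) *\<^sub>R (u1' + u2') = det2 u2 v *\<^sub>R (det2 u1 v *\<^sub>R u1') + det2 u1 v *\<^sub>R (det2 u2 v *\<^sub>R u2')"
      by (simp add: scaleR_add_right mult.commute)
    also have "\<dots> = det2 u2 v *\<^sub>R (det2 u1' v *\<^sub>R u1 + det2 u1 u1' *\<^sub>R v) + det2 u1 v *\<^sub>R (det2 u2' v *\<^sub>R u2 + det2 u2 u2' *\<^sub>R v)"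
      by (simp only: exp[of u1 u1'] exp[of u2 u2'])
    finally show ?thesis by (simp add: scaleR_add_right scaleR_add_left)
  qed
  have "(\<exists>\<rho>. d' = \<rho> *\<^sub>R d) \<longleftrightarrow> det2 u1' v * det2 u2 v = det2 u2' v * det2 u1 v \<and>
     (det2 u1 v - det2 u1 u1') * det2 u2 v = (det2 u2 v + det2 u2 u2') * det2 u1 v"
  proof
    assume "\<exists>\<rho>. d' = \<rho> *\<^sub>R d"
    then obtain \<rho> where dd: "d' = \<rho> *\<^sub>R d" by blast
    have "\<kappa> * det2 u1' v = \<kappa> * (\<rho> * det2 u1 v)" using D2 unfolding dd aff_linear by algebra
    then have 1: "det2 u1' v = \<rho> * det2 u1 v" using \<kappa>0 by simp
    have "\<kappa> * det2 u2' v = \<kappa> * (\<rho> * det2 u2 v)" using D1 unfolding dd aff_linear by algebra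
    then have 2: "det2 u2' v = \<rho> * det2 u2 v" using \<kappa>0 by simp
    have "u1' + u2' = \<rho> *\<^sub>R (u1 + u2)" unfolding gd[symmetric] dd grad_linear ..
    then have "(det2 u2 v * det2 u1 u1' + det2 u1 v * det2 u2 u2') *\<^sub>R v = 0"
      using main unfolding 1 2 by (simp add: scaleR_add_right algebra_simps)
    then have "det2 u2 v * det2 u1 u1' + det2 u1 v * det2 u2 u2' = 0" using v0 by simp
    then show "det2 u1' v * det2 u2 v = det2 u2' v * det2 u1 v \<and>
     (det2 u1 v - det2 u1 u1') * det2 u2 v = (det2 u2 v + det2 u2 u2') * det2 u1 v"
      unfolding 1 2 by (simp add: algebra_simps)
  next
    assume R: "det2 u1' v * det2 u2 v = det2 u2' v * det2 u1 v \<and>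
     (det2 u1 v - det2 u1 u1') * det2 u2 v = (det2 u2 v + det2 u2 u2') * det2 u1 v"
    define \<rho> where "\<rho> = det2 u1' v / det2 u1 v"
    have 1: "det2 u1' v = \<rho> * det2 u1 v" using nz by (simp add: \<rho>_def)
    then have "det2 u1 v * det2 u2' v = det2 u1 v * (\<rho> * det2 u2 v)" using R by (auto simp: mult_ac)
    then have 2: "det2 u2' v = \<rho> * det2 u2 v" using nz by simp
    have 0: "det2 u2 v * det2 u1 u1' + det2 u1 v * det2 u2 u2' = 0" using R by (simp add: algebra_simps)
    have "(det2 u1 v * det2 u2 v) *\<^sub>R (u1' + u2') = (det2 u1 v * det2 u2 v) *\<^sub>R (\<rho> *\<^sub>R (u1 + u2))"
      unfolding main 0 1 2 by (simp add: scaleR_add_right mult_ac)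
    then have "u1' + u2' = \<rho> *\<^sub>R (u1 + u2)" using nz scaleR_left_imp_eq by (metis mult_eq_0_iff)
    moreover have "aff d' f1 = \<rho> * aff d f1" unfolding D1 2 by simp
    ultimately have "d' = \<rho> *\<^sub>R d" unfolding triple_eq_iff[of _ _ f1] aff_linear grad_linear gd by simp
    then show "\<exists>\<rho>. d' = \<rho> *\<^sub>R d" ..
  qed
  then show ?thesis
    unfolding d cg.a_def cg.b_def rates_mirror_iff[OF cg.cv[OF kl(1,2)] cg.cv[OF k l]] t .
qed

lemma line_in_plane:
  fixes d w :: vec2
  assumes d: "d \<noteq> 0" and sub: "\<And>v. d \<bullet> v + e = 0 \<Longrightarrow> w \<bullet> v = c"
  shows "\<exists>\<mu>. w = \<mu> *\<^sub>R d \<and> c = - \<mu> * e"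
proof -
  define v0 where "v0 = (- e / (d \<bullet> d)) *\<^sub>R d"
  have dd: "d \<bullet> d \<noteq> 0" using d by simp
  have "d \<bullet> v0 + e = 0" using dd by (simp add: v0_def)
  then have 0: "w \<bullet> v0 = c" by (rule sub)
  have "d \<bullet> (v0 + quarter d) + e = 0" using \<open>d \<bullet> v0 + e = 0\<close> by (simp add: inner_add_right quarter_simps det2_simps)
  then have "w \<bullet> (v0 + quarter d) = c" by (rule sub)
  then have w: "w \<bullet> quarter d = 0" using 0 by (simp add: inner_add_right)
  obtain \<mu> where \<mu>: "w = \<mu> *\<^sub>R d"
    using perp_parallel[of "quarter d" d w] w d quarter_perp by blast
  then have "c = - \<mu> * e" using 0 dd by (auto simp: v0_def mult.commute)
  then show ?thesis using \<mu> by blast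
qed

text \<open>In the top view, an isotropic plane is a line and
  \<open>nplane (q k l) \<inter> nplane (q k' l)\<close> is the zero set of the affine function
  \<open>q k' l - q k l\<close>, a line because the gradients differ. Zero lines coincide exactly
  when the functions are proportional.\<close>

lemma common_plane_iff:
  assumes d: "\<And>l. l < n \<Longrightarrow> P k l \<noteq> P k' l"
  shows "(\<exists>S. iso_plane S \<and> (\<forall>l<n. nplane (q k l) \<inter> nplane (q k' l) \<subseteq> S)) \<longleftrightarrow>
    (\<forall>l. Suc l < n \<longrightarrow> (\<exists>\<rho>. q k' (Suc l) - q k (Suc l) = \<rho> *\<^sub>R (q k' l - q k l)))"
proof
  have g: "grad (q k' l - q k l) \<noteq> 0" if "l < n" for l using d[OF that] by (simp add: grad_linear P_def)
  {
    assume "\<exists>S. iso_plane S \<and> (\<forall>l<n. nplane (q k l) \<inter> nplane (q k' l) \<subseteq> S)"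
    then obtain a b c where ab: "(a, b) \<noteq> (0, 0)"
      and S: "\<And>l. l < n \<Longrightarrow> nplane (q k l) \<inter> nplane (q k' l) \<subseteq> {p. a * xc p + b * yc p = c}"
      unfolding iso_plane_def by blast
    have mu: "\<exists>\<mu>. \<mu> \<noteq> 0 \<and> (a, b, - c) = \<mu> *\<^sub>R (q k' l - q k l)" if l: "l < n" for l
    proof -
      let ?D = "q k' l - q k l"
      have "\<exists>\<mu>. (a, b) = \<mu> *\<^sub>R grad ?D \<and> c = - \<mu> * snd (snd ?D)"
      proof (rule line_in_plane[OF g[OF l]])
        fix v assume "grad ?D \<bullet> v + snd (snd ?D) = 0"
        then have "aff ?D v = 0" by (simp add: aff_def)
        then have "aff (q k' l) v = aff (q k l) v" by (simp add: aff_linear)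
        then have "(fst v, snd v, aff (q k l) v) \<in> nplane (q k l) \<inter> nplane (q k' l)"
          by (simp add: mem_nplane top_view_def xc_def yc_def zc_def)
        then have "(fst v, snd v, aff (q k l) v) \<in> {p. a * xc p + b * yc p = c}" using S[OF l] by blast
        then show "(a, b) \<bullet> v = c" by (simp add: xc_def yc_def inner_vec2)
      qed
      then obtain \<mu> where m: "(a, b) = \<mu> *\<^sub>R grad ?D" "c = - \<mu> * snd (snd ?D)" by blast
      then have "(a, b, - c) = \<mu> *\<^sub>R ?D" by (auto simp: grad_def prod_eq_iff)
      moreover have "\<mu> \<noteq> 0" using m(1) ab by (auto simp: zero_prod_def)
      ultimately show ?thesis by blast
    qed
    show "\<forall>l. Suc l < n \<longrightarrow> (\<exists>\<rho>. q k' (Suc l) - q k (Suc l) = \<rho> *\<^sub>R (q k' l - q k l))"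
    proof (intro allI impI)
      fix l assume l: "Suc l < n"
      obtain \<mu> where m: "\<mu> \<noteq> 0" "(a, b, - c) = \<mu> *\<^sub>R (q k' (Suc l) - q k (Suc l))" using mu[OF l] by blast
      obtain \<mu>' where m': "(a, b, - c) = \<mu>' *\<^sub>R (q k' l - q k l)" using mu[of l] l by auto
      have "q k' (Suc l) - q k (Suc l) = (1 / \<mu>) *\<^sub>R (\<mu> *\<^sub>R (q k' (Suc l) - q k (Suc l)))" using m(1) by simp
      also have "\<dots> = (\<mu>' / \<mu>) *\<^sub>R (q k' l - q k l)" unfolding m(2)[symmetric] m' by simp
      finally show "\<exists>\<rho>. q k' (Suc l) - q k (Suc l) = \<rho> *\<^sub>R (q k' l - q k l)" ..
    qed
  }
  {
    assume pr: "\<forall>l. Suc l < n \<longrightarrow> (\<exists>\<rho>. q k' (Suc l) - q k (Suc l) = \<rho> *\<^sub>R (q k' l - q k l))"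
    let ?D = "q k' 0 - q k 0"
    have multiple: "\<exists>\<rho>. q k' l - q k l = \<rho> *\<^sub>R ?D" if "l < n" for l
      using that
    proof (induction l)
      case 0 show ?case by (rule exI[of _ 1]) simp
    next
      case (Suc l)
      then obtain x y where "q k' (Suc l) - q k (Suc l) = y *\<^sub>R (q k' l - q k l)" "q k' l - q k l = x *\<^sub>R ?D"
        using pr by force
      then have "q k' (Suc l) - q k (Suc l) = (y * x) *\<^sub>R ?D" by simp
      then show ?case ..
    qed
    let ?S = "{p. fst (grad ?D) * xc p + snd (grad ?D) * yc p = - snd (snd ?D)}"
    have "iso_plane ?S"
      unfolding iso_plane_def using g[of 0] mn
      by (intro exI[of _ "fst (grad ?D)"] exI[of _ "snd (grad ?D)"] exI[of _ "- snd (snd ?D)"]) (auto simp: prod_eq_iff)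
    moreover have "nplane (q k l) \<inter> nplane (q k' l) \<subseteq> ?S" if l: "l < n" for l
    proof
      fix p assume "p \<in> nplane (q k l) \<inter> nplane (q k' l)"
      then have 0: "aff (q k' l - q k l) (top_view p) = 0" by (simp add: mem_nplane aff_linear)
      obtain \<rho> where e: "q k' l - q k l = \<rho> *\<^sub>R ?D" using multiple[OF l] by blast
      have "\<rho> \<noteq> 0" using g[OF l] unfolding e grad_linear by auto
      then have "aff ?D (top_view p) = 0" using 0 unfolding e aff_linear(3) by simp
      then show "p \<in> ?S" by (simp add: aff_def inner_vec2 top_view_def eq_neg_iff_add_eq_0)
    qed
    ultimately show "\<exists>S. iso_plane S \<and> (\<forall>l<n. nplane (q k l) \<inter> nplane (q k' l) \<subseteq> S)" by blast
  }
qed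

lemma pairs_mirrored_iff:
  assumes d: "\<And>k k' l. k < m \<Longrightarrow> k' < m \<Longrightarrow> k \<noteq> k' \<Longrightarrow> l < n \<Longrightarrow> P k l \<noteq> P k' l"
  shows "pairs_mirrored m n cg.a cg.b \<longleftrightarrow>
    (\<forall>k. k + 3 \<le> m \<longrightarrow> (\<exists>S. iso_plane S \<and> (\<forall>l<n. nplane (q k l) \<inter> nplane (q (k + 2) l) \<subseteq> S)))"
proof -
  have *: "(\<exists>S. iso_plane S \<and> (\<forall>l<n. nplane (q k l) \<inter> nplane (q (k + 2) l) \<subseteq> S)) \<longleftrightarrow>
      (\<forall>l. Suc l < n \<longrightarrow> cg.a (Suc k) l = cg.a k l \<and> cg.b (Suc k) l = 1 / cg.b k l)" if k: "k + 3 \<le> m" for k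
  proof -
    have "Suc (Suc k) < m" using k by simp
    then show ?thesis
      using common_plane_iff[of k "k + 2"] d[of k "k + 2"] proportional_iff_mirrored[of k] by simp
  qed
  have "k + 3 \<le> m \<longleftrightarrow> Suc (Suc k) < m" for k by linarith
  then have "pairs_mirrored m n cg.a cg.b \<longleftrightarrow> (\<forall>k. k + 3 \<le> m \<longrightarrow>
      (\<forall>l. Suc l < n \<longrightarrow> cg.a (Suc k) l = cg.a k l \<and> cg.b (Suc k) l = 1 / cg.b k l))"
    unfolding pairs_mirrored_def by auto
  also have "\<dots> \<longleftrightarrow> (\<forall>k. k + 3 \<le> m \<longrightarrow> (\<exists>S. iso_plane S \<and> (\<forall>l<n. nplane (q k l) \<inter> nplane (q (k + 2) l) \<subseteq> S)))"
    by (rule all_cong1, rule imp_cong[OF refl], rule *[symmetric])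
  finally show ?thesis .
qed

end

lemma transposed_rates:
  "base_rate A D C B = - side_rate A B C D" "side_rate A D C B = - base_rate A B C D"
proof -
  have t: "tri X Z Y = - tri X Y Z" "tri Y X Z = - tri X Y Z" "tri Y Z X = tri X Y Z" for X Y Z
    by (simp_all add: tri_def det2_def algebra_simps)
  have e: "tri D C B = - tri B C D" "tri C B A = - tri A B C" "tri A D C = - tri C D A" "tri B A D = - tri D A B"
    by (simp_all add: tri_def det2_def algebra_simps)
  show "base_rate A D C B = - side_rate A B C D" "side_rate A D C B = - base_rate A B C D"
    unfolding base_rate_def side_rate_def e by (simp_all add: mult_ac)
qed

lemma (in dual_grid) dual_grid_transposed: "dual_grid n m (\<lambda>k l. q l k) (\<lambda>k l. f l k) (\<lambda>k l. z l k)"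
proof
  fix k l assume "Suc k < n" "Suc l < m"
  then show "convex4 (grad (q l k)) (grad (q l (Suc k))) (grad (q (Suc l) (Suc k))) (grad (q (Suc l) k))"
    using cv[of l k] by (auto simp: convex4_def tri_def det2_def algebra_simps)
next
  fix k l assume "k < n" "l < m"
  then show "tri (f l k) (f l (Suc k)) (f (Suc l) k) \<noteq> 0" "tri (f (Suc l) (Suc k)) (f l (Suc k)) (f (Suc l) k) \<noteq> 0"
    using nondeg[of l k] by (auto simp: tri_def det2_def algebra_simps)
qed (use mn on in auto)

theorem theorem1:
  fixes m n :: nat and F :: "nat \<Rightarrow> nat \<Rightarrow> pt"
  assumes dc: "dual_convex m n F"
    and nonpar: "\<forall>k l k' l'. k < m \<and> l < n \<and> k' < m \<and> l' < n \<and> (k, l) \<noteq> (k', l') \<longrightarrow>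
                   \<not> planes_parallel (face_plane F k l) (face_plane F k' l')"
  shows "flexible m n F \<longleftrightarrow>
    (((\<forall>k. k + 3 \<le> m \<longrightarrow> (\<exists>P. iso_plane P \<and>
            (\<forall>l<n. face_plane F k l \<inter> face_plane F (k + 2) l \<subseteq> P))) \<or>
      (\<forall>l. l + 3 \<le> n \<longrightarrow> (\<exists>P. iso_plane P \<and>
            (\<forall>k<m. face_plane F k l \<inter> face_plane F k (l + 2) \<subseteq> P)))) \<or>
     ((\<forall>i j. 0 < i \<and> i + 1 < m \<and> 0 < j \<and> j < n \<longrightarrow> orat_ip F i j = orat_im F (i + 1) j) \<and>
      (\<forall>i j. 0 < i \<and> i < m \<and> 0 < j \<and> j + 1 < n \<longrightarrow> orat_jp F i j = orat_jm F i (j + 1))))"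
proof -
  obtain q where "dual_net m n F q" using dual_net_if_dual_convex[OF dc] by blast
  then interpret dual_net m n F q .
  interpret tr: dual_grid n m "\<lambda>k l. q l k" "\<lambda>k l. f l k" "\<lambda>k l. zc (F l k)" by (rule dual_grid_transposed)
  have distinct: "P k l \<noteq> P k' l'" if kl: "k < m" "l < n" "k' < m" "l' < n" "(k, l) \<noteq> (k', l')" for k l k' l'
  proof
    assume e: "P k l = P k' l'"
    \<comment> \<open>Planes with equal gradients differ by this vertical translation, so they would
      be parallel.\<close>
    define v where "v = ((0, 0, snd (snd (q k' l')) - snd (snd (q k l))) :: pt)"
    have "p \<in> nplane (q k' l') \<longleftrightarrow> p - v \<in> nplane (q k l)" for p
      using e by (auto simp: v_def mem_nplane aff_def P_def top_view_def xc_def yc_def zc_def)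
    moreover have "p \<in> (\<lambda>x. v + x) ` S \<longleftrightarrow> p - v \<in> S" for p and S :: "pt set"
      by (auto intro!: image_eqI[of p _ "p - v"])
    ultimately have "nplane (q k' l') = (\<lambda>x. v + x) ` nplane (q k l)" by blast
    then have "planes_parallel (face_plane F k l) (face_plane F k' l')"
      unfolding planes_parallel_def using fp kl by (intro exI[of _ v]) simp
    then show False using nonpar kl by blast
  qed
  have ab: "rate_grid m n cg.a cg.b"
    using mn cg.a_pos cg.b_neg by unfold_locales auto
  have tr_rates: "tr.cg.a = (\<lambda>k l. - cg.b l k)" "tr.cg.b = (\<lambda>k l. - cg.a l k)"
    unfolding fun_eq_iff tr.cg.a_def tr.cg.b_def cg.a_def cg.b_def tr.P_def P_def
    using transposed_rates by blast+
  have "pairs_mirrored m n cg.a cg.b \<longleftrightarrow>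
    (\<forall>k. k + 3 \<le> m \<longrightarrow> (\<exists>S. iso_plane S \<and> (\<forall>l<n. nplane (q k l) \<inter> nplane (q (k + 2) l) \<subseteq> S)))"
    by (rule pairs_mirrored_iff) (use distinct in simp)
  also have "\<dots> \<longleftrightarrow>
    (\<forall>k. k + 3 \<le> m \<longrightarrow> (\<exists>S. iso_plane S \<and> (\<forall>l<n. face_plane F k l \<inter> face_plane F (k + 2) l \<subseteq> S)))"
    by (intro all_cong1 imp_cong ex_cong1 conj_cong refl) (simp add: fp)
  finally have 1: "pairs_mirrored m n cg.a cg.b \<longleftrightarrow> \<dots>" .
  have "pairs_mirrored n m tr.cg.a tr.cg.b \<longleftrightarrow>
    (\<forall>l. l + 3 \<le> n \<longrightarrow> (\<exists>S. iso_plane S \<and> (\<forall>k<m. nplane (q k l) \<inter> nplane (q k (l + 2)) \<subseteq> S)))"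
    by (rule tr.pairs_mirrored_iff) (use distinct in \<open>simp add: tr.P_def flip: P_def\<close>)
  also have "\<dots> \<longleftrightarrow>
    (\<forall>l. l + 3 \<le> n \<longrightarrow> (\<exists>S. iso_plane S \<and> (\<forall>k<m. face_plane F k l \<inter> face_plane F k (l + 2) \<subseteq> S)))"
    by (intro all_cong1 imp_cong ex_cong1 conj_cong refl) (simp add: fp)
  finally have 2: "pairs_mirrored n m (\<lambda>k l. - cg.b l k) (\<lambda>k l. - cg.a l k) \<longleftrightarrow> \<dots>"
    unfolding tr_rates .
  show ?thesis
    unfolding flexible_iff_rate_motion moving_iff_rates[OF ab] 1 2 rates_matched_iff by blast
qed

end
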